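(* Let $d\ge 2$ and let $\mu$ be a compactly supported Borel probability measure on $\mathbb{R}^d$. Fix $\theta\in[0,1]$, and write $s=\dim_{\mathrm F}^{\theta}\mu$. Define $$\beta(s):=\begin{cases}\dfrac s2, & \theta=0,\\[2ex] \max\left\{\dfrac{s-d\theta}{2},\ \min\left\{\dfrac{s(1+2\theta)-d\theta}{2},\ \dfrac s2,\ \dfrac{s^2}{d}\right\}\right\}, & 0<\theta<\dfrac12,\\[3ex] \min\left\{s-\dfrac{d\theta}{2},\ \dfrac s2\right\}, & \dfrac12\le\theta\le 1.\end{cases}$$ If $\beta(s)>0$, then $$\dim_{\mathrm H} D_x(\operatorname{supp}\mu)\ge\min\{1,\beta(s)\}\quad\text{for }\mu\text{-almost all }x.$$ Moreover, if $\beta(s)>1$, then $\mathcal{L}^1\bigl(D_x(\operatorname{supp}\mu)\bigr)>0$ for $\mu$-almost all $x$.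
   Context: For $E\subseteq\mathbb{R}^d$ and $x\in\mathbb{R}^d$, $D_x(E)=\{|x-y|:y\in E\}$ is the pinned distance set. $\dim_{\mathrm H}$ is Hausdorff dimension and $\mathcal{L}^1$ is 1-dimensional Lebesgue measure on $\mathbb{R}$. For a finite Borel measure $\mu$ on $\mathbb{R}^d$, $\widehat\mu(z)=\int e^{-2\pi i z\cdot x}\,d\mu(x)$. For $s\ge 0$ define $$\mathcal{J}_{s,\theta}(\mu)=\left(\int_{\mathbb{R}^d}|\widehat\mu(z)|^{2/\theta}|z|^{s/\theta-d}\,dz\right)^{\theta}\ (\theta\in(0,1]),\qquad \mathcal{J}_{s,0}(\mu)=\sup_{z\in\mathbb{R}^d}|\widehat\mu(z)|^2|z|^s.$$ The Fourier spectrum of $\mu$ at $\theta\in[0,1]$ is $\dim_{\mathrm F}^{\theta}\mu=\sup\{s\ge 0:\mathcal{J}_{s,\theta}(\mu)<\infty\}$ (with $\sup\emptyset=0$). *)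

theory Defs
  imports "HOL-Probability.Probability"
begin

text \<open>Topological support of a Borel measure.\<close>

definition msupp :: "'a::topological_space measure \<Rightarrow> 'a set" where
  "msupp \<mu> = {x. \<forall>U. open U \<and> x \<in> U \<longrightarrow> emeasure \<mu> U > 0}"

definition pinned_distance_set :: "'a::metric_space \<Rightarrow> 'a set \<Rightarrow> real set" where
  "pinned_distance_set x E = (\<lambda>y. dist x y) ` E"

text \<open>
  Hausdorff measure and dimension. The weight of a covering set is \<open>(diam U)\<^sup>s\<close> with the
  usual conventions \<open>(diam {})\<^sup>s = 0\<close> and \<open>0\<^sup>0 = 1\<close> for nonempty \<open>U\<close>, so that the measure for
  \<open>s = 0\<close> is counting measure. They are spelled out because \<open>0 powr 0 = 0\<close>.
  Covering sets must be bounded because \<^const>\<open>diameter\<close> is unspecified on unbounded sets.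
  Finite covers are included, since covering sets may be empty.
\<close>

definition hausdorff_weight :: "real \<Rightarrow> 'a::metric_space set \<Rightarrow> ennreal" where
  "hausdorff_weight s U =
     (if U = {} then 0 else if s = 0 then 1 else ennreal (diameter U powr s))"

definition hausdorff_premeasure :: "real \<Rightarrow> real \<Rightarrow> 'a::metric_space set \<Rightarrow> ennreal" where
  "hausdorff_premeasure s \<delta> E =
     Inf {(\<Sum>i. hausdorff_weight s (U i)) | U :: nat \<Rightarrow> 'a set.
            E \<subseteq> (\<Union>i. U i) \<and> (\<forall>i. bounded (U i) \<and> diameter (U i) \<le> \<delta>)}"

definition hausdorff_measure :: "real \<Rightarrow> 'a::metric_space set \<Rightarrow> ennreal" where
  "hausdorff_measure s E = (SUP \<delta>\<in>{0<..}. hausdorff_premeasure s \<delta> E)"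

definition hausdorff_dim :: "'a::metric_space set \<Rightarrow> ereal" where
  "hausdorff_dim E = Inf {ereal s | s. 0 \<le> s \<and> hausdorff_measure s E = 0}"

definition fourier_transform :: "'a::euclidean_space measure \<Rightarrow> 'a \<Rightarrow> complex" where
  "fourier_transform \<mu> z = (LINT x|\<mu>. exp (- 2 * of_real pi * \<i> * of_real (z \<bullet> x)))"

text \<open>Power of an extended nonnegative real, intended for exponents \<open>a > 0\<close>.\<close>

definition ennreal_powr :: "ennreal \<Rightarrow> real \<Rightarrow> ennreal" where
  "ennreal_powr x a = (if x = \<infinity> then \<infinity> else ennreal (enn2real x powr a))"

text \<open>
  The value \<open>0 powr a = 0\<close> at the single point \<open>z = 0\<close> is harmless: that point is Lebesgue-null,
  and for \<open>\<theta> = s = 0\<close> the supremum is unchanged because \<^const>\<open>fourier_transform\<close> of a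
  finite measure is continuous.
\<close>

definition fourier_energy :: "real \<Rightarrow> real \<Rightarrow> 'a::euclidean_space measure \<Rightarrow> ennreal" where
  "fourier_energy s \<theta> \<mu> =
     (if \<theta> = 0
      then (SUP z. ennreal ((cmod (fourier_transform \<mu> z))\<^sup>2 * norm z powr s))
      else ennreal_powr
             (\<integral>\<^sup>+ z. ennreal (cmod (fourier_transform \<mu> z) powr (2 / \<theta>)
                            * norm z powr (s / \<theta> - real DIM('a))) \<partial>lborel) \<theta>)"

text \<open>
  The supremum may be infinite (e.g. for measures with smooth density), hence the type
  \<^typ>\<open>ereal\<close>; inserting \<open>0\<close> encodes the convention that the supremum of the empty set is \<open>0\<close>.
\<close>

definition fourier_spectrum :: "real \<Rightarrow> 'a::euclidean_space measure \<Rightarrow> ereal" where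
  "fourier_spectrum \<theta> \<mu> =
     Sup (insert 0 {ereal s | s. 0 \<le> s \<and> fourier_energy s \<theta> \<mu> < \<infinity>})"

definition beta :: "nat \<Rightarrow> real \<Rightarrow> ereal \<Rightarrow> ereal" where
  "beta d \<theta> s =
     (if \<theta> = 0 then s / 2
      else if \<theta> < 1 / 2 then
        max ((s - ereal (real d * \<theta>)) / 2)
            (min ((s * ereal (1 + 2 * \<theta>) - ereal (real d * \<theta>)) / 2)
                 (min (s / 2) (s\<^sup>2 / ereal (real d))))
      else min (s - ereal (real d * \<theta> / 2)) (s / 2))"

end

theory Submission
  imports Defs
begin

text \<open>
  Write \<open>G x = exp (- \<pi> |x|\<^sup>2)\<close>, let \<open>m\<close> be the modulus of the Fourier transform of \<open>\<mu>\<close>, let \<open>d\<close>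
  be the dimension and let \<open>\<nu>\<close> be the law of \<open>y' - y\<close> for independent \<open>\<mu>\<close>-distributed \<open>y\<close>, \<open>y'\<close>.
  Both claims follow from one averaged estimate: for every \<open>b \<in> (0, 1]\<close> with \<open>b < \<beta>(s)\<close>, the
  \<open>\<mu> \<otimes> \<mu> \<otimes> \<mu>\<close>-mass of the triples \<open>(x, y, y')\<close> with \<open>| |x - y| - |x - y'| | \<le> r\<close> is \<open>O(r\<^sup>b)\<close>. For
  fixed \<open>x\<close> this mass is the probability that two independent samples of the distance to \<open>x\<close> are
  \<open>r\<close>-close. Summing over dyadic \<open>r\<close> gives, for almost every \<open>x\<close>, a Frostman condition on a set of
  positive mass, hence positive Hausdorff measure in every dimension below \<open>b\<close>
  (\<open>hausdorff_measure_pos\<close>); for \<open>b = 1\<close>, Fatou's lemma gives a bound linear in \<open>r\<close> along a sequence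
  of radii, hence positive length (\<open>lborel_pos_of_pair_correlation\<close>).

  The triple estimate is obtained in Fourier space. The difference \<open>|x - y|\<^sup>2 - |x - y'|\<^sup>2\<close> is affine
  in \<open>x\<close>, so integrating a character of it over \<open>x\<close> produces the Fourier transform of \<open>\<mu>\<close> at a multiple
  of \<open>y' - y\<close>. Inserting the weight \<open>G x\<close>, which is bounded below on the support, replaces this by the
  transform of \<open>G \<mu>\<close>, which is the convolution of \<open>G\<close> with the transform of \<open>\<mu>\<close>. The convolution can
  be moved to the other factor, and what remains is the decay in \<open>t\<close> of \<open>E(t) = \<integral> m(u) N\<^sub>t(u) du\<close>, where
  \<open>N\<^sub>t(u) = \<integral> G(t w - u) d\<nu>(w)\<close> (\<open>triple_gauss_le\<close>, \<open>weighted_fourier_difference_le\<close>).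

  For \<open>0 < \<theta> < 1\<close> and \<open>c = (s - d \<theta>) / (2 (1 - \<theta>))\<close>, a three-fold Hoelder inequality bounds \<open>E(t)\<close> by
  the product of
  \<open>(\<integral> m\<^bsup>2/\<theta>\<^esup> |u|\<^bsup>s/\<theta> - d\<^esup> du)\<^bsup>\<theta>/2\<^esup>\<close>, \<open>(\<integral> |u|\<^bsup>-c\<^esup> N\<^sub>t du)\<^bsup>1 - \<theta>\<^esup>\<close> and \<open>(\<integral> N\<^sub>t\<^sup>2 du)\<^bsup>\<theta>/2\<^esup>\<close>.
  The first factor is finite by hypothesis. The second integral is \<open>O(t\<^bsup>-c\<^esup>)\<close>: if \<open>c < 0\<close>,
  because \<open>N\<^sub>t\<close> lives at distance \<open>O(t)\<close> from the origin, and if \<open>c \<ge> 0\<close>, because it has little mass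
  near the origin when \<open>\<integral> m\<^sup>2 |z|\<^bsup>r - d\<^esup> dz\<close> is finite for some \<open>r > c\<close> with \<open>r \<le> d\<close>. The third is
  \<open>O(t\<^bsup>-q\<^esup>)\<close> as soon as \<open>q \<le> d\<close> and \<open>\<integral> m\<^sup>4 |z|\<^bsup>q - d\<^esup> dz\<close> is finite. Hence \<open>E(t) = O(t\<^bsup>-\<sigma>\<^esup>)\<close> with
  \<open>\<sigma> = (s - d \<theta> + q \<theta>) / 2\<close> (\<open>fourier_smoothed_difference_decay\<close>). Finiteness of one moment of \<open>m\<close>
  implies finiteness of others (\<open>fourier_moment_mono\<close>), and \<open>q\<close> may be taken close to the smaller
  of \<open>d\<close> and \<open>s min(2, 1/\<theta>)\<close>, so that \<open>\<sigma>\<close> comes close to the smaller of \<open>s / 2\<close> and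
  \<open>(s - d \<theta>) / 2 + s min(\<theta>, 1/2)\<close>. This minimum is at least \<open>\<beta>(s)\<close>: in the case
  \<open>0 < \<theta> < 1/2\<close>, \<open>(s - d \<theta>) / 2\<close> lies below both of its terms, and \<open>s\<^sup>2 / d\<close> enters only as a further
  member of the inner minimum. The endpoints \<open>\<theta> = 0\<close> and \<open>\<theta> = 1\<close>
  are approached from the interior (\<open>interior_fourier_moment\<close>), and an \<open>s\<close> that is too large for the
  estimate of the second factor is first lowered (\<open>admissible_exponents\<close>).
\<close>

section \<open>Gaussians and affine changes of variables\<close>

text \<open>
  Normalised so as to be its own Fourier transform and to have integral 1.
\<close>

definition gauss :: "'a::euclidean_space \<Rightarrow> real" where
  "gauss x = exp (- pi * (norm x)\<^sup>2)"

lemma gauss_measurable [measurable]: "gauss \<in> borel_measurable borel"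
  unfolding gauss_def by measurable

lemma gauss_bounds: "0 < gauss x" "gauss x \<le> 1"
  by (auto simp: gauss_def)

lemma gauss_eq_prod: "gauss x = (\<Prod>b\<in>Basis. exp (- pi * (x \<bullet> b)\<^sup>2))"
proof -
  have "(norm x)\<^sup>2 = (\<Sum>b\<in>Basis. (x \<bullet> b)\<^sup>2)"
    by (simp add: norm_eq_sqrt_inner euclidean_inner[of x x] power2_eq_square sum_nonneg)
  then show ?thesis
    by (simp add: gauss_def sum_distrib_left exp_sum)
qed

text \<open>
  A rescaling of the characteristic function of the standard normal law.
\<close>

lemma gauss_real_fourier:
  fixes t :: real
  shows "integrable lborel (\<lambda>x::real. exp (- pi * x\<^sup>2))"
    and "(LINT x|lborel. of_real (exp (- pi * x\<^sup>2)) * exp (- 2 * of_real pi * \<i> * of_real (t * x)))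
          = complex_of_real (exp (- pi * t\<^sup>2))"
proof -
  define c where "c = sqrt (2 * pi)"
  have c: "c > 0" "c\<^sup>2 = 2 * pi" by (auto simp: c_def)
  have *: "std_normal_density (0 + c * x) = exp (- pi * x\<^sup>2) / c" for x
    using c(2) by (simp add: std_normal_density_def c_def[symmetric] power_mult_distrib)
  have "integrable lborel (\<lambda>x. c * std_normal_density (0 + c * x))"
    using c(1) by (intro integrable_mult_right lborel_integrable_real_affine integrable_normal_density) auto
  then show "integrable lborel (\<lambda>x::real. exp (- pi * x\<^sup>2))"
    using c(1) unfolding * by simp
  define s where "s = - 2 * pi * t / c"
  have s2: "- s\<^sup>2 / 2 = - pi * t\<^sup>2"
    using c by (simp add: s_def power_divide power_mult_distrib) (simp add: power2_eq_square)
  have "complex_of_real (exp (- s\<^sup>2 / 2)) = char std_normal_distribution s"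
    using char_std_normal_distribution by (simp add: fun_eq_iff)
  also have "\<dots> = (LINT x|lborel. std_normal_density x *\<^sub>R iexp (s * x))"
    unfolding char_def by (subst integral_density) auto
  also have "\<dots> = \<bar>c\<bar> *\<^sub>R (LINT x|lborel. std_normal_density (0 + c * x) *\<^sub>R iexp (s * (0 + c * x)))"
    using c(1) by (intro lborel_integral_real_affine) auto
  also have "\<dots> = (LINT x|lborel. \<bar>c\<bar> *\<^sub>R (std_normal_density (0 + c * x) *\<^sub>R iexp (s * (0 + c * x))))"
    by (simp only: integral_scaleR_right)
  also have "\<dots> = (LINT x|lborel. of_real (exp (- pi * x\<^sup>2)) * exp (- 2 * of_real pi * \<i> * of_real (t * x)))"
    unfolding * using c(1)
    by (intro Bochner_Integration.integral_cong refl) (simp add: scaleR_conv_of_real s_def algebra_simps)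
  finally show "(LINT x|lborel. of_real (exp (- pi * x\<^sup>2)) * exp (- 2 * of_real pi * \<i> * of_real (t * x)))
          = complex_of_real (exp (- pi * t\<^sup>2))"
    unfolding s2 by simp
qed

text \<open>
  Both sides factor over the coordinates.
\<close>

lemma gauss_fourier:
  fixes z :: "'a::euclidean_space"
  shows "(LINT x|lborel. of_real (gauss x) * exp (- 2 * of_real pi * \<i> * of_real (z \<bullet> x)))
          = complex_of_real (gauss z)"
proof -
  let ?f = "\<lambda>b (x::real). of_real (exp (- pi * x\<^sup>2)) * exp (- 2 * of_real pi * \<i> * of_real ((z \<bullet> b) * x))"
  interpret product_sigma_finite "\<lambda>_::'a. lborel::real measure" ..
  have int: "integrable lborel (?f b)" for b
    by (rule Bochner_Integration.integrable_bound[OF gauss_real_fourier(1)])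
       (auto simp: norm_mult norm_exp_eq_Re)
  have prod: "of_real (gauss x) * exp (- 2 * of_real pi * \<i> * of_real (z \<bullet> x)) = (\<Prod>b\<in>Basis. ?f b (x \<bullet> b))"
    for x :: 'a
  proof -
    have "z \<bullet> x = (\<Sum>b\<in>Basis. (z \<bullet> b) * (x \<bullet> b))" by (rule euclidean_inner)
    then show ?thesis
      by (simp add: gauss_eq_prod prod.distrib exp_sum[symmetric] sum_distrib_left sum_negf
                    of_real_prod[symmetric] del: of_real_prod of_real_exp)
  qed
  have "(LINT x|lborel. of_real (gauss x) * exp (- 2 * of_real pi * \<i> * of_real (z \<bullet> x)))
     = (LINT x|(\<Pi>\<^sub>M b\<in>Basis. lborel). (\<Prod>b\<in>Basis. ?f b ((\<Sum>b\<in>Basis. x b *\<^sub>R b) \<bullet> b)))"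
    unfolding prod by (subst lborel_eq, subst integral_distr) simp_all
  also have "\<dots> = (LINT x|(\<Pi>\<^sub>M b\<in>Basis. lborel). (\<Prod>b\<in>(Basis::'a set). ?f b (x b)))"
    by (intro Bochner_Integration.integral_cong prod.cong refl) (simp add: inner_sum_left inner_Basis if_distrib cong: if_cong)
  also have "\<dots> = (\<Prod>b\<in>Basis. integral\<^sup>L lborel (?f b))"
    using int by (intro product_integral_prod) auto
  also have "\<dots> = (\<Prod>b\<in>Basis. of_real (exp (- pi * (z \<bullet> b)\<^sup>2)))"
    by (simp only: gauss_real_fourier(2))
  also have "\<dots> = of_real (gauss z)" by (simp add: gauss_eq_prod)
  finally show ?thesis .
qed

lemma nn_integral_gauss: "(\<integral>\<^sup>+x. ennreal (gauss (x::'a::euclidean_space)) \<partial>lborel) = 1"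
proof -
  have "(\<integral>\<^sup>+x. ennreal (exp (- pi * x\<^sup>2)) \<partial>lborel) = ennreal (LINT x|lborel. exp (- pi * x\<^sup>2))"
    by (intro nn_integral_eq_integral gauss_real_fourier) auto
  also have "complex_of_real (LINT x|lborel. exp (- pi * x\<^sup>2)) = 1"
    using gauss_real_fourier(2)[of 0] by simp
  then have "(LINT x|lborel. exp (- pi * x\<^sup>2)) = 1" by (simp only: of_real_eq_1_iff)
  finally have *: "(\<integral>\<^sup>+x. ennreal (exp (- pi * x\<^sup>2)) \<partial>lborel) = 1" by simp
  have "(\<integral>\<^sup>+x. ennreal (gauss (x::'a)) \<partial>lborel) = (\<integral>\<^sup>+x. (\<Prod>b\<in>Basis. ennreal (exp (- pi * ((x::'a) \<bullet> b)\<^sup>2))) \<partial>lborel)"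
    by (subst prod_ennreal) (simp_all add: gauss_eq_prod)
  also have "\<dots> = (\<Prod>b\<in>(Basis::'a set). (\<integral>\<^sup>+x. ennreal (exp (- pi * x\<^sup>2)) \<partial>lborel))"
    by (rule nn_integral_lborel_prod) auto
  finally show ?thesis using * by simp
qed

lemma integrable_gauss: "integrable lborel (gauss :: 'a::euclidean_space \<Rightarrow> real)"
  by (intro integrableI_nonneg) (auto simp: nn_integral_gauss less_imp_le[OF gauss_bounds(1)])

lemma nn_integral_lborel_affine:
  fixes t :: "'a::euclidean_space"
  assumes [measurable]: "f \<in> borel_measurable borel" and c: "c \<noteq> 0"
  shows "(\<integral>\<^sup>+x. f (t + c *\<^sub>R x) \<partial>lborel) = ennreal (1 / \<bar>c\<bar> ^ DIM('a)) * (\<integral>\<^sup>+x. f x \<partial>lborel)"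
proof -
  have "(\<integral>\<^sup>+x. f x \<partial>lborel) = ennreal (\<bar>c\<bar> ^ DIM('a)) * (\<integral>\<^sup>+x. f (t + c *\<^sub>R x) \<partial>lborel)"
    by (subst lborel_affine[OF c, of t]) (simp add: nn_integral_density nn_integral_distr nn_integral_cmult)
  then have "ennreal (1 / \<bar>c\<bar> ^ DIM('a)) * (\<integral>\<^sup>+x. f x \<partial>lborel)
     = (ennreal (1 / \<bar>c\<bar> ^ DIM('a)) * ennreal (\<bar>c\<bar> ^ DIM('a))) * (\<integral>\<^sup>+x. f (t + c *\<^sub>R x) \<partial>lborel)"
    by (simp add: mult.assoc)
  also have "ennreal (1 / \<bar>c\<bar> ^ DIM('a)) * ennreal (\<bar>c\<bar> ^ DIM('a)) = 1"
    using c by (subst ennreal_mult[symmetric]) auto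
  finally show ?thesis by simp
qed

lemma nn_integral_gauss_affine:
  fixes t :: "'a::euclidean_space"
  assumes "c \<noteq> 0"
  shows "(\<integral>\<^sup>+x. ennreal (gauss (t + c *\<^sub>R x)) \<partial>lborel) = ennreal (1 / \<bar>c\<bar> ^ DIM('a))"
  using nn_integral_lborel_affine[of "\<lambda>x. ennreal (gauss x)" c t] assms by (simp add: nn_integral_gauss)

section \<open>Fourier transforms and the difference law\<close>

lemma fourier_transform_measurable:
  fixes \<mu> :: "'a::euclidean_space measure"
  assumes "finite_measure \<mu>" and [measurable_cong]: "sets \<mu> = sets borel"
  shows "fourier_transform \<mu> \<in> borel_measurable borel"
proof -
  interpret finite_measure \<mu> by fact
  show ?thesis unfolding fourier_transform_def by measurable
qed

lemma cmod_fourier_transform_le: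
  fixes \<mu> :: "'a::euclidean_space measure"
  assumes "prob_space \<mu>" and "sets \<mu> = sets borel"
  shows "cmod (fourier_transform \<mu> z) \<le> 1"
proof -
  interpret prob_space \<mu> by fact
  have "cmod (fourier_transform \<mu> z) \<le> (LINT x|\<mu>. cmod (exp (- 2 * of_real pi * \<i> * of_real (z \<bullet> x))))"
    unfolding fourier_transform_def by (rule integral_norm_bound)
  also have "\<dots> = 1" by (simp add: norm_exp_eq_Re prob_space)
  finally show ?thesis .
qed

text \<open>
  Replace the Gaussian by its own Fourier integral and exchange the integrals. The case \<open>z = 0\<close> is
  the form of Parseval's identity used below; the case \<open>c = 1\<close> says that multiplying a measure by
  the Gaussian averages its Fourier transform over a unit scale.
\<close>

lemma gauss_weighted_integral_fourier:
  fixes \<mu> :: "'a::euclidean_space measure"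
  assumes "finite_measure \<mu>" and [measurable_cong]: "sets \<mu> = sets borel"
  shows "(LINT w|\<mu>. of_real (gauss (c *\<^sub>R w)) * exp (- 2 * of_real pi * \<i> * of_real (z \<bullet> w)))
          = (LINT \<xi>|lborel. of_real (gauss \<xi>) * fourier_transform \<mu> (z + c *\<^sub>R \<xi>))"
proof -
  interpret finite_measure \<mu> by fact
  interpret pair_sigma_finite \<mu> "lborel :: 'a measure" ..
  let ?f = "\<lambda>w \<xi>. of_real (gauss \<xi>) * exp (- 2 * of_real pi * \<i> * of_real ((z + c *\<^sub>R \<xi>) \<bullet> w))"
  have nf: "norm (?f w \<xi>) = gauss \<xi>" for w \<xi>
    using gauss_bounds(1)[of \<xi>] by (simp add: norm_mult norm_exp_eq_Re)
  have meas: "case_prod ?f \<in> borel_measurable (\<mu> \<Otimes>\<^sub>M lborel)" by measurable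
  have int: "integrable (\<mu> \<Otimes>\<^sub>M lborel) (case_prod ?f)"
  proof (rule Fubini_integrable[OF meas])
    show "integrable \<mu> (\<lambda>x. LINT y|lborel. norm (case_prod ?f (x, y)))"
      unfolding prod.case nf by simp
    show "AE x in \<mu>. integrable lborel (\<lambda>y. case_prod ?f (x, y))"
    proof (rule AE_I2)
      fix x :: 'a
      show "integrable lborel (\<lambda>y. case_prod ?f (x, y))"
        by (rule Bochner_Integration.integrable_bound[OF integrable_gauss]) (simp, unfold prod.case nf, simp)
    qed
  qed
  have "(LINT w|\<mu>. of_real (gauss (c *\<^sub>R w)) * exp (- 2 * of_real pi * \<i> * of_real (z \<bullet> w)))
      = (LINT w|\<mu>. LINT \<xi>|lborel. ?f w \<xi>)"
  proof (intro Bochner_Integration.integral_cong refl)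
    fix w :: 'a
    have "?f w \<xi> = (of_real (gauss \<xi>) * exp (- 2 * of_real pi * \<i> * of_real ((c *\<^sub>R w) \<bullet> \<xi>)))
                    * exp (- 2 * of_real pi * \<i> * of_real (z \<bullet> w))" for \<xi>
      by (simp add: inner_add_left inner_commute exp_add[symmetric] algebra_simps)
    then show "of_real (gauss (c *\<^sub>R w)) * exp (- 2 * of_real pi * \<i> * of_real (z \<bullet> w)) = (LINT \<xi>|lborel. ?f w \<xi>)"
      by (simp only: integral_mult_left_zero gauss_fourier)
  qed
  also have "\<dots> = (LINT \<xi>|lborel. LINT w|\<mu>. ?f w \<xi>)"
    using Fubini_integral[OF int] by simp
  also have "\<dots> = (LINT \<xi>|lborel. of_real (gauss \<xi>) * fourier_transform \<mu> (z + c *\<^sub>R \<xi>))"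
    unfolding fourier_transform_def by (simp only: integral_mult_right_zero)
  finally show ?thesis .
qed

definition difference_law :: "'a::euclidean_space measure \<Rightarrow> 'a measure" where
  "difference_law \<mu> = distr (\<mu> \<Otimes>\<^sub>M \<mu>) borel (\<lambda>(x, y). y - x)"

lemma sets_difference_law [simp, measurable_cong]: "sets (difference_law \<mu>) = sets borel"
  by (simp add: difference_law_def)

lemma prob_space_difference_law:
  assumes "prob_space \<mu>" and [measurable_cong]: "sets \<mu> = sets borel"
  shows "prob_space (difference_law \<mu>)"
proof -
  interpret prob_space \<mu> by fact
  interpret pair_prob_space \<mu> \<mu> ..
  show ?thesis unfolding difference_law_def by (rule prob_space_distr) measurable
qed

lemma nn_integral_difference_law:
  fixes \<mu> :: "'a::euclidean_space measure"
  assumes "prob_space \<mu>" and [measurable_cong]: "sets \<mu> = sets borel"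
    and [measurable]: "f \<in> borel_measurable borel"
  shows "(\<integral>\<^sup>+w. f w \<partial>difference_law \<mu>) = (\<integral>\<^sup>+x. \<integral>\<^sup>+y. f (y - x) \<partial>\<mu> \<partial>\<mu>)"
proof -
  interpret prob_space \<mu> by fact
  have "(\<integral>\<^sup>+w. f w \<partial>difference_law \<mu>) = (\<integral>\<^sup>+p. f (snd p - fst p) \<partial>(\<mu> \<Otimes>\<^sub>M \<mu>))"
    unfolding difference_law_def by (subst nn_integral_distr) (simp_all add: case_prod_beta)
  also have "\<dots> = (\<integral>\<^sup>+x. \<integral>\<^sup>+y. f (y - x) \<partial>\<mu> \<partial>\<mu>)"
    using nn_integral_fst[of "\<lambda>p. f (snd p - fst p)" \<mu>] by simp
  finally show ?thesis .
qed

text \<open>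
  The law is the convolution of \<open>\<mu>\<close> with its reflection, whose transform is the complex conjugate.
\<close>

lemma fourier_transform_difference_law:
  fixes \<mu> :: "'a::euclidean_space measure"
  assumes "prob_space \<mu>" and [measurable_cong]: "sets \<mu> = sets borel"
  shows "fourier_transform (difference_law \<mu>) z = of_real ((cmod (fourier_transform \<mu> z))\<^sup>2)"
proof -
  interpret prob_space \<mu> by fact
  interpret pair_prob_space \<mu> \<mu> ..
  let ?e = "\<lambda>x. exp (- 2 * of_real pi * \<i> * of_real (z \<bullet> x))"
  have cnj: "cnj (?e x) = exp (2 * of_real pi * \<i> * of_real (z \<bullet> x))" for x
    by (simp add: exp_cnj)
  have "fourier_transform (difference_law \<mu>) z = (LINT p|(\<mu> \<Otimes>\<^sub>M \<mu>). cnj (?e (fst p)) * ?e (snd p))"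
    unfolding fourier_transform_def difference_law_def cnj
    by (subst integral_distr)
       (auto simp: case_prod_beta inner_diff_right exp_add[symmetric] algebra_simps
             intro!: Bochner_Integration.integral_cong)
  also have "\<dots> = (LINT x|\<mu>. LINT y|\<mu>. cnj (?e x) * ?e y)"
    by (subst integral_fst'[symmetric])
       (auto intro!: P.integrable_const_bound[where B = 1] simp: exp_cnj norm_mult norm_exp_eq_Re)
  also have "\<dots> = cnj (fourier_transform \<mu> z) * fourier_transform \<mu> z"
    unfolding fourier_transform_def by (simp only: integral_mult_right_zero integral_mult_left_zero Bochner_Integration.integral_cnj)
  also have "\<dots> = of_real ((cmod (fourier_transform \<mu> z))\<^sup>2)"
    by (metis complex_norm_square mult.commute)
  finally show ?thesis .
qed

text \<open>
  The frequency side is nonnegative because the transform of a difference law is.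
\<close>

lemma gauss_parseval:
  fixes \<mu> :: "'a::euclidean_space measure"
  assumes p: "prob_space \<mu>" and s[measurable_cong]: "sets \<mu> = sets borel"
  shows "(\<integral>\<^sup>+w. ennreal (gauss (c *\<^sub>R w)) \<partial>difference_law \<mu>)
          = (\<integral>\<^sup>+\<xi>. ennreal (gauss \<xi> * (cmod (fourier_transform \<mu> (c *\<^sub>R \<xi>)))\<^sup>2) \<partial>lborel)"
proof -
  interpret D: prob_space "difference_law \<mu>" using p s by (rule prob_space_difference_law)
  have [measurable]: "fourier_transform \<mu> \<in> borel_measurable borel"
    using p s by (intro fourier_transform_measurable) (auto simp: prob_space_def)
  let ?m = "\<lambda>\<xi>. (cmod (fourier_transform \<mu> (c *\<^sub>R \<xi>)))\<^sup>2"
  have le: "\<bar>?m \<xi>\<bar> \<le> 1" for \<xi>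
    using cmod_fourier_transform_le[OF p s, of "c *\<^sub>R \<xi>"] by (simp add: power_le_one)
  have "of_real (LINT w|difference_law \<mu>. gauss (c *\<^sub>R w)) = (LINT w|difference_law \<mu>. complex_of_real (gauss (c *\<^sub>R w)))"
    by (rule integral_complex_of_real[symmetric])
  also have "\<dots> = (LINT \<xi>|lborel. of_real (gauss \<xi>) * of_real (?m \<xi>))"
    using gauss_weighted_integral_fourier[of "difference_law \<mu>" c 0] D.finite_measure_axioms
    by (simp add: fourier_transform_difference_law[OF p s])
  also have "\<dots> = (LINT \<xi>|lborel. complex_of_real (gauss \<xi> * ?m \<xi>))" by (simp only: of_real_mult)
  also have "\<dots> = of_real (LINT \<xi>|lborel. gauss \<xi> * ?m \<xi>)" by (rule integral_complex_of_real)
  finally have eq: "(LINT w|difference_law \<mu>. gauss (c *\<^sub>R w)) = (LINT \<xi>|lborel. gauss \<xi> * ?m \<xi>)"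
    by (simp only: of_real_eq_iff)
  have "(\<integral>\<^sup>+w. ennreal (gauss (c *\<^sub>R w)) \<partial>difference_law \<mu>) = ennreal (LINT w|difference_law \<mu>. gauss (c *\<^sub>R w))"
    by (intro nn_integral_eq_integral D.integrable_const_bound[where B = 1])
       (auto simp: gauss_bounds less_imp_le[OF gauss_bounds(1)])
  also have "\<dots> = (\<integral>\<^sup>+\<xi>. ennreal (gauss \<xi> * ?m \<xi>) \<partial>lborel)"
    unfolding eq
  proof (rule nn_integral_eq_integral[symmetric])
    show "integrable lborel (\<lambda>\<xi>. gauss \<xi> * ?m \<xi>)"
      using le by (intro Bochner_Integration.integrable_bound[OF integrable_gauss])
        (auto simp: abs_mult less_imp_le[OF gauss_bounds(1)] mult_left_le)
  qed (auto simp: less_imp_le[OF gauss_bounds(1)])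
  finally show ?thesis .
qed

text \<open>
  The previous identity for the difference law in place of \<open>\<mu>\<close>; squaring the squared modulus
  produces the fourth power.
\<close>

lemma gauss_parseval_difference_law:
  fixes \<mu> :: "'a::euclidean_space measure"
  assumes p: "prob_space \<mu>" and s: "sets \<mu> = sets borel"
  shows "(\<integral>\<^sup>+v. \<integral>\<^sup>+w. ennreal (gauss (c *\<^sub>R (w - v))) \<partial>difference_law \<mu> \<partial>difference_law \<mu>)
          = (\<integral>\<^sup>+\<xi>. ennreal (gauss \<xi> * cmod (fourier_transform \<mu> (c *\<^sub>R \<xi>)) ^ 4) \<partial>lborel)"
proof -
  have D: "prob_space (difference_law \<mu>)" using p s by (rule prob_space_difference_law)
  have "(\<integral>\<^sup>+v. \<integral>\<^sup>+w. ennreal (gauss (c *\<^sub>R (w - v))) \<partial>difference_law \<mu> \<partial>difference_law \<mu>)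
     = (\<integral>\<^sup>+w. ennreal (gauss (c *\<^sub>R w)) \<partial>difference_law (difference_law \<mu>))"
    by (subst nn_integral_difference_law[OF D]) simp_all
  also have "\<dots> = (\<integral>\<^sup>+\<xi>. ennreal (gauss \<xi> * cmod (fourier_transform \<mu> (c *\<^sub>R \<xi>)) ^ 4) \<partial>lborel)"
    by (subst gauss_parseval[OF D])
       (simp_all add: fourier_transform_difference_law[OF p s] norm_power flip: power_mult)
  finally show ?thesis .
qed

section \<open>The smoothed difference law\<close>

text \<open>
  Up to the factor \<open>t\<^bsup>d\<^esup>\<close> and the substitution \<open>u = t v\<close>, this is the density at \<open>v\<close> of the difference
  law mollified at scale \<open>1 / t\<close>.
\<close>

definition smoothed_difference :: "'a::euclidean_space measure \<Rightarrow> real \<Rightarrow> 'a \<Rightarrow> real" where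
  "smoothed_difference \<mu> t u = (LINT w|difference_law \<mu>. gauss (t *\<^sub>R w - u))"

lemma ennreal_smoothed_difference:
  assumes "prob_space \<mu>" "sets \<mu> = sets borel"
  shows "ennreal (smoothed_difference \<mu> t u) = (\<integral>\<^sup>+w. ennreal (gauss (t *\<^sub>R w - u)) \<partial>difference_law \<mu>)"
proof -
  interpret D: prob_space "difference_law \<mu>" using assms by (rule prob_space_difference_law)
  show ?thesis unfolding smoothed_difference_def
    by (intro nn_integral_eq_integral[symmetric] D.integrable_const_bound[where B = 1])
       (auto simp: gauss_bounds less_imp_le[OF gauss_bounds(1)])
qed

lemma smoothed_difference_nonneg: "0 \<le> smoothed_difference \<mu> t u"
  unfolding smoothed_difference_def by (auto simp: less_imp_le[OF gauss_bounds(1)])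

lemma smoothed_difference_measurable:
  assumes "prob_space \<mu>" "sets \<mu> = sets borel"
  shows "smoothed_difference \<mu> t \<in> borel_measurable borel"
proof -
  interpret D: prob_space "difference_law \<mu>" using assms by (rule prob_space_difference_law)
  show ?thesis unfolding smoothed_difference_def by measurable
qed

lemma gauss_minus: "gauss (- x) = gauss x"
  by (simp add: gauss_def)

lemma gauss_diff_commute: "gauss (x - y) = gauss (y - x)"
  by (simp add: gauss_def norm_minus_commute)

lemma sigma_finite_difference_law:
  assumes "prob_space \<mu>" "sets \<mu> = sets borel"
  shows "sigma_finite_measure (difference_law \<mu>)"
proof -
  interpret D: prob_space "difference_law \<mu>" using assms by (rule prob_space_difference_law)
  show ?thesis by (rule D.sigma_finite_measure_axioms)
qed

lemma nn_integral_smoothed_difference: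
  fixes \<mu> :: "'a::euclidean_space measure"
  assumes p: "prob_space \<mu>" and s: "sets \<mu> = sets borel"
    and [measurable]: "f \<in> borel_measurable borel"
  shows "(\<integral>\<^sup>+u. f u * ennreal (smoothed_difference \<mu> t u) \<partial>lborel)
    = (\<integral>\<^sup>+w. \<integral>\<^sup>+u. f u * ennreal (gauss (t *\<^sub>R w - u)) \<partial>lborel \<partial>difference_law \<mu>)"
proof -
  interpret D: sigma_finite_measure "difference_law \<mu>" using p s by (rule sigma_finite_difference_law)
  interpret pair_sigma_finite "difference_law \<mu>" "lborel :: 'a measure" ..
  have "(\<integral>\<^sup>+u. f u * ennreal (smoothed_difference \<mu> t u) \<partial>lborel)
    = (\<integral>\<^sup>+u. \<integral>\<^sup>+w. f u * ennreal (gauss (t *\<^sub>R w - u)) \<partial>difference_law \<mu> \<partial>lborel)"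
    by (simp add: ennreal_smoothed_difference[OF p s] nn_integral_cmult)
  also have "\<dots> = (\<integral>\<^sup>+w. \<integral>\<^sup>+u. f u * ennreal (gauss (t *\<^sub>R w - u)) \<partial>lborel \<partial>difference_law \<mu>)"
    by (rule Fubini') measurable
  finally show ?thesis .
qed

lemma nn_integral_smoothed_difference_eq_1:
  fixes \<mu> :: "'a::euclidean_space measure"
  assumes p: "prob_space \<mu>" and s: "sets \<mu> = sets borel"
  shows "(\<integral>\<^sup>+u. ennreal (smoothed_difference \<mu> t u) \<partial>lborel) = 1"
proof -
  interpret D: prob_space "difference_law \<mu>" using p s by (rule prob_space_difference_law)
  have "(\<integral>\<^sup>+u. ennreal (gauss (a - u)) \<partial>lborel) = 1" for a :: 'a
    using nn_integral_gauss_affine[of "-1" a] by simp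
  then show ?thesis
    using nn_integral_smoothed_difference[OF p s, of "\<lambda>_. 1" t] D.emeasure_space_1 by simp
qed

text \<open>
  On a compact support the weight is bounded below, so it costs only a constant when a nonnegative
  quantity is to be bounded from above. In return the transform becomes an average of the
  original one over a unit scale.
\<close>

definition weighted_fourier :: "'a::euclidean_space measure \<Rightarrow> 'a \<Rightarrow> complex" where
  "weighted_fourier \<mu> z = (LINT x|\<mu>. of_real (gauss x) * exp (- 2 * of_real pi * \<i> * of_real (z \<bullet> x)))"

lemma weighted_fourier_measurable:
  fixes \<mu> :: "'a::euclidean_space measure"
  assumes "prob_space \<mu>" and [measurable_cong]: "sets \<mu> = sets borel"
  shows "weighted_fourier \<mu> \<in> borel_measurable borel"
proof -
  interpret prob_space \<mu> by fact
  show ?thesis unfolding weighted_fourier_def by measurable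
qed

lemma weighted_fourier_le:
  fixes \<mu> :: "'a::euclidean_space measure"
  assumes p: "prob_space \<mu>" and s: "sets \<mu> = sets borel"
  shows "ennreal (cmod (weighted_fourier \<mu> z))
     \<le> (\<integral>\<^sup>+u. ennreal (cmod (fourier_transform \<mu> u)) * ennreal (gauss (z - u)) \<partial>lborel)"
proof -
  have fm: "finite_measure \<mu>" using p by (simp add: prob_space_def)
  have [measurable]: "fourier_transform \<mu> \<in> borel_measurable borel"
    using fm s by (rule fourier_transform_measurable)
  have "ennreal (cmod (weighted_fourier \<mu> z))
      = ennreal (norm (LINT \<xi>|lborel. of_real (gauss \<xi>) * fourier_transform \<mu> (z + \<xi>)))"
    using gauss_weighted_integral_fourier[OF fm s, of 1 z] by (simp add: weighted_fourier_def)
  also have "\<dots> \<le> (\<integral>\<^sup>+\<xi>. norm (of_real (gauss \<xi>) * fourier_transform \<mu> (z + \<xi>)) \<partial>lborel)"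
  proof (rule integral_norm_bound_ennreal)
    show "integrable lborel (\<lambda>\<xi>. of_real (gauss \<xi>) * fourier_transform \<mu> (z + \<xi>))"
      using cmod_fourier_transform_le[OF p s]
      by (intro Bochner_Integration.integrable_bound[OF integrable_gauss])
         (auto simp: norm_mult mult_left_le)
  qed
  also have "\<dots> = (\<integral>\<^sup>+\<xi>. (\<lambda>u. ennreal (cmod (fourier_transform \<mu> u)) * ennreal (gauss (z - u))) (z + 1 *\<^sub>R \<xi>) \<partial>lborel)"
    by (simp add: norm_mult gauss_minus ennreal_mult[symmetric] mult.commute less_imp_le[OF gauss_bounds(1)]
                  abs_of_pos[OF gauss_bounds(1)])
  also have "\<dots> = (\<integral>\<^sup>+u. ennreal (cmod (fourier_transform \<mu> u)) * ennreal (gauss (z - u)) \<partial>lborel)"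
    by (subst nn_integral_lborel_affine) simp_all
  finally show ?thesis .
qed

text \<open>
  The unit-scale average produced by the Gaussian weight is transferred to the difference law, which
  thereby acquires a smooth density, while the transform of \<open>\<mu>\<close> enters only through its modulus.
\<close>

lemma weighted_fourier_difference_le:
  fixes \<mu> :: "'a::euclidean_space measure"
  assumes p: "prob_space \<mu>" and s: "sets \<mu> = sets borel"
  shows "(\<integral>\<^sup>+w. ennreal (cmod (weighted_fourier \<mu> (t *\<^sub>R w))) \<partial>difference_law \<mu>)
     \<le> (\<integral>\<^sup>+u. ennreal (cmod (fourier_transform \<mu> u)) * ennreal (smoothed_difference \<mu> t u) \<partial>lborel)"
proof -
  have [measurable]: "fourier_transform \<mu> \<in> borel_measurable borel"
    using p s by (intro fourier_transform_measurable) (auto simp: prob_space_def)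
  show ?thesis
    by (subst nn_integral_smoothed_difference[OF p s], measurable, intro nn_integral_mono weighted_fourier_le[OF p s])
qed

text \<open>
  Completing the square in \<open>u\<close>.
\<close>

lemma gauss_mult_gauss:
  fixes x y :: "'a::euclidean_space"
  assumes "a > 0" and "b > 0"
  shows "gauss (a *\<^sub>R u - x) * gauss (b *\<^sub>R u - y)
     = gauss ((b *\<^sub>R x - a *\<^sub>R y) /\<^sub>R sqrt (a\<^sup>2 + b\<^sup>2))
       * gauss (- ((a *\<^sub>R x + b *\<^sub>R y) /\<^sub>R sqrt (a\<^sup>2 + b\<^sup>2)) + sqrt (a\<^sup>2 + b\<^sup>2) *\<^sub>R u)"
proof -
  define h where "h = sqrt (a\<^sup>2 + b\<^sup>2)"
  have h: "h > 0" and h2: "h\<^sup>2 = a\<^sup>2 + b\<^sup>2" using assms by (auto simp: h_def add_pos_pos)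
  have A: "(norm ((b *\<^sub>R x - a *\<^sub>R y) /\<^sub>R h))\<^sup>2 = (norm (b *\<^sub>R x - a *\<^sub>R y))\<^sup>2 / h\<^sup>2"
    using h by (simp add: power_mult_distrib power_divide divide_inverse power_inverse)
  have B: "(norm (- ((a *\<^sub>R x + b *\<^sub>R y) /\<^sub>R h) + h *\<^sub>R u))\<^sup>2
      = (norm (a *\<^sub>R x + b *\<^sub>R y))\<^sup>2 / h\<^sup>2 - 2 * ((a *\<^sub>R x + b *\<^sub>R y) \<bullet> u) + h\<^sup>2 * (norm u)\<^sup>2"
  proof -
    have "(norm (- (v /\<^sub>R h) + h *\<^sub>R u))\<^sup>2 = (norm (v /\<^sub>R h))\<^sup>2 - 2 * ((v /\<^sub>R h) \<bullet> (h *\<^sub>R u)) + (norm (h *\<^sub>R u))\<^sup>2" for v :: 'a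
      unfolding power2_norm_eq_inner by (simp add: inner_diff_left inner_diff_right inner_commute[of v u] algebra_simps)
    then show ?thesis
      using h by (simp add: power_mult_distrib divide_inverse power_inverse mult.commute)
  qed
  have "(norm (b *\<^sub>R x - a *\<^sub>R y))\<^sup>2 + (norm (a *\<^sub>R x + b *\<^sub>R y))\<^sup>2 = h\<^sup>2 * ((norm x)\<^sup>2 + (norm y)\<^sup>2)"
    unfolding h2 power2_norm_eq_inner
    by (simp add: inner_add_left inner_add_right inner_diff_left inner_diff_right inner_commute[of y x] inner_commute[of x u] inner_commute[of y u] algebra_simps power2_eq_square)
  then have "(norm (b *\<^sub>R x - a *\<^sub>R y))\<^sup>2 / h\<^sup>2 + (norm (a *\<^sub>R x + b *\<^sub>R y))\<^sup>2 / h\<^sup>2 = (norm x)\<^sup>2 + (norm y)\<^sup>2"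
    using h by (simp add: add_divide_distrib[symmetric])
  moreover have "(norm (a *\<^sub>R u - x))\<^sup>2 + (norm (b *\<^sub>R u - y))\<^sup>2
       = (norm x)\<^sup>2 + (norm y)\<^sup>2 - 2 * ((a *\<^sub>R x + b *\<^sub>R y) \<bullet> u) + h\<^sup>2 * (norm u)\<^sup>2"
    unfolding h2 power2_norm_eq_inner
    by (simp add: inner_add_left inner_add_right inner_diff_left inner_diff_right inner_commute[of y x] inner_commute[of x u] inner_commute[of y u] algebra_simps power2_eq_square)
  ultimately have "(norm (a *\<^sub>R u - x))\<^sup>2 + (norm (b *\<^sub>R u - y))\<^sup>2
     = (norm ((b *\<^sub>R x - a *\<^sub>R y) /\<^sub>R h))\<^sup>2 + (norm (- ((a *\<^sub>R x + b *\<^sub>R y) /\<^sub>R h) + h *\<^sub>R u))\<^sup>2"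
    unfolding A B by simp
  then show ?thesis
    unfolding h_def[symmetric] gauss_def exp_add[symmetric] by (simp only: distrib_left[symmetric])
qed

lemma nn_integral_gauss_mult_gauss:
  fixes x y :: "'a::euclidean_space"
  assumes "a > 0" and "b > 0"
  shows "(\<integral>\<^sup>+u. ennreal (gauss (a *\<^sub>R u - x) * gauss (b *\<^sub>R u - y)) \<partial>lborel)
     = ennreal (1 / sqrt (a\<^sup>2 + b\<^sup>2) ^ DIM('a)) * ennreal (gauss ((b *\<^sub>R x - a *\<^sub>R y) /\<^sub>R sqrt (a\<^sup>2 + b\<^sup>2)))"
proof -
  define h where "h = sqrt (a\<^sup>2 + b\<^sup>2)"
  have h: "h > 0" using assms by (auto simp: h_def add_pos_pos)
  have "(\<integral>\<^sup>+u. ennreal (gauss (- ((a *\<^sub>R x + b *\<^sub>R y) /\<^sub>R h) + h *\<^sub>R u)) \<partial>lborel) = ennreal (1 / h ^ DIM('a))"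
    using h nn_integral_gauss_affine[of h "- ((a *\<^sub>R x + b *\<^sub>R y) /\<^sub>R h)"] by (simp del: add_uminus_conv_diff uminus_add_conv_diff)
  then show ?thesis
    unfolding gauss_mult_gauss[OF assms] h_def[symmetric]
    by (simp add: ennreal_mult less_imp_le[OF gauss_bounds(1)] nn_integral_cmult mult.commute
        del: add_uminus_conv_diff uminus_add_conv_diff)
qed

section \<open>Size of the smoothed difference law\<close>

text \<open>
  For \<open>p = 2 / \<theta>\<close> and \<open>a = s / \<theta>\<close> this is the integral in the energy of order \<open>s\<close>. The exponents are
  separate parameters because second and fourth powers of the transform occur as well.
\<close>

definition fourier_moment :: "'a::euclidean_space measure \<Rightarrow> real \<Rightarrow> real \<Rightarrow> ennreal" where
  "fourier_moment \<mu> p a =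
     (\<integral>\<^sup>+z. ennreal (cmod (fourier_transform \<mu> z) powr p * norm z powr (a - DIM('a))) \<partial>lborel)"

text \<open>
  From \<open>ln |x| \<le> |x|\<close> and \<open>e |x| \<le> e\<^sup>2 + |x|\<^sup>2\<close>.
\<close>

lemma gauss_le_powr:
  assumes "e \<ge> 0" and "x \<noteq> 0"
  shows "gauss x \<le> exp (e\<^sup>2) * norm x powr (- e)"
proof -
  have x: "norm x > 0" using assms by simp
  have "e * ln (norm x) \<le> e * norm x"
    using assms ln_le_minus_one[OF x] by (intro mult_left_mono) auto
  also have "\<dots> \<le> e\<^sup>2 + (norm x)\<^sup>2"
    using sum_squares_bound[of e "norm x"] mult_nonneg_nonneg[OF assms(1) norm_ge_zero[of x]] by linarith
  also have "(norm x)\<^sup>2 \<le> pi * (norm x)\<^sup>2"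
    using pi_ge_two mult_right_mono[of 1 pi "(norm x)\<^sup>2"] by simp
  finally have "- pi * (norm x)\<^sup>2 \<le> e\<^sup>2 + (- e) * ln (norm x)" by simp
  then have "gauss x \<le> exp (e\<^sup>2 + (- e) * ln (norm x))" by (simp add: gauss_def)
  then show ?thesis
    using x by (simp only: exp_add) (simp add: powr_def)
qed

text \<open>
  Dominate the Gaussian by the power \<open>|\<xi>|\<^bsup>q - d\<^esup>\<close>, which is homogeneous, and rescale. The power has a
  nonpositive exponent only for \<open>q \<le> d\<close>, and this is where the exponents saturate at the dimension.
\<close>

lemma nn_integral_gauss_fourier_le:
  fixes \<mu> :: "'a::euclidean_space measure" and q :: real
  assumes p: "prob_space \<mu>" and s: "sets \<mu> = sets borel"
    and q: "q \<le> DIM('a)" and c: "c > 0"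
  shows "(\<integral>\<^sup>+\<xi>. ennreal (gauss \<xi> * cmod (fourier_transform \<mu> (c *\<^sub>R \<xi>)) powr p) \<partial>lborel)
    \<le> ennreal (exp ((DIM('a) - q)\<^sup>2) * c powr (- q)) * fourier_moment \<mu> p q"
proof -
  have [measurable]: "fourier_transform \<mu> \<in> borel_measurable borel"
    using p s by (intro fourier_transform_measurable) (auto simp: prob_space_def)
  let ?d = "real DIM('a)"
  let ?E = "exp ((?d - q)\<^sup>2)"
  let ?g = "\<lambda>z. ennreal (cmod (fourier_transform \<mu> z) powr p * norm z powr (q - ?d))"
  have "(\<integral>\<^sup>+\<xi>. ennreal (gauss \<xi> * cmod (fourier_transform \<mu> (c *\<^sub>R \<xi>)) powr p) \<partial>lborel)
      \<le> (\<integral>\<^sup>+\<xi>. ennreal (?E * c powr (?d - q)) * ?g (0 + c *\<^sub>R \<xi>) \<partial>lborel)"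
  proof (rule nn_integral_mono_AE)
    have "AE \<xi> in lborel. \<xi> \<noteq> (0::'a)" by (rule AE_lborel_singleton)
    then show "AE \<xi> in lborel. ennreal (gauss \<xi> * cmod (fourier_transform \<mu> (c *\<^sub>R \<xi>)) powr p)
                 \<le> ennreal (?E * c powr (?d - q)) * ?g (0 + c *\<^sub>R \<xi>)"
    proof eventually_elim
      case (elim \<xi>)
      let ?m = "cmod (fourier_transform \<mu> (c *\<^sub>R \<xi>)) powr p"
      have cc: "c powr (?d - q) * c powr (q - ?d) = 1" using c by (simp add: powr_add[symmetric])
      have "gauss \<xi> * ?m \<le> (?E * norm \<xi> powr (- (?d - q))) * ?m"
        using q elim by (intro mult_right_mono gauss_le_powr) auto
      also have "\<dots> = ?E * (c powr (?d - q) * c powr (q - ?d)) * norm \<xi> powr (q - ?d) * ?m"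
        unfolding cc by simp
      also have "\<dots> = (?E * c powr (?d - q)) * (?m * norm (0 + c *\<^sub>R \<xi>) powr (q - ?d))"
        using c by (simp add: powr_mult mult_ac)
      finally show ?case by (subst ennreal_mult[symmetric]) (auto intro!: ennreal_leI)
    qed
  qed
  also have "\<dots> = ennreal (?E * c powr (?d - q)) * (ennreal (1 / \<bar>c\<bar> ^ DIM('a)) * fourier_moment \<mu> p q)"
    unfolding fourier_moment_def
    using c by (subst nn_integral_cmult, measurable, subst nn_integral_lborel_affine) simp_all
  also have "\<dots> = ennreal ((?E * c powr (?d - q)) * (1 / \<bar>c\<bar> ^ DIM('a))) * fourier_moment \<mu> p q"
    by (subst mult.assoc[symmetric], subst ennreal_mult) auto
  also have "(?E * c powr (?d - q)) * (1 / \<bar>c\<bar> ^ DIM('a)) = ?E * c powr (- q)"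
    using c by (simp add: powr_diff powr_minus powr_realpow divide_inverse)
  finally show ?thesis .
qed

text \<open>
  Integrating the product of the two Gaussians over \<open>u\<close> leaves a Gaussian in the difference of two
  independent differences, to which the fourth power version of Parseval's identity applies.
\<close>

lemma smoothed_difference_square_bound:
  fixes \<mu> :: "'a::euclidean_space measure" and q :: real
  assumes p: "prob_space \<mu>" and s: "sets \<mu> = sets borel"
    and q: "q \<le> DIM('a)" and fin: "fourier_moment \<mu> 4 q < \<infinity>"
  obtains K where "K \<ge> 0" and
    "\<And>t. t > 0 \<Longrightarrow> (\<integral>\<^sup>+u. ennreal ((smoothed_difference \<mu> t u)\<^sup>2) \<partial>lborel) \<le> ennreal (K * t powr (- q))"
proof -
  define D where "D = difference_law \<mu>"
  have [measurable]: "smoothed_difference \<mu> t \<in> borel_measurable borel" for t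
    using p s by (rule smoothed_difference_measurable)
  define K where "K = exp ((DIM('a) - q)\<^sup>2) * sqrt 2 powr q * enn2real (fourier_moment \<mu> 4 q)"
  have "(\<integral>\<^sup>+u. ennreal ((smoothed_difference \<mu> t u)\<^sup>2) \<partial>lborel) \<le> ennreal (K * t powr (- q))" if t: "t > 0" for t
  proof -
    let ?N = "\<lambda>u. ennreal (smoothed_difference \<mu> t u)"
    have "(\<integral>\<^sup>+u. ennreal ((smoothed_difference \<mu> t u)\<^sup>2) \<partial>lborel) = (\<integral>\<^sup>+u. ?N u * ?N u \<partial>lborel)"
      by (simp add: power2_eq_square ennreal_mult smoothed_difference_nonneg)
    also have "\<dots> = (\<integral>\<^sup>+w. \<integral>\<^sup>+u. ?N u * ennreal (gauss (t *\<^sub>R w - u)) \<partial>lborel \<partial>D)"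
      unfolding D_def by (intro nn_integral_smoothed_difference p s) measurable
    also have "\<dots> = (\<integral>\<^sup>+w. \<integral>\<^sup>+u. ennreal (gauss (t *\<^sub>R w - u)) * ?N u \<partial>lborel \<partial>D)"
      by (simp add: mult.commute)
    also have "\<dots> = (\<integral>\<^sup>+w. \<integral>\<^sup>+v. \<integral>\<^sup>+u. ennreal (gauss (t *\<^sub>R w - u)) * ennreal (gauss (t *\<^sub>R v - u)) \<partial>lborel \<partial>D \<partial>D)"
      unfolding D_def
      by (intro nn_integral_cong nn_integral_smoothed_difference[OF p s]) measurable
    also have "\<dots> \<le> (\<integral>\<^sup>+w. \<integral>\<^sup>+v. ennreal (gauss ((t / sqrt 2) *\<^sub>R (v - w))) \<partial>D \<partial>D)"
    proof (intro nn_integral_mono)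
      fix v w :: 'a
      have scale: "(t *\<^sub>R w - t *\<^sub>R v) /\<^sub>R k = - ((t / k) *\<^sub>R (v - w))" for k
        by (simp add: algebra_simps divide_inverse)
      have "(\<integral>\<^sup>+u. ennreal (gauss (t *\<^sub>R w - u)) * ennreal (gauss (t *\<^sub>R v - u)) \<partial>lborel)
        = (\<integral>\<^sup>+u. ennreal (gauss (1 *\<^sub>R u - t *\<^sub>R w) * gauss (1 *\<^sub>R u - t *\<^sub>R v)) \<partial>lborel)"
        by (simp add: ennreal_mult less_imp_le[OF gauss_bounds(1)] gauss_diff_commute[of "t *\<^sub>R _"])
      also have "\<dots> = ennreal (1 / sqrt 2 ^ DIM('a)) * ennreal (gauss ((t *\<^sub>R w - t *\<^sub>R v) /\<^sub>R sqrt 2))"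
        by (subst nn_integral_gauss_mult_gauss) simp_all
      also have "\<dots> \<le> 1 * ennreal (gauss ((t *\<^sub>R w - t *\<^sub>R v) /\<^sub>R sqrt 2))"
        by (intro mult_right_mono) (simp_all add: one_le_power)
      also have "(t *\<^sub>R w - t *\<^sub>R v) /\<^sub>R sqrt 2 = - ((t / sqrt 2) *\<^sub>R (v - w))"
        using scale[of "sqrt 2"] .
      finally show "(\<integral>\<^sup>+u. ennreal (gauss (t *\<^sub>R w - u)) * ennreal (gauss (t *\<^sub>R v - u)) \<partial>lborel)
          \<le> ennreal (gauss ((t / sqrt 2) *\<^sub>R (v - w)))" by (simp add: gauss_minus)
    qed
    also have "\<dots> = (\<integral>\<^sup>+\<xi>. ennreal (gauss \<xi> * cmod (fourier_transform \<mu> ((t / sqrt 2) *\<^sub>R \<xi>)) powr 4) \<partial>lborel)"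
      unfolding D_def by (subst gauss_parseval_difference_law[OF p s]) simp
    also have "\<dots> \<le> ennreal (exp ((DIM('a) - q)\<^sup>2) * (t / sqrt 2) powr (- q)) * fourier_moment \<mu> 4 q"
      using t by (intro nn_integral_gauss_fourier_le p s q) auto
    also have "\<dots> = ennreal (exp ((DIM('a) - q)\<^sup>2) * (t / sqrt 2) powr (- q)) * ennreal (enn2real (fourier_moment \<mu> 4 q))"
      using fin by simp
    also have "\<dots> = ennreal (exp ((DIM('a) - q)\<^sup>2) * (t / sqrt 2) powr (- q) * enn2real (fourier_moment \<mu> 4 q))"
      by (subst ennreal_mult) auto
    also have "exp ((DIM('a) - q)\<^sup>2) * (t / sqrt 2) powr (- q) * enn2real (fourier_moment \<mu> 4 q) = K * t powr (- q)"
      using t by (simp add: K_def powr_divide powr_minus field_simps)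
    finally show ?thesis .
  qed
  moreover have "K \<ge> 0" by (simp add: K_def)
  ultimately show thesis by (intro that[of K])
qed

text \<open>
  A ball is dominated by a Gaussian of the same width. Its product with the Gaussian centred at
  \<open>t w\<close> integrates to a Gaussian in \<open>w\<close> of width \<open>h / t\<close>, where \<open>h\<^sup>2 = 1 + r\<^sup>2\<close>, times \<open>(r / h)\<^bsup>d\<^esup>\<close>. For
  small \<open>r\<close> this last factor supplies the missing power of \<open>r\<close>, so one bound serves all radii.
\<close>

lemma smoothed_difference_ball_bound:
  fixes \<mu> :: "'a::euclidean_space measure" and q :: real
  assumes p: "prob_space \<mu>" and s: "sets \<mu> = sets borel"
    and q: "0 < q" "q \<le> DIM('a)" and fin: "fourier_moment \<mu> 2 q < \<infinity>"
  obtains K where "K \<ge> 0" and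
    "\<And>t r. t > 0 \<Longrightarrow> r > 0 \<Longrightarrow>
       (\<integral>\<^sup>+u. indicator (cball 0 r) u * ennreal (smoothed_difference \<mu> t u) \<partial>lborel) \<le> ennreal (K * (r / t) powr q)"
proof -
  define D where "D = difference_law \<mu>"
  have [measurable]: "smoothed_difference \<mu> t \<in> borel_measurable borel" for t
    using p s by (rule smoothed_difference_measurable)
  let ?d = "real DIM('a)"
  define K where "K = exp pi * exp ((?d - q)\<^sup>2) * enn2real (fourier_moment \<mu> 2 q)"
  have "(\<integral>\<^sup>+u. indicator (cball 0 r) u * ennreal (smoothed_difference \<mu> t u) \<partial>lborel) \<le> ennreal (K * (r / t) powr q)"
    if t: "t > 0" and r: "r > 0" for t r
  proof -
    define h where "h = sqrt (1 + r\<^sup>2)"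
    have h2: "h\<^sup>2 = 1 + r\<^sup>2" by (simp add: h_def)
    have h: "h > 0" "h \<ge> r" "h \<noteq> 0"
      using r by (auto simp: h_def real_le_rsqrt add_pos_pos less_imp_neq[symmetric])
    have "(1/r)\<^sup>2 + 1\<^sup>2 = (h / r)\<^sup>2"
      using r by (simp add: power_divide h2 field_simps)
    then have hh: "sqrt ((1/r)\<^sup>2 + 1\<^sup>2) = h / r"
      using r h by simp
    have "(\<integral>\<^sup>+u. indicator (cball 0 r) u * ennreal (smoothed_difference \<mu> t u) \<partial>lborel)
      \<le> (\<integral>\<^sup>+u. ennreal (exp pi * gauss ((1/r) *\<^sub>R u)) * ennreal (smoothed_difference \<mu> t u) \<partial>lborel)"
    proof (intro nn_integral_mono mult_right_mono)
      fix u :: 'a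
      show "indicator (cball 0 r) u \<le> ennreal (exp pi * gauss ((1/r) *\<^sub>R u))"
      proof (cases "u \<in> cball 0 r")
        case True
        then have "(norm u / r)\<^sup>2 \<le> 1" using r by (auto simp: power_le_one)
        then have "pi * (norm u / r)\<^sup>2 \<le> pi * 1" by (intro mult_left_mono) auto
        then have "1 \<le> exp pi * gauss ((1/r) *\<^sub>R u)"
          using r by (simp add: gauss_def exp_add[symmetric])
        then show ?thesis using True by simp
      qed simp
    qed simp
    also have "\<dots> = (\<integral>\<^sup>+w. \<integral>\<^sup>+u. ennreal (exp pi * gauss ((1/r) *\<^sub>R u)) * ennreal (gauss (t *\<^sub>R w - u)) \<partial>lborel \<partial>D)"
      unfolding D_def by (intro nn_integral_smoothed_difference p s) measurable
    also have "\<dots> = (\<integral>\<^sup>+w. ennreal (exp pi * (r / h) ^ DIM('a)) * ennreal (gauss ((t / h) *\<^sub>R w)) \<partial>D)"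
    proof (intro nn_integral_cong)
      fix w :: 'a
      have "(\<integral>\<^sup>+u. ennreal (exp pi * gauss ((1/r) *\<^sub>R u)) * ennreal (gauss (t *\<^sub>R w - u)) \<partial>lborel)
        = (\<integral>\<^sup>+u. ennreal (exp pi) * ennreal (gauss ((1/r) *\<^sub>R u - 0) * gauss (1 *\<^sub>R u - t *\<^sub>R w)) \<partial>lborel)"
        by (simp add: ennreal_mult less_imp_le[OF gauss_bounds(1)] gauss_diff_commute[of "t *\<^sub>R _"] mult.assoc)
      also have "\<dots> = ennreal (exp pi) * (ennreal (1 / (h / r) ^ DIM('a)) * ennreal (gauss ((1 *\<^sub>R 0 - (1/r) *\<^sub>R (t *\<^sub>R w)) /\<^sub>R (h / r))))"
        using r by (subst nn_integral_cmult, measurable, subst nn_integral_gauss_mult_gauss) (simp_all only: hh, simp_all)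
      also have "(1 *\<^sub>R 0 - (1/r) *\<^sub>R (t *\<^sub>R w)) /\<^sub>R (h / r) = - ((t / h) *\<^sub>R w)"
        using r h by (simp add: divide_inverse)
      also have "ennreal (exp pi) * (ennreal (1 / (h / r) ^ DIM('a)) * ennreal (gauss (- ((t / h) *\<^sub>R w))))
         = ennreal (exp pi * (r / h) ^ DIM('a)) * ennreal (gauss ((t / h) *\<^sub>R w))"
      proof -
        have "1 / (h / r) ^ DIM('a) = (r / h) ^ DIM('a)" using r h by (simp add: power_divide)
        moreover have "ennreal (exp pi * (r / h) ^ DIM('a)) = ennreal (exp pi) * ennreal ((r / h) ^ DIM('a))"
          using r h by (intro ennreal_mult) auto
        ultimately show ?thesis by (simp add: gauss_minus mult.assoc)
      qed
      finally show "(\<integral>\<^sup>+u. ennreal (exp pi * gauss ((1/r) *\<^sub>R u)) * ennreal (gauss (t *\<^sub>R w - u)) \<partial>lborel)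
        = ennreal (exp pi * (r / h) ^ DIM('a)) * ennreal (gauss ((t / h) *\<^sub>R w))" .
    qed
    also have "\<dots> = ennreal (exp pi * (r / h) ^ DIM('a)) * (\<integral>\<^sup>+w. ennreal (gauss ((t / h) *\<^sub>R w)) \<partial>D)"
      by (rule nn_integral_cmult) (simp add: D_def)
    also have "\<dots> \<le> ennreal (exp pi * (r / h) ^ DIM('a)) * ennreal (exp ((?d - q)\<^sup>2) * (t / h) powr (- q) * enn2real (fourier_moment \<mu> 2 q))"
    proof (rule mult_left_mono)
      have "(\<integral>\<^sup>+w. ennreal (gauss ((t / h) *\<^sub>R w)) \<partial>D)
         = (\<integral>\<^sup>+\<xi>. ennreal (gauss \<xi> * cmod (fourier_transform \<mu> ((t / h) *\<^sub>R \<xi>)) powr 2) \<partial>lborel)"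
        unfolding D_def by (subst gauss_parseval[OF p s]) simp
      also have "\<dots> \<le> ennreal (exp ((?d - q)\<^sup>2) * (t / h) powr (- q)) * fourier_moment \<mu> 2 q"
        using t h by (intro nn_integral_gauss_fourier_le p s q) auto
      also have "\<dots> = ennreal (exp ((?d - q)\<^sup>2) * (t / h) powr (- q)) * ennreal (enn2real (fourier_moment \<mu> 2 q))"
        using fin by simp
      also have "\<dots> = ennreal (exp ((?d - q)\<^sup>2) * (t / h) powr (- q) * enn2real (fourier_moment \<mu> 2 q))"
        by (rule ennreal_mult[symmetric]) auto
      finally show "(\<integral>\<^sup>+w. ennreal (gauss ((t / h) *\<^sub>R w)) \<partial>D)
        \<le> ennreal (exp ((?d - q)\<^sup>2) * (t / h) powr (- q) * enn2real (fourier_moment \<mu> 2 q))" .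
    qed simp
    also have "\<dots> = ennreal (exp pi * (r / h) ^ DIM('a) * (exp ((?d - q)\<^sup>2) * (t / h) powr (- q) * enn2real (fourier_moment \<mu> 2 q)))"
      using r h by (intro ennreal_mult[symmetric]) auto
    also have "\<dots> \<le> ennreal (K * (r / t) powr q)"
    proof (rule ennreal_leI)
      have "(r / h) ^ DIM('a) = (r / h) powr ?d" using r h by (simp add: powr_realpow)
      also have "\<dots> \<le> (r / h) powr q" using r h q by (intro powr_mono') auto
      finally have "(r / h) ^ DIM('a) * (t / h) powr (- q) \<le> (r / h) powr q * (t / h) powr (- q)"
        by (intro mult_right_mono) auto
      also have "\<dots> = (r / t) powr q"
        using r h t by (simp add: powr_divide powr_minus field_simps)
      finally have "K * ((r / h) ^ DIM('a) * (t / h) powr (- q)) \<le> K * (r / t) powr q"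
        by (intro mult_left_mono) (auto simp: K_def)
      then show "exp pi * (r / h) ^ DIM('a) * (exp ((?d - q)\<^sup>2) * (t / h) powr (- q) * enn2real (fourier_moment \<mu> 2 q)) \<le> K * (r / t) powr q"
        by (simp add: K_def mult_ac)
    qed
    finally show ?thesis by (auto simp: mult_left_mono)
  qed
  moreover have "K \<ge> 0" by (simp add: K_def)
  ultimately show thesis by (intro that[of K])
qed

section \<open>Moments of the Fourier transform\<close>

lemma dyadic_scale:
  fixes x :: real
  assumes "1 \<le> x"
  obtains k :: nat where "2 ^ k \<le> x" and "x < 2 ^ (k + 1)"
proof -
  define k where "k = nat \<lfloor>log 2 x\<rfloor>"
  have x: "x > 0" "log 2 x \<ge> 0" using assms by auto
  then have k: "real k \<le> log 2 x" "log 2 x < real (k + 1)"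
    unfolding k_def by linarith+
  have "2 powr real k \<le> x" using k(1) x(1) by (subst (asm) le_log_iff) auto
  moreover have "x < 2 powr real (k + 1)" using k(2) x(1) by (subst (asm) log_less_iff) auto
  ultimately show thesis by (intro that[of k]) (simp_all only: powr_realpow zero_less_numeral)
qed

lemma two_power_powr: "(2 ^ k) powr a = (2::real) powr (a * real k)"
  by (simp add: powr_powr mult.commute flip: powr_realpow)

lemma cball_borel [measurable]: "cball (x::'a::metric_space) r \<in> sets borel"
  by (intro borel_closed closed_cball)

lemma ennreal_le_suminf: "(f k :: ennreal) \<le> (\<Sum>k. f k)"
  using sum_le_suminf[of f "{k}"] by simp

text \<open>
  Cut the ball into dyadic shells: the shell of radius about \<open>t / 2\<^bsup>k\<^esup>\<close> contributes at most a constant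
  times \<open>2\<^bsup>k (c - s)\<^esup>\<close>, a geometric sequence. The origin contributes nothing since \<open>0 powr (- c) = 0\<close>.
\<close>

lemma nn_integral_powr_near_zero:
  fixes P :: "'a::euclidean_space measure"
  assumes [measurable_cong]: "sets P = sets borel"
    and t: "t > 0" and c: "0 \<le> c" "c < s" and K: "0 \<le> K"
    and ball: "\<And>r. 0 < r \<Longrightarrow> r \<le> t \<Longrightarrow> emeasure P (cball 0 r) \<le> ennreal (K * (r / t) powr s)"
  shows "(\<integral>\<^sup>+u. indicator (cball 0 t) u * ennreal (norm u powr (- c)) \<partial>P)
      \<le> ennreal (2 powr c / (1 - 2 powr (c - s)) * K * t powr (- c))"
proof -
  define A where "A k = t powr (- c) * 2 powr (c * (real k + 1))" for k :: nat
  define x where "x = 2 powr (c - s)"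
  have x: "0 < x" "x < 1" using c by (auto simp: x_def powr_less_one)
  have A: "A k \<ge> 0" for k by (simp add: A_def)
  have "(\<integral>\<^sup>+u. indicator (cball 0 t) u * ennreal (norm u powr (- c)) \<partial>P)
     \<le> (\<integral>\<^sup>+u. (\<Sum>k. ennreal (A k) * indicator (cball 0 (t / 2 ^ k)) u) \<partial>P)"
  proof (intro nn_integral_mono)
    fix u :: 'a
    show "indicator (cball 0 t) u * ennreal (norm u powr (- c)) \<le> (\<Sum>k. ennreal (A k) * indicator (cball 0 (t / 2 ^ k)) u)"
    proof (cases "u \<in> cball 0 t \<and> u \<noteq> 0")
      case True
      then have u: "norm u > 0" "1 \<le> t / norm u" by auto
      obtain k where k: "2 ^ k \<le> t / norm u" "t / norm u < 2 ^ (k + 1)"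
        using dyadic_scale[OF u(2)] .
      have "u \<in> cball 0 (t / 2 ^ k)" using k(1) u by (simp add: field_simps)
      moreover have "norm u powr (- c) \<le> A k"
      proof -
        have "norm u powr (- c) = t powr (- c) * (t / norm u) powr c"
          using u t by (simp add: powr_divide powr_minus field_simps)
        also have "\<dots> \<le> t powr (- c) * (2 ^ (k + 1)) powr c"
          using k(2) u t c by (intro mult_left_mono powr_mono2) auto
        also have "\<dots> = A k" unfolding A_def two_power_powr by (simp add: add.commute)
        finally show ?thesis .
      qed
      ultimately have "indicator (cball 0 t) u * ennreal (norm u powr (- c)) \<le> ennreal (A k) * indicator (cball 0 (t / 2 ^ k)) u"
        using True by (auto intro: ennreal_leI)
      also have "\<dots> \<le> (\<Sum>k. ennreal (A k) * indicator (cball 0 (t / 2 ^ k)) u)"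
        by (rule ennreal_le_suminf)
      finally show ?thesis .
    qed auto
  qed
  also have "\<dots> = (\<Sum>k. ennreal (A k) * emeasure P (cball 0 (t / 2 ^ k)))"
    by (subst nn_integral_suminf, measurable) (simp add: nn_integral_cmult_indicator assms(1) cball_borel)
  also have "\<dots> \<le> (\<Sum>k. ennreal (2 powr c * K * t powr (- c) * x ^ k))"
  proof (rule suminf_le)
    fix k :: nat
    have "ennreal (A k) * emeasure P (cball 0 (t / 2 ^ k)) \<le> ennreal (A k) * ennreal (K * ((t / 2 ^ k) / t) powr s)"
      using t by (intro mult_left_mono ball) (auto simp: field_simps)
    also have "\<dots> = ennreal (A k * (K * ((t / 2 ^ k) / t) powr s))"
      using A by (intro ennreal_mult[symmetric]) (auto simp: K)
    also have "A k * (K * ((t / 2 ^ k) / t) powr s) = 2 powr c * K * t powr (- c) * x ^ k"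
    proof -
      have "((t / 2 ^ k) / t) powr s = 1 / (2 ^ k) powr s"
        using t by (simp add: powr_divide)
      also have "\<dots> = 2 powr (- s * real k)"
        unfolding two_power_powr using powr_minus_divide[of 2 "s * real k"] by simp
      finally have "((t / 2 ^ k) / t) powr s = 2 powr (- s * real k)" .
      moreover have "x ^ k = 2 powr ((c - s) * real k)"
        by (simp add: x_def powr_powr flip: powr_realpow)
      moreover have "2 powr (c * (real k + 1)) * 2 powr (- s * real k) = 2 powr c * (2::real) powr ((c - s) * real k)"
        unfolding powr_add[symmetric] by (simp add: algebra_simps)
      ultimately show ?thesis by (simp add: A_def mult_ac)
    qed
    finally show "ennreal (A k) * emeasure P (cball 0 (t / 2 ^ k)) \<le> ennreal (2 powr c * K * t powr (- c) * x ^ k)" .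
  qed auto
  also have "\<dots> = ennreal (\<Sum>k. 2 powr c * K * t powr (- c) * x ^ k)"
    using x K by (intro suminf_ennreal2) (auto intro!: summable_mult summable_geometric)
  also have "(\<Sum>k. 2 powr c * K * t powr (- c) * x ^ k) = 2 powr c / (1 - x) * K * t powr (- c)"
    using x by (simp add: suminf_mult suminf_geometric summable_geometric)
  finally show ?thesis by (simp add: x_def)
qed

lemma lborel_powr_near_zero:
  fixes a :: real
  assumes a: "a > 0"
  shows "(\<integral>\<^sup>+z. indicator (cball 0 1) z * ennreal (norm (z::'a::euclidean_space) powr (a - DIM('a))) \<partial>lborel) < \<infinity>"
proof -
  let ?V = "unit_ball_vol (real DIM('a))"
  let ?b = "min a (real DIM('a))"
  have "(\<integral>\<^sup>+z. indicator (cball 0 1) z * ennreal (norm (z::'a) powr (a - DIM('a))) \<partial>lborel)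
     \<le> (\<integral>\<^sup>+z. indicator (cball 0 1) z * ennreal (norm (z::'a) powr (- (DIM('a) - ?b))) \<partial>lborel)"
    by (intro nn_integral_mono) (auto simp: indicator_def intro!: powr_mono' ennreal_leI)
  also have "\<dots> \<le> ennreal (2 powr (DIM('a) - ?b) / (1 - 2 powr ((DIM('a) - ?b) - DIM('a))) * ?V * 1 powr (- (DIM('a) - ?b)))"
  proof (rule nn_integral_powr_near_zero)
    fix r :: real assume "0 < r" 
    then show "emeasure lborel (cball (0::'a) r) \<le> ennreal (?V * (r / 1) powr (real DIM('a)))"
      by (simp add: emeasure_cball powr_realpow)
  qed (use a in auto)
  finally show ?thesis by (rule order.strict_trans1) simp
qed

lemma lborel_powr_far:
  fixes e :: real
  assumes e: "e > 0"
  shows "(\<integral>\<^sup>+z. indicator (- cball 0 1) z * ennreal (norm (z::'a::euclidean_space) powr (- e - DIM('a))) \<partial>lborel) < \<infinity>"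
proof -
  let ?V = "unit_ball_vol (real DIM('a))" and ?d = "real DIM('a)"
  define A where "A k = (2 ^ k) powr (- e - ?d)" for k :: nat
  define x where "x = 2 powr (- e)"
  have x: "0 < x" "x < 1" using e by (auto simp: x_def powr_less_one)
  have "(\<integral>\<^sup>+z. indicator (- cball 0 1) z * ennreal (norm (z::'a) powr (- e - DIM('a))) \<partial>lborel)
     \<le> (\<integral>\<^sup>+z. (\<Sum>k. ennreal (A k) * indicator (cball 0 (2 ^ (k + 1))) z) \<partial>(lborel :: 'a measure))"
  proof (intro nn_integral_mono)
    fix z :: 'a
    show "indicator (- cball 0 1) z * ennreal (norm z powr (- e - DIM('a))) \<le> (\<Sum>k. ennreal (A k) * indicator (cball 0 (2 ^ (k + 1))) z)"
    proof (cases "z \<in> - cball 0 1")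
      case True
      then have z: "1 \<le> norm z" by auto
      obtain k where k: "2 ^ k \<le> norm z" "norm z < 2 ^ (k + 1)"
        using dyadic_scale[OF z] .
      have "z \<in> cball 0 (2 ^ (k + 1))" using k(2) by simp
      moreover have "norm z powr (- e - ?d) \<le> A k"
        unfolding A_def using k(1) e by (intro powr_mono2') auto
      ultimately have "indicator (- cball 0 1) z * ennreal (norm z powr (- e - DIM('a))) \<le> ennreal (A k) * indicator (cball 0 (2 ^ (k + 1))) z"
        using True by (auto intro: ennreal_leI)
      also have "\<dots> \<le> (\<Sum>k. ennreal (A k) * indicator (cball 0 (2 ^ (k + 1))) z)"
        by (rule ennreal_le_suminf)
      finally show ?thesis .
    qed auto
  qed
  also have "\<dots> = (\<Sum>k. ennreal (A k) * emeasure lborel (cball (0::'a) (2 ^ (k + 1))))"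
    by (subst nn_integral_suminf, measurable) (simp add: nn_integral_cmult_indicator cball_borel)
  also have "\<dots> = (\<Sum>k. ennreal (?V * 2 powr ?d * x ^ k))"
  proof (rule suminf_cong)
    fix k :: nat
    have "ennreal (A k) * emeasure lborel (cball (0::'a) (2 ^ (k + 1))) = ennreal (A k * (?V * (2 ^ (k + 1)) powr ?d))"
      by (simp add: emeasure_cball powr_realpow A_def ennreal_mult)
    also have "A k * (?V * (2 ^ (k + 1)) powr ?d) = ?V * 2 powr ?d * x ^ k"
    proof -
      have "A k = 2 powr ((- e - ?d) * real k)"
        unfolding A_def by (rule two_power_powr)
      moreover have "(2 ^ (k + 1)) powr ?d = 2 powr (?d * (real k + 1))"
        unfolding two_power_powr by (simp add: add.commute)
      moreover have "x ^ k = 2 powr (- e * real k)"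
        by (simp add: x_def powr_powr flip: powr_realpow)
      moreover have "2 powr ((- e - ?d) * real k) * 2 powr (?d * (real k + 1)) = 2 powr ?d * (2::real) powr (- e * real k)"
        unfolding powr_add[symmetric] by (simp add: algebra_simps)
      ultimately show ?thesis by (simp add: mult_ac)
    qed
    finally show "ennreal (A k) * emeasure lborel (cball (0::'a) (2 ^ (k + 1))) = ennreal (?V * 2 powr ?d * x ^ k)" .
  qed
  also have "\<dots> = ennreal (\<Sum>k. ?V * 2 powr ?d * x ^ k)"
    using x by (intro suminf_ennreal2) (auto intro!: summable_mult summable_geometric)
  finally show ?thesis by (rule order.strict_trans1) simp
qed

text \<open>
  A weighted geometric mean lies below the maximum.
\<close>

lemma powr_weighted_le_add:
  fixes x y :: real
  assumes "0 \<le> x" "0 \<le> y" "0 \<le> l" "l \<le> 1"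
  shows "x powr l * y powr (1 - l) \<le> x + y"
proof -
  define M where "M = max x y"
  have M: "M \<ge> 0" "x \<le> M" "y \<le> M" using assms by (auto simp: M_def)
  have "x powr l * y powr (1 - l) \<le> M powr l * M powr (1 - l)"
    using assms M by (intro mult_mono powr_mono2) auto
  also have "\<dots> = M" using M by (simp add: powr_add[symmetric] powr_one)
  also have "M \<le> x + y" using assms by (auto simp: M_def)
  finally show ?thesis .
qed

text \<open>
  Near the origin \<open>m \<le> 1\<close> and a positive \<open>a\<close> makes the weight integrable, so only high frequencies
  matter.
\<close>

lemma fourier_moment_finiteI:
  fixes \<mu> :: "'a::euclidean_space measure" and a p :: real
  assumes P: "prob_space \<mu>" and s: "sets \<mu> = sets borel"
    and a: "a > 0" "p \<ge> 0" and [measurable]: "g \<in> borel_measurable borel"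
    and g: "\<And>z. norm z > 1 \<Longrightarrow> ennreal (cmod (fourier_transform \<mu> z) powr p * norm z powr (a - DIM('a))) \<le> g z"
    and fin: "(\<integral>\<^sup>+z. indicator (- cball 0 1) z * g z \<partial>lborel) < \<infinity>"
  shows "fourier_moment \<mu> p a < \<infinity>"
proof -
  have [measurable]: "fourier_transform \<mu> \<in> borel_measurable borel"
    using P s by (intro fourier_transform_measurable) (auto simp: prob_space_def)
  let ?h = "\<lambda>z::'a. indicator (cball 0 1) z * ennreal (norm z powr (a - DIM('a)))"
  have "fourier_moment \<mu> p a \<le> (\<integral>\<^sup>+z. ?h z + indicator (- cball 0 1) z * g z \<partial>lborel)"
    unfolding fourier_moment_def
  proof (intro nn_integral_mono)
    fix z :: 'a
    have "cmod (fourier_transform \<mu> z) powr p \<le> 1"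
      using cmod_fourier_transform_le[OF P s, of z] a by (intro powr_le1) auto
    then have "cmod (fourier_transform \<mu> z) powr p * norm z powr (a - DIM('a)) \<le> 1 * norm z powr (a - DIM('a))"
      by (intro mult_right_mono) auto
    then show "ennreal (cmod (fourier_transform \<mu> z) powr p * norm z powr (a - DIM('a))) \<le> ?h z + indicator (- cball 0 1) z * g z"
      using g[of z] by (cases "z \<in> cball 0 1") (auto intro!: ennreal_leI)
  qed
  also have "\<dots> = (\<integral>\<^sup>+z. ?h z \<partial>lborel) + (\<integral>\<^sup>+z. indicator (- cball 0 1) z * g z \<partial>lborel)"
    by (rule nn_integral_add) measurable
  also have "\<dots> < \<infinity>" using lborel_powr_near_zero[OF a(1), where 'a='a] fin by (simp add: less_top)
  finally show ?thesis .
qed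

text \<open>
  The energies form a scale. Raising \<open>p\<close> is harmless as \<open>m \<le> 1\<close>. Lowering \<open>p\<close> costs an arbitrarily small
  amount in the ratio \<open>a / p\<close>: with \<open>l = p' / p\<close> the new integrand is the weighted geometric mean of the
  old one and of \<open>|z|\<^bsup>- e - d\<^esup>\<close>, where \<open>e > 0\<close> measures the loss.
\<close>

lemma fourier_moment_mono:
  fixes \<mu> :: "'a::euclidean_space measure" and a p a' p' :: real
  assumes P: "prob_space \<mu>" and s: "sets \<mu> = sets borel"
    and fin: "fourier_moment \<mu> p a < \<infinity>" and a': "0 < a'" and p': "0 < p'"
    and *: "(p \<le> p' \<and> a' \<le> a) \<or> (p' < p \<and> a' * p < a * p')"
  shows "fourier_moment \<mu> p' a' < \<infinity>"
proof -
  have [measurable]: "fourier_transform \<mu> \<in> borel_measurable borel"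
    using P s by (intro fourier_transform_measurable) (auto simp: prob_space_def)
  let ?m = "\<lambda>z. cmod (fourier_transform \<mu> z)" and ?d = "real DIM('a)"
  let ?f = "\<lambda>z. ennreal (?m z powr p * norm z powr (a - ?d))"
  have m1: "?m z \<le> 1" for z by (rule cmod_fourier_transform_le[OF P s])
  from * show ?thesis
  proof
    assume c: "p \<le> p' \<and> a' \<le> a"
    show ?thesis
    proof (rule fourier_moment_finiteI[OF P s a', where g = ?f])
      fix z :: 'a assume z: "norm z > 1"
      have "?m z powr p' * norm z powr (a' - ?d) \<le> ?m z powr p * norm z powr (a - ?d)"
        using z c m1[of z] by (intro mult_mono powr_mono' powr_mono) auto
      then show "ennreal (?m z powr p' * norm z powr (a' - ?d)) \<le> ?f z" by (rule ennreal_leI)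
    next
      have "(\<integral>\<^sup>+z. indicator (- cball 0 1) z * ?f z \<partial>lborel) \<le> fourier_moment \<mu> p a"
        unfolding fourier_moment_def by (intro nn_integral_mono) (auto simp: indicator_def)
      then show "(\<integral>\<^sup>+z. indicator (- cball 0 1) z * ?f z \<partial>lborel) < \<infinity>" using fin by simp
    qed (use p' in auto)
  next
    assume c: "p' < p \<and> a' * p < a * p'"
    define l where "l = p' / p"
    have pp: "p > 0" using c p' by simp
    have l: "0 < l" "l < 1" using c p' by (auto simp: l_def)
    define e where "e = (a * l - a') / (1 - l)"
    have "a' < a * l" using c pp by (simp add: l_def field_simps)
    then have e: "e > 0" using l by (simp add: e_def)
    let ?g = "\<lambda>z::'a. ennreal (norm z powr (- e - ?d))"
    show ?thesis
    proof (rule fourier_moment_finiteI[OF P s a', where g = "\<lambda>z. ?f z + ?g z"])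
      fix z :: 'a assume z: "norm z > 1"
      have "?m z powr p' * norm z powr a' = (?m z powr p * norm z powr a) powr l * (norm z powr (- e)) powr (1 - l)"
      proof -
        have "e * (1 - l) = a * l - a'" using l by (simp add: e_def)
        then have eq: "a * l + - e * (1 - l) = a'" by simp
        have "norm z powr (a * l) * norm z powr (- e * (1 - l)) = norm z powr a'"
          by (simp only: powr_add[symmetric] eq)
        moreover have "p * l = p'" using pp by (simp add: l_def)
        ultimately show ?thesis by (simp add: powr_mult powr_powr)
      qed
      also have "\<dots> \<le> ?m z powr p * norm z powr a + norm z powr (- e)"
        using l by (intro powr_weighted_le_add) auto
      finally have "(?m z powr p' * norm z powr a') * norm z powr (- ?d) \<le> (?m z powr p * norm z powr a + norm z powr (- e)) * norm z powr (- ?d)"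
        by (intro mult_right_mono) auto
      then have "?m z powr p' * norm z powr (a' - ?d) \<le> ?m z powr p * norm z powr (a - ?d) + norm z powr (- e - ?d)"
        unfolding diff_conv_add_uminus powr_add by (simp add: algebra_simps)
      then show "ennreal (?m z powr p' * norm z powr (a' - ?d)) \<le> ?f z + ?g z"
        by (simp add: ennreal_leI flip: ennreal_plus)
    next
      have "(\<integral>\<^sup>+z. indicator (- cball 0 1) z * (?f z + ?g z) \<partial>lborel)
         = (\<integral>\<^sup>+z. indicator (- cball 0 1) z * ?f z \<partial>lborel) + (\<integral>\<^sup>+z. indicator (- cball 0 1) z * ?g z \<partial>lborel)"
        unfolding distrib_left by (rule nn_integral_add) measurable
      moreover have "(\<integral>\<^sup>+z. indicator (- cball 0 1) z * ?f z \<partial>lborel) \<le> fourier_moment \<mu> p a"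
        unfolding fourier_moment_def by (intro nn_integral_mono) (auto simp: indicator_def)
      moreover note lborel_powr_far[OF e, where 'a='a]
      ultimately show "(\<integral>\<^sup>+z. indicator (- cball 0 1) z * (?f z + ?g z) \<partial>lborel) < \<infinity>"
        using fin by (auto simp: less_top intro: le_less_trans)
    qed (use p' in auto)
  qed
qed

text \<open>
  The counterpart of the comparison above that starts from the pointwise decay at \<open>\<theta> = 0\<close>.
\<close>

lemma fourier_moment_of_decay:
  fixes \<mu> :: "'a::euclidean_space measure" and a p :: real
  assumes P: "prob_space \<mu>" and s: "sets \<mu> = sets borel"
    and decay: "\<And>z. (cmod (fourier_transform \<mu> z))\<^sup>2 * norm z powr b \<le> B"
    and a: "0 < a" and p': "0 < p" and ab: "a < b * p / 2"
  shows "fourier_moment \<mu> p a < \<infinity>"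
proof -
  let ?m = "\<lambda>z. cmod (fourier_transform \<mu> z)" and ?d = "real DIM('a)"
  define e where "e = b * p / 2 - a"
  have e: "e > 0" using ab by (simp add: e_def)
  have B: "B \<ge> 0" using decay[of 0] by (auto intro: order_trans[rotated])
  show ?thesis
  proof (rule fourier_moment_finiteI[OF P s a, where g = "\<lambda>z. ennreal (B powr (p / 2)) * ennreal (norm z powr (- e - ?d))"])
    fix z :: 'a assume z: "norm z > 1"
    have "((?m z)\<^sup>2 * norm z powr b) powr (p / 2) \<le> B powr (p / 2)"
      using p' decay by (intro powr_mono2) auto
    moreover have "((?m z)\<^sup>2 * norm z powr b) powr (p / 2) = ?m z powr p * norm z powr (b * p / 2)"
    proof -
      have "(?m z)\<^sup>2 powr (p / 2) = (?m z powr 2) powr (p / 2)" by simp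
      also have "\<dots> = ?m z powr p" unfolding powr_powr by simp
      finally show ?thesis by (simp add: powr_mult powr_powr)
    qed
    ultimately have "(?m z powr p * norm z powr (b * p / 2)) * norm z powr (- e - ?d) \<le> B powr (p / 2) * norm z powr (- e - ?d)"
      by (intro mult_right_mono) auto
    also have "(?m z powr p * norm z powr (b * p / 2)) * norm z powr (- e - ?d) = ?m z powr p * norm z powr (a - ?d)"
      unfolding mult.assoc powr_add[symmetric] by (simp add: e_def)
    finally show "ennreal (?m z powr p * norm z powr (a - ?d)) \<le> ennreal (B powr (p / 2)) * ennreal (norm z powr (- e - ?d))"
      by (subst ennreal_mult[symmetric]) (auto intro: ennreal_leI)
  next
    have "(\<integral>\<^sup>+z. indicator (- cball 0 1) z * (ennreal (B powr (p / 2)) * ennreal (norm (z::'a) powr (- e - ?d))) \<partial>lborel)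
      = ennreal (B powr (p / 2)) * (\<integral>\<^sup>+z. indicator (- cball 0 1) z * ennreal (norm (z::'a) powr (- e - ?d)) \<partial>lborel)"
      by (subst nn_integral_cmult[symmetric]) (auto simp: mult_ac)
    then show "(\<integral>\<^sup>+z. indicator (- cball 0 1) z * (ennreal (B powr (p / 2)) * ennreal (norm (z::'a) powr (- e - ?d))) \<partial>lborel) < \<infinity>"
      using lborel_powr_far[OF e, where 'a='a] by (simp add: ennreal_mult_less_top)
  qed (use p' in auto)
qed

section \<open>Decay of the Fourier integral\<close>

text \<open>
  Inside the ball of radius \<open>t\<close> use the power law for the mass of balls; outside it the integrand is at
  most \<open>t\<^bsup>-c\<^esup>\<close> and the total mass is 1.
\<close>

lemma smoothed_difference_negative_moment:
  fixes \<mu> :: "'a::euclidean_space measure" and c q :: real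
  assumes P: "prob_space \<mu>" and s: "sets \<mu> = sets borel"
    and c: "0 \<le> c" "c < q" and q: "q \<le> DIM('a)" and fin: "fourier_moment \<mu> 2 q < \<infinity>"
  obtains K where "K \<ge> 0" and
    "\<And>t. t > 0 \<Longrightarrow> (\<integral>\<^sup>+u. ennreal (norm u powr (- c)) * ennreal (smoothed_difference \<mu> t u) \<partial>lborel) \<le> ennreal (K * t powr (- c))"
proof -
  have [measurable]: "smoothed_difference \<mu> t \<in> borel_measurable borel" for t
    using P s by (rule smoothed_difference_measurable)
  from smoothed_difference_ball_bound[OF P s _ q fin] c obtain K where K: "K \<ge> 0" and
    ball: "\<And>t r. t > 0 \<Longrightarrow> r > 0 \<Longrightarrow>
       (\<integral>\<^sup>+u. indicator (cball 0 r) u * ennreal (smoothed_difference \<mu> t u) \<partial>lborel) \<le> ennreal (K * (r / t) powr q)"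
    by auto
  define Z where "Z = 2 powr c / (1 - 2 powr (c - q)) * K"
  have "2 powr (c - q) < 1" using c by (simp add: powr_less_one)
  then have Z: "Z \<ge> 0" using K by (simp add: Z_def)
  have "(\<integral>\<^sup>+u. ennreal (norm u powr (- c)) * ennreal (smoothed_difference \<mu> t u) \<partial>lborel) \<le> ennreal ((Z + 1) * t powr (- c))"
    if t: "t > 0" for t
  proof -
    let ?N = "\<lambda>u. ennreal (smoothed_difference \<mu> t u)"
    \<comment> \<open>The dyadic estimate is stated for measures, so the smoothed difference is read as a density.\<close>
    define M where "M = density lborel ?N"
    have sM: "sets M = sets borel" by (simp add: M_def)
    have "(\<integral>\<^sup>+u. ennreal (norm u powr (- c)) * ?N u \<partial>lborel)
      \<le> (\<integral>\<^sup>+u. ?N u * (indicator (cball 0 t) u * ennreal (norm u powr (- c))) + ennreal (t powr (- c)) * ?N u \<partial>lborel)"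
    proof (intro nn_integral_mono)
      fix u :: 'a
      show "ennreal (norm u powr (- c)) * ?N u
        \<le> ?N u * (indicator (cball 0 t) u * ennreal (norm u powr (- c))) + ennreal (t powr (- c)) * ?N u"
      proof (cases "norm u \<le> t")
        case True
        then show ?thesis by (simp add: mult.commute)
      next
        case False
        then have "norm u powr (- c) \<le> t powr (- c)" using t c by (intro powr_mono2') auto
        then show ?thesis using False by (simp add: mult_right_mono ennreal_leI)
      qed
    qed
    also have "\<dots> = (\<integral>\<^sup>+u. ?N u * (indicator (cball 0 t) u * ennreal (norm u powr (- c))) \<partial>lborel) + (\<integral>\<^sup>+u. ennreal (t powr (- c)) * ?N u \<partial>lborel)"
      by (rule nn_integral_add) measurable
    also have "(\<integral>\<^sup>+u. ?N u * (indicator (cball 0 t) u * ennreal (norm u powr (- c))) \<partial>lborel)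
        = (\<integral>\<^sup>+u. indicator (cball 0 t) u * ennreal (norm u powr (- c)) \<partial>M)"
      unfolding M_def by (subst nn_integral_density) measurable
    also have "(\<integral>\<^sup>+u. ennreal (t powr (- c)) * ?N u \<partial>lborel) = ennreal (t powr (- c))"
      by (subst nn_integral_cmult) (simp_all add: nn_integral_smoothed_difference_eq_1[OF P s])
    also have "(\<integral>\<^sup>+u. indicator (cball 0 t) u * ennreal (norm u powr (- c)) \<partial>M) + ennreal (t powr (- c))
       \<le> ennreal (Z * t powr (- c)) + ennreal (t powr (- c))"
      unfolding Z_def
    proof (intro add_right_mono nn_integral_powr_near_zero sM t c K)
      fix r :: real assume r: "0 < r" "r \<le> t"
      have "emeasure M (cball 0 r) = (\<integral>\<^sup>+u. indicator (cball 0 r) u * ?N u \<partial>lborel)"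
        unfolding M_def by (subst emeasure_density) (simp_all add: mult.commute cball_borel)
      also have "\<dots> \<le> ennreal (K * (r / t) powr q)" using t r by (intro ball) auto
      finally show "emeasure M (cball 0 r) \<le> ennreal (K * (r / t) powr q)" .
    qed
    also have "\<dots> = ennreal ((Z + 1) * t powr (- c))"
      using Z by (subst ennreal_plus[symmetric]) (auto simp: algebra_simps)
    finally show ?thesis .
  qed
  moreover have "Z + 1 \<ge> 0" using Z by simp
  ultimately show thesis by (intro that[of "Z + 1"])
qed

lemma gauss_shifted_moment_finite:
  fixes R e :: real
  assumes "R > 0" "e \<ge> 0"
  shows "(\<integral>\<^sup>+v. ennreal ((R + norm v) powr e * gauss (v::'a::euclidean_space)) \<partial>lborel) < \<infinity>"
proof -
  have "(\<integral>\<^sup>+v. ennreal ((R + norm v) powr e * gauss (v::'a)) \<partial>lborel)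
     \<le> (\<integral>\<^sup>+v. ennreal (exp (e * R + e\<^sup>2)) * ennreal (gauss (0 + (1/2) *\<^sub>R (v::'a))) \<partial>lborel)"
  proof (intro nn_integral_mono)
    fix v :: 'a
    have pos: "R + norm v > 0" using assms by (simp add: add_pos_nonneg)
    have "e * ln (R + norm v) \<le> e * (R + norm v)"
      using assms ln_le_minus_one[OF pos] by (intro mult_left_mono) auto
    moreover have "e * norm v \<le> e\<^sup>2 + (norm v)\<^sup>2 / 2"
      using sum_squares_bound[of e "norm v"] zero_le_power2[of e] by linarith
    moreover have "1 * (norm v)\<^sup>2 \<le> pi * (norm v)\<^sup>2"
      using pi_ge_two by (intro mult_right_mono) auto
    moreover have "pi * (norm ((1/2) *\<^sub>R v))\<^sup>2 = pi * (norm v)\<^sup>2 / 4"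
      by (simp add: power_divide)
    ultimately have "e * ln (R + norm v) + (- pi * (norm v)\<^sup>2) \<le> (e * R + e\<^sup>2) + (- pi * (norm ((1/2) *\<^sub>R v))\<^sup>2)"
      unfolding distrib_left mult_minus_left using zero_le_power2[of "norm v"] by linarith
    then have "exp (e * ln (R + norm v) + (- pi * (norm v)\<^sup>2)) \<le> exp ((e * R + e\<^sup>2) + (- pi * (norm ((1/2) *\<^sub>R v))\<^sup>2))"
      by (simp only: exp_le_cancel_iff)
    then have "(R + norm v) powr e * gauss v \<le> exp (e * R + e\<^sup>2) * gauss ((1/2) *\<^sub>R v)"
      unfolding exp_add gauss_def using pos by (simp only: powr_def) auto
    then show "ennreal ((R + norm v) powr e * gauss v) \<le> ennreal (exp (e * R + e\<^sup>2)) * ennreal (gauss (0 + (1/2) *\<^sub>R v))"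
      by (subst ennreal_mult[symmetric]) (auto simp: less_imp_le[OF gauss_bounds(1)] intro: ennreal_leI)
  qed
  also have "\<dots> = ennreal (exp (e * R + e\<^sup>2)) * ennreal (1 / \<bar>1/2\<bar> ^ DIM('a))"
    by (subst nn_integral_cmult, measurable, subst nn_integral_gauss_affine) simp_all
  also have "\<dots> < \<infinity>" by (simp add: ennreal_mult_less_top)
  finally show ?thesis .
qed

text \<open>
  The mass sits within a bounded distance of the points \<open>t w\<close> with \<open>|w| \<le> R\<close>, hence at distance \<open>O(t)\<close>
  from the origin, with Gaussian tails.
\<close>

lemma smoothed_difference_positive_moment:
  fixes \<mu> :: "'a::euclidean_space measure" and e :: real
  assumes P: "prob_space \<mu>" and s: "sets \<mu> = sets borel"
    and R: "R > 0" and supp: "AE w in difference_law \<mu>. norm w \<le> R" and e: "0 \<le> e"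
  obtains K where "K \<ge> 0" and
    "\<And>t. t \<ge> 1 \<Longrightarrow> (\<integral>\<^sup>+u. ennreal (norm u powr e) * ennreal (smoothed_difference \<mu> t u) \<partial>lborel) \<le> ennreal (K * t powr e)"
proof -
  interpret D: prob_space "difference_law \<mu>" using P s by (rule prob_space_difference_law)
  define I where "I = (\<integral>\<^sup>+v. ennreal ((R + norm v) powr e * gauss (v::'a)) \<partial>lborel)"
  have I: "I < \<infinity>" unfolding I_def using R e by (rule gauss_shifted_moment_finite)
  define K where "K = enn2real I"
  have "(\<integral>\<^sup>+u. ennreal (norm u powr e) * ennreal (smoothed_difference \<mu> t u) \<partial>lborel) \<le> ennreal (K * t powr e)"
    if t: "t \<ge> 1" for t
  proof -
    have "(\<integral>\<^sup>+u. ennreal (norm u powr e) * ennreal (smoothed_difference \<mu> t u) \<partial>lborel)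
      = (\<integral>\<^sup>+w. \<integral>\<^sup>+u. ennreal (norm u powr e) * ennreal (gauss (t *\<^sub>R w - u)) \<partial>lborel \<partial>difference_law \<mu>)"
      by (intro nn_integral_smoothed_difference P s) measurable
    also have "\<dots> \<le> (\<integral>\<^sup>+w. ennreal (t powr e) * I \<partial>difference_law \<mu>)"
    proof (rule nn_integral_mono_AE)
      show "AE w in difference_law \<mu>. (\<integral>\<^sup>+u. ennreal (norm u powr e) * ennreal (gauss (t *\<^sub>R w - u)) \<partial>lborel) \<le> ennreal (t powr e) * I"
        using supp
      proof eventually_elim
        case (elim w)
        have "(\<integral>\<^sup>+u. ennreal (norm u powr e) * ennreal (gauss (t *\<^sub>R w - u)) \<partial>lborel)
          = (\<integral>\<^sup>+v. ennreal (norm (t *\<^sub>R w + 1 *\<^sub>R v) powr e) * ennreal (gauss (t *\<^sub>R w - (t *\<^sub>R w + 1 *\<^sub>R v))) \<partial>lborel)"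
          using nn_integral_lborel_affine[of "\<lambda>u. ennreal (norm u powr e) * ennreal (gauss (t *\<^sub>R w - u))" 1 "t *\<^sub>R w"]
          by simp
        also have "\<dots> \<le> (\<integral>\<^sup>+v. ennreal (t powr e) * ennreal ((R + norm v) powr e * gauss (v::'a)) \<partial>lborel)"
        proof (intro nn_integral_mono)
          fix v :: 'a
          have "norm (t *\<^sub>R w + v) \<le> t * norm w + norm v"
            using t norm_triangle_ineq[of "t *\<^sub>R w" v] by simp
          also have "\<dots> \<le> t * R + t * norm v"
            using t elim mult_right_mono[of 1 t "norm v"] by (intro add_mono mult_left_mono) auto
          finally have "norm (t *\<^sub>R w + v) powr e \<le> (t * (R + norm v)) powr e"
            using e by (intro powr_mono2) (auto simp: distrib_left)
          also have "\<dots> = t powr e * (R + norm v) powr e"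
            using t R by (subst powr_mult) auto
          finally have "norm (t *\<^sub>R w + v) powr e * gauss v \<le> t powr e * (R + norm v) powr e * gauss v"
            by (intro mult_right_mono) (auto simp: less_imp_le[OF gauss_bounds(1)])
          then show "ennreal (norm (t *\<^sub>R w + 1 *\<^sub>R v) powr e) * ennreal (gauss (t *\<^sub>R w - (t *\<^sub>R w + 1 *\<^sub>R v)))
            \<le> ennreal (t powr e) * ennreal ((R + norm v) powr e * gauss v)"
            by (auto simp: gauss_minus ennreal_mult[symmetric] less_imp_le[OF gauss_bounds(1)] mult.assoc intro!: ennreal_leI)
        qed
        also have "\<dots> = ennreal (t powr e) * I"
          unfolding I_def by (rule nn_integral_cmult) measurable
        finally show ?case .
      qed
    qed
    also have "\<dots> = ennreal (t powr e) * I" by (simp add: D.emeasure_space_1)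
    also have "I = ennreal K" unfolding K_def using I by simp
    also have "ennreal (t powr e) * ennreal K = ennreal (K * t powr e)"
      by (subst ennreal_mult[symmetric]) (auto simp: K_def mult.commute)
    finally show ?thesis .
  qed
  moreover have "K \<ge> 0" by (simp add: K_def)
  ultimately show thesis by (intro that[of K])
qed

lemma powr_weighted3_le_add:
  fixes x y z :: real
  assumes "0 \<le> x" "0 \<le> y" "0 \<le> z" "0 \<le> a" "0 \<le> b" "0 \<le> g" "a + b + g = 1"
  shows "x powr a * y powr b * z powr g \<le> x + y + z"
proof -
  define M where "M = max x (max y z)"
  have M: "M \<ge> 0" "x \<le> M" "y \<le> M" "z \<le> M" using assms by (auto simp: M_def)
  have "x powr a * y powr b * z powr g \<le> M powr a * M powr b * M powr g"
    using assms M by (intro mult_mono powr_mono2) auto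
  also have "\<dots> = M" using M assms by (simp add: powr_add[symmetric])
  also have "M \<le> x + y + z" using assms by (auto simp: M_def)
  finally show ?thesis .
qed

text \<open>
  The integrand of the three-fold Hoelder inequality with exponents \<open>\<theta>/2\<close>, \<open>1 - \<theta>\<close> and \<open>\<theta>/2\<close>. Instead of
  integrating each factor, multiply the three terms by the powers of \<open>t\<close> that make their integrals
  bounded; the weighted geometric mean then collects exactly the factor \<open>t\<^bsup>\<sigma>\<^esup>\<close>.
\<close>

lemma product_le_three_terms:
  fixes m N n t \<theta> s d q :: real
  defines "c \<equiv> (s - d * \<theta>) / (2 * (1 - \<theta>))" and "\<sigma> \<equiv> (s - d * \<theta> + q * \<theta>) / 2"
  assumes m: "0 \<le> m" and N: "0 \<le> N" and n: "0 < n" and t: "0 < t" and \<theta>: "0 < \<theta>" "\<theta> < 1"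
  shows "m * N \<le> t powr (- \<sigma>) * (m powr (2 / \<theta>) * n powr (s / \<theta> - d) + t powr c * (n powr (- c) * N) + t powr q * N\<^sup>2)"
proof (cases "m = 0 \<or> N = 0")
  case True
  then show ?thesis using N by auto
next
  case False
  then have m: "m > 0" and N: "N > 0" using m N by auto
  have N2: "N\<^sup>2 = N powr 2" using N by simp
  let ?X = "m powr (2 / \<theta>) * n powr (s / \<theta> - d)" and ?Y = "t powr c * (n powr (- c) * N)" and ?Z = "t powr q * N\<^sup>2"
  have c: "c * (1 - \<theta>) = (s - d * \<theta>) / 2" using \<theta> by (simp add: c_def field_simps)
  have X: "?X powr (\<theta> / 2) = m * n powr ((s - d * \<theta>) / 2)"
  proof -
    have "(s / \<theta> - d) * (\<theta> / 2) = (s - d * \<theta>) / 2" using \<theta> by (simp add: field_simps)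
    then show ?thesis using m n \<theta> by (simp add: powr_mult powr_powr)
  qed
  have Y: "?Y powr (1 - \<theta>) = t powr ((s - d * \<theta>) / 2) * n powr (- ((s - d * \<theta>) / 2)) * N powr (1 - \<theta>)"
    using m n N t by (simp only: powr_mult powr_powr c mult_minus_left mult.assoc)
  have Z: "?Z powr (\<theta> / 2) = t powr (q * \<theta> / 2) * N powr \<theta>"
    unfolding N2 using N t by (simp only: powr_mult powr_powr) simp
  have "?X powr (\<theta> / 2) * ?Y powr (1 - \<theta>) * ?Z powr (\<theta> / 2)
     = m * (n powr ((s - d * \<theta>) / 2) * n powr (- ((s - d * \<theta>) / 2))) * (N powr (1 - \<theta>) * N powr \<theta>)
       * (t powr ((s - d * \<theta>) / 2) * t powr (q * \<theta> / 2))"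
    unfolding X Y Z by (simp only: mult_ac)
  also have "\<dots> = m * N * t powr \<sigma>"
  proof -
    have "(s - d * \<theta>) / 2 + q * \<theta> / 2 = \<sigma>" by (simp add: \<sigma>_def field_simps)
    then show ?thesis using n N unfolding powr_add[symmetric] by simp
  qed
  finally have "m * N * t powr \<sigma> \<le> ?X + ?Y + ?Z"
    using powr_weighted3_le_add[of ?X ?Y ?Z "\<theta> / 2" "1 - \<theta>" "\<theta> / 2"] \<theta> N by simp
  then have "t powr (- \<sigma>) * (m * N * t powr \<sigma>) \<le> t powr (- \<sigma>) * (?X + ?Y + ?Z)"
    by (intro mult_left_mono) auto
  moreover have "t powr (- \<sigma>) * t powr \<sigma> = 1" using t by (simp add: powr_minus)
  then have "t powr (- \<sigma>) * (m * N * t powr \<sigma>) = m * N"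
    by (simp only: mult.left_commute[of "t powr (- \<sigma>)"] mult_1_right)
  ultimately show ?thesis by simp
qed

text \<open>
  The main estimate. The sign of \<open>c\<close> decides whether the moment of the smoothed difference law is
  governed by its behaviour near the origin or by the size of its support.
\<close>

lemma fourier_smoothed_difference_decay:
  fixes \<mu> :: "'a::euclidean_space measure" and s \<theta> q r :: real
  defines "c \<equiv> (s - real DIM('a) * \<theta>) / (2 * (1 - \<theta>))" and "\<sigma> \<equiv> (s - real DIM('a) * \<theta> + q * \<theta>) / 2"
  assumes P: "prob_space \<mu>" and S: "sets \<mu> = sets borel"
    and R: "R > 0" and supp: "AE w in difference_law \<mu>. norm w \<le> R"
    and \<theta>: "0 < \<theta>" "\<theta> < 1"
    and fin: "fourier_moment \<mu> (2 / \<theta>) (s / \<theta>) < \<infinity>"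
    and fin4: "fourier_moment \<mu> 4 q < \<infinity>" "q \<le> DIM('a)"
    and fin2: "fourier_moment \<mu> 2 r < \<infinity>" "c < r" "r \<le> DIM('a)"
  obtains K where "K \<ge> 0" and
    "\<And>t. t \<ge> 1 \<Longrightarrow>
       (\<integral>\<^sup>+u. ennreal (cmod (fourier_transform \<mu> u)) * ennreal (smoothed_difference \<mu> t u) \<partial>lborel) \<le> ennreal (K * t powr (- \<sigma>))"
proof -
  have [measurable]: "smoothed_difference \<mu> t \<in> borel_measurable borel" for t
    using P S by (rule smoothed_difference_measurable)
  have [measurable]: "fourier_transform \<mu> \<in> borel_measurable borel"
    using P S by (intro fourier_transform_measurable) (auto simp: prob_space_def)
  obtain K1 where K1: "K1 \<ge> 0" and moment: "\<And>t. t \<ge> 1 \<Longrightarrow>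
     (\<integral>\<^sup>+u. ennreal (norm u powr (- c)) * ennreal (smoothed_difference \<mu> t u) \<partial>lborel) \<le> ennreal (K1 * t powr (- c))"
  proof (cases "0 \<le> c")
    case True
    from smoothed_difference_negative_moment[OF P S this fin2(2,3,1)] obtain K where K: "K \<ge> 0" "\<And>t. t > 0 \<Longrightarrow>
     (\<integral>\<^sup>+u. ennreal (norm u powr (- c)) * ennreal (smoothed_difference \<mu> t u) \<partial>lborel) \<le> ennreal (K * t powr (- c))" by metis
    show thesis by (rule that[of K]) (use K in auto)
  next
    case False
    then have "0 \<le> - c" by simp
    from smoothed_difference_positive_moment[OF P S R supp this] obtain K where K: "K \<ge> 0" "\<And>t. t \<ge> 1 \<Longrightarrow>
     (\<integral>\<^sup>+u. ennreal (norm u powr (- c)) * ennreal (smoothed_difference \<mu> t u) \<partial>lborel) \<le> ennreal (K * t powr (- c))" by metis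
    show thesis by (rule that[of K]) (use K in auto)
  qed
  obtain K2 where K2: "K2 \<ge> 0" and square: "\<And>t. t > 0 \<Longrightarrow>
     (\<integral>\<^sup>+u. ennreal ((smoothed_difference \<mu> t u)\<^sup>2) \<partial>lborel) \<le> ennreal (K2 * t powr (- q))"
    using smoothed_difference_square_bound[OF P S fin4(2,1)] by metis
  define J where "J = enn2real (fourier_moment \<mu> (2 / \<theta>) (s / \<theta>))"
  have J: "fourier_moment \<mu> (2 / \<theta>) (s / \<theta>) = ennreal J" "J \<ge> 0" using fin by (simp_all add: J_def)
  let ?K = "J + K1 + K2"
  have "(\<integral>\<^sup>+u. ennreal (cmod (fourier_transform \<mu> u)) * ennreal (smoothed_difference \<mu> t u) \<partial>lborel) \<le> ennreal (?K * t powr (- \<sigma>))"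
    if t: "t \<ge> 1" for t
  proof -
    let ?m = "\<lambda>u. cmod (fourier_transform \<mu> u)" and ?N = "smoothed_difference \<mu> t"
    let ?X = "\<lambda>u. ennreal (?m u powr (2 / \<theta>) * norm u powr (s / \<theta> - DIM('a)))"
    let ?Y = "\<lambda>u. ennreal (norm u powr (- c)) * ennreal (?N u)"
    let ?Z = "\<lambda>u. ennreal ((?N u)\<^sup>2)"
    have "(\<integral>\<^sup>+u. ennreal (?m u) * ennreal (?N u) \<partial>lborel)
       \<le> (\<integral>\<^sup>+u. ennreal (t powr (- \<sigma>)) * (?X u + (ennreal (t powr c) * ?Y u + ennreal (t powr q) * ?Z u)) \<partial>lborel)"
    proof (rule nn_integral_mono_AE)
      have "AE u in lborel. u \<noteq> (0::'a)" by (rule AE_lborel_singleton)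
      then show "AE u in lborel. ennreal (?m u) * ennreal (?N u)
         \<le> ennreal (t powr (- \<sigma>)) * (?X u + (ennreal (t powr c) * ?Y u + ennreal (t powr q) * ?Z u))"
      proof eventually_elim
        case (elim u)
        let ?A = "?m u powr (2 / \<theta>) * norm u powr (s / \<theta> - DIM('a))" and ?B = "t powr c * (norm u powr (- c) * ?N u)" and ?C = "t powr q * (?N u)\<^sup>2"
        have N0: "0 \<le> ?N u" by (rule smoothed_difference_nonneg)
        have "?m u * ?N u \<le> t powr (- \<sigma>) * (?A + ?B + ?C)"
          unfolding c_def \<sigma>_def using elim t \<theta> N0 by (intro product_le_three_terms) auto
        then have "ennreal (?m u * ?N u) \<le> ennreal (t powr (- \<sigma>) * (?A + (?B + ?C)))"
          by (intro ennreal_leI) (simp add: add.assoc)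
        also have "\<dots> = ennreal (t powr (- \<sigma>)) * (?X u + (ennreal (t powr c) * ?Y u + ennreal (t powr q) * ?Z u))"
          using N0 by (simp add: ennreal_mult ennreal_plus)
        finally show ?case using N0 by (simp add: ennreal_mult)
      qed
    qed
    also have "\<dots> = ennreal (t powr (- \<sigma>)) * ((\<integral>\<^sup>+u. ?X u \<partial>lborel) + (ennreal (t powr c) * (\<integral>\<^sup>+u. ?Y u \<partial>lborel) + ennreal (t powr q) * (\<integral>\<^sup>+u. ?Z u \<partial>lborel)))"
      by (simp add: nn_integral_cmult nn_integral_add)
    also have "\<dots> \<le> ennreal (t powr (- \<sigma>)) * (ennreal J + (ennreal (t powr c) * ennreal (K1 * t powr (- c)) + ennreal (t powr q) * ennreal (K2 * t powr (- q))))"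
      using t J moment[of t] square[of t] unfolding fourier_moment_def
      by (intro mult_left_mono add_mono) auto
    also have "ennreal (t powr c) * ennreal (K1 * t powr (- c)) = ennreal K1"
      using t K1 by (subst ennreal_mult[symmetric]) (auto simp: powr_minus)
    also have "ennreal (t powr q) * ennreal (K2 * t powr (- q)) = ennreal K2"
      using t K2 by (subst ennreal_mult[symmetric]) (auto simp: powr_minus)
    also have "ennreal (t powr (- \<sigma>)) * (ennreal J + (ennreal K1 + ennreal K2)) = ennreal (?K * t powr (- \<sigma>))"
      using J K1 K2 by (simp add: ennreal_plus[symmetric] ennreal_mult[symmetric] mult.commute add.assoc del: ennreal_plus)
    finally show ?thesis .
  qed
  moreover have "?K \<ge> 0" using J K1 K2 by simp
  ultimately show thesis by (intro that[of ?K])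
qed

section \<open>Triples with nearly equal squared distances\<close>

lemma norm_integral_le_nn_integral:
  fixes f :: "'b \<Rightarrow> 'c::{banach, second_countable_topology}"
  shows "ennreal (norm (LINT x|M. f x)) \<le> (\<integral>\<^sup>+x. ennreal (norm (f x)) \<partial>M)"
  by (cases "integrable M f") (simp_all add: integral_norm_bound_ennreal not_integrable_integral_eq)

lemma weighted_fourier_minus: "cmod (weighted_fourier \<mu> (- z)) = cmod (weighted_fourier \<mu> z)"
proof -
  have "weighted_fourier \<mu> (- z) = (LINT x|\<mu>. cnj (of_real (gauss x) * exp (- 2 * of_real pi * \<i> * of_real (z \<bullet> x))))"
    unfolding weighted_fourier_def by (intro Bochner_Integration.integral_cong refl) (simp add: exp_cnj)
  also have "\<dots> = cnj (weighted_fourier \<mu> z)" unfolding weighted_fourier_def by (rule Bochner_Integration.integral_cnj)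
  finally show ?thesis by simp
qed

text \<open>
  The quantity whose decay in \<open>t\<close> controls triples of points at nearly equal distances.
\<close>

definition difference_energy :: "'a::euclidean_space measure \<Rightarrow> real \<Rightarrow> ennreal" where
  "difference_energy \<mu> t = (\<integral>\<^sup>+w. ennreal (cmod (weighted_fourier \<mu> (t *\<^sub>R w))) \<partial>difference_law \<mu>)"

lemma difference_energy_abs: "difference_energy \<mu> \<bar>t\<bar> = difference_energy \<mu> t"
  using weighted_fourier_minus[of \<mu> "t *\<^sub>R _"] by (cases "t \<ge> 0") (auto simp: difference_energy_def)

lemma difference_energy_le_1:
  assumes P: "prob_space \<mu>" and S: "sets \<mu> = sets borel"
  shows "difference_energy \<mu> t \<le> 1"
proof -
  interpret prob_space \<mu> by fact
  interpret D: prob_space "difference_law \<mu>" using P S by (rule prob_space_difference_law)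
  have "cmod (weighted_fourier \<mu> z) \<le> 1" for z
  proof -
    have "cmod (weighted_fourier \<mu> z) \<le> (LINT x|\<mu>. cmod (of_real (gauss x) * exp (- 2 * of_real pi * \<i> * of_real (z \<bullet> x))))"
      unfolding weighted_fourier_def by (rule integral_norm_bound)
    also have "\<dots> = (LINT x|\<mu>. gauss x)"
      by (simp add: norm_mult norm_exp_eq_Re abs_of_pos[OF gauss_bounds(1)])
    also have "\<dots> \<le> (LINT x|\<mu>. 1)"
    proof (rule integral_mono)
      have "gauss \<in> borel_measurable \<mu>" using S by (simp add: measurable_cong_sets[OF S refl])
      then show "integrable \<mu> gauss"
        by (intro integrable_const_bound[where B = 1]) (auto simp: gauss_bounds less_imp_le[OF gauss_bounds(1)])
    qed (auto simp: gauss_bounds)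
    finally show ?thesis by (simp add: prob_space)
  qed
  then have "difference_energy \<mu> t \<le> (\<integral>\<^sup>+w. 1 \<partial>difference_law \<mu>)"
    unfolding difference_energy_def by (intro nn_integral_mono) (simp add: ennreal_le_1)
  also have "\<dots> = 1" by (simp add: D.emeasure_space_1)
  finally show ?thesis .
qed

text \<open>
  The quadratic terms in \<open>x\<close> cancel. This is the reason for working with squared distances.
\<close>

lemma dist_square_difference:
  fixes x y y' :: "'a::real_inner"
  shows "(dist x y)\<^sup>2 - (dist x y')\<^sup>2 = ((norm y)\<^sup>2 - (norm y')\<^sup>2) + 2 * ((y' - y) \<bullet> x)"
  unfolding dist_norm power2_norm_eq_inner
  by (simp add: inner_diff_left inner_diff_right inner_commute[of y x] inner_commute[of y' x] algebra_simps)

text \<open>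
  The Gaussian weight makes this a finite measure of mass at most 1, in general not a probability.
\<close>

definition square_difference_law :: "'a::euclidean_space measure \<Rightarrow> real measure" where
  "square_difference_law \<mu> =
     distr ((\<mu> \<Otimes>\<^sub>M \<mu>) \<Otimes>\<^sub>M density \<mu> (\<lambda>x. ennreal (gauss x))) borel
       (\<lambda>(p, x). (dist x (fst p))\<^sup>2 - (dist x (snd p))\<^sup>2)"

lemma finite_measure_density_gauss:
  assumes P: "prob_space \<mu>" and S[measurable_cong]: "sets \<mu> = sets borel"
  shows "finite_measure (density \<mu> (\<lambda>x. ennreal (gauss x)))"
proof -
  interpret prob_space \<mu> by fact
  have "(\<integral>\<^sup>+x. ennreal (gauss x) \<partial>\<mu>) \<le> (\<integral>\<^sup>+x. 1 \<partial>\<mu>)"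
    by (intro nn_integral_mono) (simp add: gauss_bounds)
  then have "(\<integral>\<^sup>+x. ennreal (gauss x) \<partial>\<mu>) \<noteq> \<infinity>"
    using emeasure_space_1 by (auto simp: top_unique)
  then show ?thesis by (intro finite_measureI) (simp add: emeasure_density cong: nn_integral_cong)
qed

text \<open>
  Integrate in \<open>x\<close> first: the part that does not depend on \<open>x\<close> is a phase of modulus 1, and the
  rest is the weighted transform at \<open>2 t (y' - y)\<close>.
\<close>

lemma fourier_square_difference_law_le:
  fixes \<mu> :: "'a::euclidean_space measure"
  assumes P: "prob_space \<mu>" and S[measurable_cong]: "sets \<mu> = sets borel"
  shows "ennreal (cmod (fourier_transform (square_difference_law \<mu>) t)) \<le> difference_energy \<mu> (2 * t)"
proof -
  interpret prob_space \<mu> by fact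
  interpret PP: pair_prob_space \<mu> \<mu> ..
  define \<gamma> where "\<gamma> = density \<mu> (\<lambda>x. ennreal (gauss x))"
  interpret G: finite_measure \<gamma> unfolding \<gamma>_def using P S by (rule finite_measure_density_gauss)
  have [measurable_cong]: "sets \<gamma> = sets borel" by (simp add: \<gamma>_def S)
  interpret Q: pair_sigma_finite "\<mu> \<Otimes>\<^sub>M \<mu>" \<gamma> ..
  interpret QF: finite_measure "(\<mu> \<Otimes>\<^sub>M \<mu>) \<Otimes>\<^sub>M \<gamma>"
    by (intro finite_measure_pair_measure PP.P.finite_measure_axioms G.finite_measure_axioms)
  let ?e = "\<lambda>a::real. exp (- 2 * of_real pi * \<i> * of_real a)"
  let ?D = "\<lambda>p x. (dist x (fst p))\<^sup>2 - (dist x (snd p))\<^sup>2"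
  have eadd: "?e (a + b) = ?e a * ?e b" for a b
    by (simp add: exp_add[symmetric] algebra_simps)
  have ne: "cmod (?e a) = 1" for a by (simp add: norm_exp_eq_Re)
  have int: "integrable ((\<mu> \<Otimes>\<^sub>M \<mu>) \<Otimes>\<^sub>M \<gamma>) (\<lambda>(p, x). ?e (t * ?D p x))"
    by (rule QF.integrable_const_bound[where B = 1]) (auto simp: norm_exp_eq_Re)
  have "fourier_transform (square_difference_law \<mu>) t = (LINT z|((\<mu> \<Otimes>\<^sub>M \<mu>) \<Otimes>\<^sub>M \<gamma>). (case z of (p, x) \<Rightarrow> ?e (t * ?D p x)))"
    unfolding fourier_transform_def square_difference_law_def \<gamma>_def[symmetric]
    by (subst integral_distr) (auto simp: case_prod_beta intro!: Bochner_Integration.integral_cong)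
  also have "\<dots> = (LINT p|(\<mu> \<Otimes>\<^sub>M \<mu>). LINT x|\<gamma>. ?e (t * ?D p x))"
    by (rule Q.integral_fst[OF int, symmetric])
  also have "\<dots> = (LINT p|(\<mu> \<Otimes>\<^sub>M \<mu>). ?e (t * ((norm (fst p))\<^sup>2 - (norm (snd p))\<^sup>2)) * weighted_fourier \<mu> ((2 * t) *\<^sub>R (snd p - fst p)))"
  proof (intro Bochner_Integration.integral_cong refl)
    fix p :: "'a \<times> 'a"
    have "?e (t * ?D p x) = ?e (t * ((norm (fst p))\<^sup>2 - (norm (snd p))\<^sup>2)) * ?e (((2 * t) *\<^sub>R (snd p - fst p)) \<bullet> x)" for x
      unfolding eadd[symmetric] dist_square_difference by (simp add: algebra_simps)
    then have "(LINT x|\<gamma>. ?e (t * ?D p x))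
        = ?e (t * ((norm (fst p))\<^sup>2 - (norm (snd p))\<^sup>2)) * (LINT x|\<gamma>. ?e (((2 * t) *\<^sub>R (snd p - fst p)) \<bullet> x))"
      by (simp only: integral_mult_right_zero)
    also have "(LINT x|\<gamma>. ?e (((2 * t) *\<^sub>R (snd p - fst p)) \<bullet> x)) = weighted_fourier \<mu> ((2 * t) *\<^sub>R (snd p - fst p))"
      unfolding \<gamma>_def weighted_fourier_def by (subst integral_density) (auto simp: less_imp_le[OF gauss_bounds(1)] scaleR_conv_of_real)
    finally show "(LINT x|\<gamma>. ?e (t * ?D p x))
       = ?e (t * ((norm (fst p))\<^sup>2 - (norm (snd p))\<^sup>2)) * weighted_fourier \<mu> ((2 * t) *\<^sub>R (snd p - fst p))" .
  qed
  finally have "ennreal (cmod (fourier_transform (square_difference_law \<mu>) t))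
     \<le> (\<integral>\<^sup>+p. ennreal (cmod (?e (t * ((norm (fst p))\<^sup>2 - (norm (snd p))\<^sup>2)) * weighted_fourier \<mu> ((2 * t) *\<^sub>R (snd p - fst p)))) \<partial>(\<mu> \<Otimes>\<^sub>M \<mu>))"
    by (simp only: norm_integral_le_nn_integral)
  also have "\<dots> = (\<integral>\<^sup>+p. ennreal (cmod (weighted_fourier \<mu> ((2 * t) *\<^sub>R (snd p - fst p)))) \<partial>(\<mu> \<Otimes>\<^sub>M \<mu>))"
    by (simp only: norm_mult ne mult_1)
  also have "\<dots> = difference_energy \<mu> (2 * t)"
    unfolding difference_energy_def difference_law_def using weighted_fourier_measurable[OF P S]
    by (subst nn_integral_distr) (simp_all add: case_prod_beta')
  finally show ?thesis .
qed

text \<open>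
  Parseval on the line, applied to the law of the difference of squared distances.
\<close>

lemma triple_gauss_le:
  fixes \<mu> :: "'a::euclidean_space measure"
  assumes P: "prob_space \<mu>" and S[measurable_cong]: "sets \<mu> = sets borel" and r: "r > 0"
  shows "(\<integral>\<^sup>+x. ennreal (gauss x) * (\<integral>\<^sup>+y. \<integral>\<^sup>+y'. ennreal (gauss (((dist x y)\<^sup>2 - (dist x y')\<^sup>2) / r)) \<partial>\<mu> \<partial>\<mu>) \<partial>\<mu>)
     \<le> (\<integral>\<^sup>+\<tau>. ennreal (gauss \<tau>) * difference_energy \<mu> (2 * (\<tau> / r)) \<partial>(lborel :: real measure))"
proof -
  interpret prob_space \<mu> by fact
  interpret PP: pair_prob_space \<mu> \<mu> ..
  define \<gamma> where "\<gamma> = density \<mu> (\<lambda>x. ennreal (gauss x))"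
  interpret G: finite_measure \<gamma> unfolding \<gamma>_def using P S by (rule finite_measure_density_gauss)
  have [measurable_cong]: "sets \<gamma> = sets borel" by (simp add: \<gamma>_def S)
  interpret Q: pair_sigma_finite "\<mu> \<Otimes>\<^sub>M \<mu>" \<gamma> ..
  interpret QF: finite_measure "(\<mu> \<Otimes>\<^sub>M \<mu>) \<Otimes>\<^sub>M \<gamma>"
    by (intro finite_measure_pair_measure PP.P.finite_measure_axioms G.finite_measure_axioms)
  define L where "L = square_difference_law \<mu>"
  have L: "L = distr ((\<mu> \<Otimes>\<^sub>M \<mu>) \<Otimes>\<^sub>M \<gamma>) borel (\<lambda>(p, x). (dist x (fst p))\<^sup>2 - (dist x (snd p))\<^sup>2)"
    by (simp add: L_def square_difference_law_def \<gamma>_def)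
  have sL: "sets L = sets borel" by (simp add: L)
  have fL: "finite_measure L" unfolding L by (rule QF.finite_measure_distr) measurable
  interpret L: finite_measure L by (rule fL)
  have gm: "(\<lambda>w. gauss (w / r)) \<in> borel_measurable L" using sL by (simp add: measurable_cong_sets[OF sL refl])
  let ?g = "\<lambda>x y y'. ennreal (gauss (((dist x y)\<^sup>2 - (dist x y')\<^sup>2) / r))"
  have "(\<integral>\<^sup>+x. ennreal (gauss x) * (\<integral>\<^sup>+y. \<integral>\<^sup>+y'. ?g x y y' \<partial>\<mu> \<partial>\<mu>) \<partial>\<mu>)
      = (\<integral>\<^sup>+x. (\<integral>\<^sup>+y. \<integral>\<^sup>+y'. ?g x y y' \<partial>\<mu> \<partial>\<mu>) \<partial>\<gamma>)"
    unfolding \<gamma>_def by (subst nn_integral_density) measurable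
  also have "\<dots> = (\<integral>\<^sup>+x. (\<integral>\<^sup>+p. ?g x (fst p) (snd p) \<partial>(\<mu> \<Otimes>\<^sub>M \<mu>)) \<partial>\<gamma>)"
  proof (intro nn_integral_cong)
    fix x :: 'a
    show "(\<integral>\<^sup>+y. \<integral>\<^sup>+y'. ?g x y y' \<partial>\<mu> \<partial>\<mu>) = (\<integral>\<^sup>+p. ?g x (fst p) (snd p) \<partial>(\<mu> \<Otimes>\<^sub>M \<mu>))"
      using sigma_finite_measure.nn_integral_fst[OF sigma_finite_measure_axioms, of "\<lambda>p. ?g x (fst p) (snd p)" \<mu>] by simp
  qed
  also have "\<dots> = (\<integral>\<^sup>+z. (case z of (p, x) \<Rightarrow> ?g x (fst p) (snd p)) \<partial>((\<mu> \<Otimes>\<^sub>M \<mu>) \<Otimes>\<^sub>M \<gamma>))"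
    using Q.nn_integral_snd[of "\<lambda>(p, x). ?g x (fst p) (snd p)"] by simp
  also have "\<dots> = (\<integral>\<^sup>+w. ennreal (gauss (w / r)) \<partial>L)"
    unfolding L by (subst nn_integral_distr) (simp_all add: case_prod_beta')
  also have "\<dots> = ennreal (LINT w|L. gauss (w / r))"
    using gm by (intro nn_integral_eq_integral L.integrable_const_bound[where B = 1])
       (auto simp: gauss_bounds less_imp_le[OF gauss_bounds(1)])
  also have "\<dots> \<le> ennreal (cmod (LINT w|L. complex_of_real (gauss (w / r))))"
    by (intro ennreal_leI) (simp only: integral_complex_of_real norm_of_real abs_ge_self)
  also have "(LINT w|L. complex_of_real (gauss (w / r))) = (LINT \<xi>|lborel. of_real (gauss \<xi>) * fourier_transform L (\<xi> / r))"
    using gauss_weighted_integral_fourier[OF fL sL, of "1 / r" 0] by simp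
  also have "ennreal (cmod (LINT \<xi>|lborel. of_real (gauss \<xi>) * fourier_transform L (\<xi> / r)))
     \<le> (\<integral>\<^sup>+\<xi>. ennreal (cmod (of_real (gauss \<xi>) * fourier_transform L (\<xi> / r))) \<partial>lborel)"
    by (rule norm_integral_le_nn_integral)
  also have "\<dots> \<le> (\<integral>\<^sup>+\<tau>. ennreal (gauss \<tau>) * difference_energy \<mu> (2 * (\<tau> / r)) \<partial>lborel)"
  proof (intro nn_integral_mono)
    fix \<tau> :: real
    have "ennreal (cmod (of_real (gauss \<tau>) * fourier_transform L (\<tau> / r))) = ennreal (gauss \<tau>) * ennreal (cmod (fourier_transform L (\<tau> / r)))"
      by (simp add: norm_mult abs_of_pos[OF gauss_bounds(1)] ennreal_mult less_imp_le[OF gauss_bounds(1)])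
    also have "\<dots> \<le> ennreal (gauss \<tau>) * difference_energy \<mu> (2 * (\<tau> / r))"
      unfolding L_def by (intro mult_left_mono fourier_square_difference_law_le P S) simp
    finally show "ennreal (cmod (of_real (gauss \<tau>) * fourier_transform L (\<tau> / r))) \<le> ennreal (gauss \<tau>) * difference_energy \<mu> (2 * (\<tau> / r))" .
  qed
  finally show ?thesis .
qed

text \<open>
  After the substitution \<open>t = 2 \<tau> / r\<close> the Gaussian is dominated by \<open>|\<tau>|\<^bsup>b - 1\<^esup>\<close>, which is homogeneous and
  produces the factor \<open>r\<^bsup>b\<^esup>\<close>. The remaining integral of \<open>|t|\<^bsup>b - 1\<^esup> min(1, |t|\<^bsup>-\<sigma>\<^esup>)\<close> is finite because
  \<open>0 < b < \<sigma>\<close>. This treats \<open>b = 1\<close> on the same footing as \<open>b < 1\<close>.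
\<close>

lemma triple_gauss_decay:
  fixes \<mu> :: "'a::euclidean_space measure" and \<sigma> b K :: real
  assumes P: "prob_space \<mu>" and S: "sets \<mu> = sets borel"
    and K: "K \<ge> 0" and decay: "\<And>t. t \<ge> 1 \<Longrightarrow>
       (\<integral>\<^sup>+u. ennreal (cmod (fourier_transform \<mu> u)) * ennreal (smoothed_difference \<mu> t u) \<partial>lborel) \<le> ennreal (K * t powr (- \<sigma>))"
    and b: "0 < b" "b \<le> 1" "b < \<sigma>"
  obtains C where "C \<ge> 0" and "\<And>r. r > 0 \<Longrightarrow>
    (\<integral>\<^sup>+x. ennreal (gauss x) * (\<integral>\<^sup>+y. \<integral>\<^sup>+y'. ennreal (gauss (((dist x y)\<^sup>2 - (dist x y')\<^sup>2) / r)) \<partial>\<mu> \<partial>\<mu>) \<partial>\<mu>)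
     \<le> ennreal (C * r powr b)"
proof -
  define e where "e = exp ((1 - b)\<^sup>2) * (1 + K)"
  have e: "e \<ge> 0" using K by (simp add: e_def)
  define k where "k \<tau> = indicator (cball 0 1) \<tau> * ennreal (norm \<tau> powr (b - DIM(real)))
        + indicator (- cball 0 1) \<tau> * ennreal (norm \<tau> powr (- (\<sigma> - b) - DIM(real)))" for \<tau> :: real
  have [measurable]: "k \<in> borel_measurable borel" unfolding k_def[abs_def] using cball_borel[of "0::real" 1] by measurable
  define I where "I = (\<integral>\<^sup>+\<tau>. k \<tau> \<partial>lborel)"
  have "I < \<infinity>"
  proof -
    have "I = (\<integral>\<^sup>+\<tau>. indicator (cball 0 1) \<tau> * ennreal (norm (\<tau>::real) powr (b - DIM(real))) \<partial>lborel)
       + (\<integral>\<^sup>+\<tau>. indicator (- cball 0 1) \<tau> * ennreal (norm (\<tau>::real) powr (- (\<sigma> - b) - DIM(real))) \<partial>lborel)"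
      unfolding I_def k_def by (rule nn_integral_add) (use cball_borel[of "0::real" 1] in measurable)
    then show ?thesis using b lborel_powr_near_zero[of b, where 'a=real] lborel_powr_far[of "\<sigma> - b", where 'a=real]
      by (simp add: less_top)
  qed
  have kk: "ennreal (gauss \<tau>) * difference_energy \<mu> (2 * (\<tau> / r))
        \<le> ennreal (e * (r / 2) powr (b - 1)) * k (0 + (2 / r) *\<^sub>R \<tau>)" if r: "r > 0" and \<tau>: "\<tau> \<noteq> 0" for r \<tau> :: real
  proof -
    define t where "t = \<bar>2 * (\<tau> / r)\<bar>"
    have t: "t > 0" using r \<tau> by (simp add: t_def)
    have abs\<tau>: "\<bar>\<tau>\<bar> = (r / 2) * t" using r by (simp add: t_def abs_mult)
    have nt: "norm (0 + (2 / r) *\<^sub>R \<tau>) = t" using r by (simp add: t_def abs_mult)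
    have E: "difference_energy \<mu> t \<le> ennreal ((1 + K) * (if t \<le> 1 then 1 else t powr (- \<sigma>)))"
    proof (cases "t \<le> 1")
      case True
      have "difference_energy \<mu> t \<le> ennreal 1" using difference_energy_le_1[OF P S] by simp
      also have "\<dots> \<le> ennreal (1 + K)" using K by (intro ennreal_leI) auto
      finally show ?thesis using True by simp
    next
      case False
      have "difference_energy \<mu> t \<le> (\<integral>\<^sup>+u. ennreal (cmod (fourier_transform \<mu> u)) * ennreal (smoothed_difference \<mu> t u) \<partial>lborel)"
        unfolding difference_energy_def by (rule weighted_fourier_difference_le[OF P S])
      also have "\<dots> \<le> ennreal (K * t powr (- \<sigma>))" using False by (intro decay) simp
      also have "\<dots> \<le> ennreal ((1 + K) * t powr (- \<sigma>))" by (intro ennreal_leI mult_right_mono) auto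
      finally show ?thesis using False by simp
    qed
    have g: "gauss \<tau> \<le> exp ((1 - b)\<^sup>2) * ((r / 2) powr (b - 1) * t powr (b - 1))"
    proof -
      have "gauss \<tau> \<le> exp ((1 - b)\<^sup>2) * norm \<tau> powr (- (1 - b))"
        using b \<tau> by (intro gauss_le_powr) auto
      also have "norm \<tau> powr (- (1 - b)) = (r / 2) powr (b - 1) * t powr (b - 1)"
        using r t powr_mult[of "r / 2" t "b - 1"] by (simp add: abs\<tau>)
      finally show ?thesis .
    qed
    have "ennreal (gauss \<tau>) * difference_energy \<mu> (2 * (\<tau> / r)) = ennreal (gauss \<tau>) * difference_energy \<mu> t"
      by (simp only: t_def difference_energy_abs)
    also have "\<dots> \<le> ennreal (exp ((1 - b)\<^sup>2) * ((r / 2) powr (b - 1) * t powr (b - 1))) * ennreal ((1 + K) * (if t \<le> 1 then 1 else t powr (- \<sigma>)))"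
      by (intro mult_mono ennreal_leI g E) auto
    also have "\<dots> = ennreal (e * (r / 2) powr (b - 1)) * ennreal (t powr (b - 1) * (if t \<le> 1 then 1 else t powr (- \<sigma>)))"
    proof -
      let ?u = "if t \<le> 1 then 1 else t powr (- \<sigma>)"
      have "ennreal (exp ((1 - b)\<^sup>2) * ((r / 2) powr (b - 1) * t powr (b - 1))) * ennreal ((1 + K) * ?u)
          = ennreal ((exp ((1 - b)\<^sup>2) * ((r / 2) powr (b - 1) * t powr (b - 1))) * ((1 + K) * ?u))"
        using K by (intro ennreal_mult[symmetric]) auto
      also have "(exp ((1 - b)\<^sup>2) * ((r / 2) powr (b - 1) * t powr (b - 1))) * ((1 + K) * ?u)
          = (e * (r / 2) powr (b - 1)) * (t powr (b - 1) * ?u)"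
        unfolding e_def by (simp only: mult_ac)
      also have "ennreal \<dots> = ennreal (e * (r / 2) powr (b - 1)) * ennreal (t powr (b - 1) * ?u)"
        using e by (intro ennreal_mult) auto
      finally show ?thesis .
    qed
    also have "ennreal (t powr (b - 1) * (if t \<le> 1 then 1 else t powr (- \<sigma>))) = k (0 + (2 / r) *\<^sub>R \<tau>)"
    proof (cases "t \<le> 1")
      case True
      then have "0 + (2 / r) *\<^sub>R \<tau> \<in> cball 0 1" using nt by (simp only: mem_cball_0)
      then show ?thesis unfolding k_def nt using True by simp
    next
      case False
      then have "0 + (2 / r) *\<^sub>R \<tau> \<notin> cball 0 1" using nt by (simp only: mem_cball_0) simp
      moreover have "t powr (b - 1) * t powr (- \<sigma>) = t powr (- (\<sigma> - b) - 1)"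
        unfolding powr_add[symmetric] by (simp add: algebra_simps)
      ultimately show ?thesis unfolding k_def nt using False by simp
    qed
    finally show ?thesis .
  qed
  define C where "C = e * (1/2) powr b * enn2real I"
  show thesis
  proof (rule that[of C])
    show "C \<ge> 0" using e by (simp add: C_def)
    fix r :: real assume r: "r > 0"
    have "(\<integral>\<^sup>+x. ennreal (gauss x) * (\<integral>\<^sup>+y. \<integral>\<^sup>+y'. ennreal (gauss (((dist x y)\<^sup>2 - (dist x y')\<^sup>2) / r)) \<partial>\<mu> \<partial>\<mu>) \<partial>\<mu>)
     \<le> (\<integral>\<^sup>+\<tau>. ennreal (gauss \<tau>) * difference_energy \<mu> (2 * (\<tau> / r)) \<partial>(lborel :: real measure))"
      using P S r by (rule triple_gauss_le)
    also have "\<dots> \<le> (\<integral>\<^sup>+\<tau>. ennreal (e * (r / 2) powr (b - 1)) * k (0 + (2 / r) *\<^sub>R \<tau>) \<partial>lborel)"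
    proof (rule nn_integral_mono_AE)
      have "AE \<tau> in lborel. \<tau> \<noteq> (0::real)" by (rule AE_lborel_singleton)
      then show "AE \<tau> in lborel. ennreal (gauss \<tau>) * difference_energy \<mu> (2 * (\<tau> / r)) \<le> ennreal (e * (r / 2) powr (b - 1)) * k (0 + (2 / r) *\<^sub>R \<tau>)"
        by eventually_elim (use kk[OF r] in auto)
    qed
    also have "\<dots> = ennreal (e * (r / 2) powr (b - 1)) * (ennreal (1 / \<bar>2 / r\<bar> ^ DIM(real)) * I)"
      unfolding I_def using r by (subst nn_integral_cmult, measurable, subst nn_integral_lborel_affine) auto
    also have "\<dots> = ennreal (e * (r / 2) powr (b - 1)) * (ennreal (r / 2) * ennreal (enn2real I))"
      using r \<open>I < \<infinity>\<close> by simp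
    also have "\<dots> = ennreal (e * (r / 2) powr (b - 1) * ((r / 2) * enn2real I))"
      using r e by (simp add: ennreal_mult[symmetric])
    also have "e * (r / 2) powr (b - 1) * ((r / 2) * enn2real I) = C * r powr b"
    proof -
      have "(r / 2) powr (b - 1) * (r / 2) = (r / 2) powr b"
        using r powr_add[of "r / 2" "b - 1" 1] by simp
      also have "\<dots> = (1/2) powr b * r powr b" using r powr_mult[of "1/2" r b] by simp
      finally show ?thesis by (simp add: C_def algebra_simps)
    qed
    finally show "(\<integral>\<^sup>+x. ennreal (gauss x) * (\<integral>\<^sup>+y. \<integral>\<^sup>+y'. ennreal (gauss (((dist x y)\<^sup>2 - (dist x y')\<^sup>2) / r)) \<partial>\<mu> \<partial>\<mu>) \<partial>\<mu>)
     \<le> ennreal (C * r powr b)" .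
  qed
qed

section \<open>Hausdorff measure and length from close pairs\<close>

text \<open>
  For a probability measure, the probability that two independent samples are at distance at most \<open>r\<close>.
\<close>

definition pair_correlation :: "'a::metric_space measure \<Rightarrow> real \<Rightarrow> ennreal" where
  "pair_correlation \<nu> r = (\<integral>\<^sup>+u. emeasure \<nu> (cball u r) \<partial>\<nu>)"

lemma emeasure_cball_measurable:
  fixes \<nu> :: "'a::euclidean_space measure"
  assumes "finite_measure \<nu>" and [measurable_cong]: "sets \<nu> = sets borel"
  shows "(\<lambda>u. emeasure \<nu> (cball u r)) \<in> borel_measurable borel"
proof -
  interpret finite_measure \<nu> by fact
  have "emeasure \<nu> (cball u r) = (\<integral>\<^sup>+v. (if dist u v \<le> r then 1 else 0) \<partial>\<nu>)" for u
  proof -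
    have "emeasure \<nu> (cball u r) = (\<integral>\<^sup>+v. indicator (cball u r) v \<partial>\<nu>)"
      by (rule nn_integral_indicator[symmetric]) (simp add: assms cball_borel)
    also have "\<dots> = (\<integral>\<^sup>+v. (if dist u v \<le> r then 1 else 0) \<partial>\<nu>)"
      by (intro nn_integral_cong) (auto simp: indicator_def)
    finally show ?thesis .
  qed
  then show ?thesis by simp
qed

text \<open>
  The mass distribution principle. Summability makes the series \<open>\<Phi>\<close> finite almost everywhere, so it is
  bounded by a constant on a set \<open>A\<close> of positive mass; each term of the series then gives a Frostman
  bound for balls centred in \<open>A\<close>, and any covering set that meets \<open>A\<close> lies in such a ball.
\<close>

lemma hausdorff_measure_pos:
  fixes \<nu> :: "'a::euclidean_space measure" and E :: "'a set" and \<sigma> s :: real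
  assumes P: "prob_space \<nu>" and S: "sets \<nu> = sets borel" and E: "AE u in \<nu>. u \<in> E"
    and \<sigma>: "0 < \<sigma>" and s: "0 \<le> s" "s \<le> \<sigma>"
    and fin: "(\<Sum>k. ennreal (2 powr (\<sigma> * real k)) * pair_correlation \<nu> ((1/2) ^ k)) < \<infinity>"
  shows "hausdorff_measure s E \<noteq> 0"
proof -
  interpret prob_space \<nu> by fact
  have [measurable]: "(\<lambda>u. emeasure \<nu> (cball u r)) \<in> borel_measurable \<nu>" for r
    using emeasure_cball_measurable[OF finite_measure_axioms S, of r] by (simp add: measurable_cong_sets[OF S refl])
  define \<Phi> where "\<Phi> u = (\<Sum>k. ennreal (2 powr (\<sigma> * real k)) * emeasure \<nu> (cball u ((1/2) ^ k)))" for u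
  have [measurable]: "\<Phi> \<in> borel_measurable \<nu>" unfolding \<Phi>_def by measurable
  have "(\<integral>\<^sup>+u. \<Phi> u \<partial>\<nu>) = (\<Sum>k. ennreal (2 powr (\<sigma> * real k)) * pair_correlation \<nu> ((1/2) ^ k))"
    unfolding \<Phi>_def pair_correlation_def by (subst nn_integral_suminf) (auto simp: nn_integral_cmult)
  then have "AE u in \<nu>. \<Phi> u \<noteq> \<infinity>"
    using fin by (intro nn_integral_PInf_AE) auto
  then have AEfin: "AE u in \<nu>. u \<in> (\<Union>M::nat. {u \<in> space \<nu>. \<Phi> u \<le> of_nat M})"
  proof (rule AE_mp, intro AE_I2 impI)
    fix u assume u: "u \<in> space \<nu>" "\<Phi> u \<noteq> \<infinity>"
    then obtain M :: nat where "\<Phi> u \<le> of_nat M"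
      by (metis ennreal_Ex_less_of_nat infinity_ennreal_def less_imp_le top.not_eq_extremum)
    then show "u \<in> (\<Union>M::nat. {u \<in> space \<nu>. \<Phi> u \<le> of_nat M})" using u by auto
  qed
  have "\<exists>M::nat. emeasure \<nu> {u \<in> space \<nu>. \<Phi> u \<le> of_nat M} \<noteq> 0"
  proof (rule ccontr)
    assume no: "\<not> (\<exists>M::nat. emeasure \<nu> {u \<in> space \<nu>. \<Phi> u \<le> of_nat M} \<noteq> 0)"
    have "AE u in \<nu>. \<not> \<Phi> u \<le> of_nat M" for M :: nat
      by (rule AE_I'[of "{u \<in> space \<nu>. \<Phi> u \<le> of_nat M}"]) (use no in \<open>auto simp: null_sets_def\<close>)
    then have "AE u in \<nu>. \<forall>M::nat. \<not> \<Phi> u \<le> of_nat M"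
      unfolding AE_all_countable by blast
    with AEfin have "AE u in \<nu>. False" by eventually_elim auto
    then show False by simp
  qed
  then obtain M :: nat where M: "emeasure \<nu> {u \<in> space \<nu>. \<Phi> u \<le> of_nat M} \<noteq> 0" by blast
  define A where "A = {u \<in> space \<nu>. \<Phi> u \<le> of_nat M}"
  have A[measurable]: "A \<in> sets \<nu>" unfolding A_def by measurable
  have frostman: "emeasure \<nu> (cball u ((1/2) ^ k)) \<le> ennreal (M * 2 powr (- \<sigma> * real k))" if "u \<in> A" for u k
  proof -
    have "ennreal (2 powr (\<sigma> * real k)) * emeasure \<nu> (cball u ((1/2) ^ k)) \<le> \<Phi> u"
      unfolding \<Phi>_def by (rule ennreal_le_suminf)
    also have "\<dots> \<le> ennreal M" using that by (simp add: A_def ennreal_of_nat_eq_real_of_nat)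
    finally have "ennreal (2 powr (- \<sigma> * real k)) * (ennreal (2 powr (\<sigma> * real k)) * emeasure \<nu> (cball u ((1/2) ^ k)))
      \<le> ennreal (2 powr (- \<sigma> * real k)) * ennreal M" by (rule mult_left_mono) simp
    also have "ennreal (2 powr (- \<sigma> * real k)) * (ennreal (2 powr (\<sigma> * real k)) * emeasure \<nu> (cball u ((1/2) ^ k)))
      = emeasure \<nu> (cball u ((1/2) ^ k))"
      unfolding mult.assoc[symmetric] by (simp add: ennreal_mult[symmetric] powr_minus)
    also have "ennreal (2 powr (- \<sigma> * real k)) * ennreal M = ennreal (M * 2 powr (- \<sigma> * real k))"
      by (simp add: ennreal_mult[symmetric] mult.commute)
    finally show ?thesis .
  qed
  define C where "C = (real M + 1) * 2 powr \<sigma>"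
  have C: "C > 0" by (simp add: C_def add_nonneg_pos)
  have weight: "emeasure \<nu> (cball u (diameter U)) \<le> ennreal C * hausdorff_weight s U"
    if u: "u \<in> A" "u \<in> U" and U: "bounded U" "diameter U \<le> 1" for u U
  proof (cases "diameter U = 0")
    case True
    \<comment> \<open>A covering set of diameter 0 may have weight 0, so its point must carry no mass at all.\<close>
    have "emeasure \<nu> (cball u (diameter U)) \<le> 0"
    proof (rule LIMSEQ_le_const[of "\<lambda>k. ennreal (M * 2 powr (- \<sigma> * real k))"])
      have "(\<lambda>k. ennreal (M * 2 powr (- \<sigma> * real k))) \<longlonglongrightarrow> ennreal (real M * 0)"
      proof (intro tendsto_ennrealI tendsto_mult tendsto_const)
        have "(\<lambda>k. (2 powr (- \<sigma>)) ^ k) \<longlonglongrightarrow> (0::real)"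
          using \<sigma> by (intro LIMSEQ_realpow_zero) (auto simp: powr_less_one)
        then show "(\<lambda>k. 2 powr (- \<sigma> * real k)) \<longlonglongrightarrow> (0::real)"
          by (simp add: powr_powr flip: powr_realpow)
      qed
      then show "(\<lambda>k. ennreal (M * 2 powr (- \<sigma> * real k))) \<longlonglongrightarrow> 0" by simp
      show "\<exists>N. \<forall>n\<ge>N. emeasure \<nu> (cball u (diameter U)) \<le> ennreal (M * 2 powr (- \<sigma> * real n))"
      proof (intro exI allI impI)
        fix n :: nat
        have "emeasure \<nu> (cball u (diameter U)) \<le> emeasure \<nu> (cball u ((1/2) ^ n))"
          using True by (intro emeasure_mono) (auto simp: S cball_borel)
        also have "\<dots> \<le> ennreal (M * 2 powr (- \<sigma> * real n))" by (rule frostman[OF u(1)])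
        finally show "emeasure \<nu> (cball u (diameter U)) \<le> ennreal (M * 2 powr (- \<sigma> * real n))" .
      qed
    qed
    then show ?thesis by simp
  next
    case False
    define \<delta> where "\<delta> = diameter U"
    have \<delta>: "0 < \<delta>" "\<delta> \<le> 1" using False U diameter_ge_0[OF U(1)] by (auto simp: \<delta>_def)
    then have "1 \<le> 1 / \<delta>" by simp
    then obtain k where k: "2 ^ k \<le> 1 / \<delta>" "1 / \<delta> < 2 ^ (k + 1)" by (rule dyadic_scale)
    have "\<delta> \<le> (1/2) ^ k" using k(1) \<delta> by (simp add: field_simps power_divide)
    then have "emeasure \<nu> (cball u \<delta>) \<le> emeasure \<nu> (cball u ((1/2) ^ k))"
      by (intro emeasure_mono) (auto simp: S cball_borel)
    also have "\<dots> \<le> ennreal (M * 2 powr (- \<sigma> * real k))" by (rule frostman[OF u(1)])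
    also have "\<dots> \<le> ennreal (C * \<delta> powr s)"
    proof (rule ennreal_leI)
      have "2 powr (- \<sigma> * real k) = 2 powr \<sigma> * (2 ^ (k + 1)) powr (- \<sigma>)"
        unfolding two_power_powr powr_add[symmetric] by (simp add: algebra_simps)
      also have "\<dots> \<le> 2 powr \<sigma> * (1 / \<delta>) powr (- \<sigma>)"
        using k(2) \<delta> \<sigma> by (intro mult_left_mono powr_mono2') auto
      also have "(1 / \<delta>) powr (- \<sigma>) = \<delta> powr \<sigma>" using \<delta> by (simp add: powr_divide powr_minus)
      also have "2 powr \<sigma> * \<delta> powr \<sigma> \<le> 2 powr \<sigma> * \<delta> powr s"
        using \<delta> s by (intro mult_left_mono powr_mono') auto
      finally have "M * 2 powr (- \<sigma> * real k) \<le> (real M + 1) * (2 powr \<sigma> * \<delta> powr s)"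
        by (intro mult_mono) auto
      then show "M * 2 powr (- \<sigma> * real k) \<le> C * \<delta> powr s" by (simp add: C_def mult.assoc)
    qed
    also have "\<dots> = ennreal C * ennreal (\<delta> powr s)" using C by (intro ennreal_mult) auto
    also have "\<dots> \<le> ennreal C * hausdorff_weight s U"
      using u \<delta> by (intro mult_left_mono) (auto simp: hausdorff_weight_def \<delta>_def)
    finally show ?thesis by (simp add: \<delta>_def)
  qed
  have lower: "ennreal (1 / C) * emeasure \<nu> A \<le> (\<Sum>i. hausdorff_weight s (U i))"
    if cover: "E \<subseteq> (\<Union>i. U i)" and U: "\<And>i. bounded (U i)" "\<And>i. diameter (U i) \<le> 1" for U :: "nat \<Rightarrow> 'a set"
  proof -
    \<comment> \<open>Covering sets need not be measurable; the balls that replace them are.\<close>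
    define V where "V i = (if U i \<inter> A = {} then {} else cball (SOME u. u \<in> U i \<inter> A) (diameter (U i)))" for i
    have pick: "(SOME u. u \<in> U i \<inter> A) \<in> U i \<inter> A" if "U i \<inter> A \<noteq> {}" for i
      using someI_ex[of "\<lambda>u. u \<in> U i \<inter> A"] that by auto
    have [measurable]: "V i \<in> sets \<nu>" for i by (simp add: V_def S cball_borel)
    have sub: "U i \<inter> A \<subseteq> V i" for i
    proof
      fix v assume v: "v \<in> U i \<inter> A"
      then have ne: "U i \<inter> A \<noteq> {}" by blast
      have "dist (SOME u. u \<in> U i \<inter> A) v \<le> diameter (U i)"
        using pick[OF ne] v U(1)[of i] by (intro diameter_bounded_bound) auto
      then show "v \<in> V i" using ne by (simp add: V_def)
    qed
    have "emeasure \<nu> A \<le> emeasure \<nu> (\<Union>i. V i)"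
    proof (rule emeasure_mono_AE)
      show "AE x in \<nu>. x \<in> A \<longrightarrow> x \<in> (\<Union>i. V i)"
        using E by eventually_elim (use cover sub in blast)
    qed measurable
    also have "\<dots> \<le> (\<Sum>i. emeasure \<nu> (V i))"
      by (rule emeasure_subadditive_countably) auto
    also have "\<dots> \<le> (\<Sum>i. ennreal C * hausdorff_weight s (U i))"
    proof (rule suminf_le)
      fix i
      show "emeasure \<nu> (V i) \<le> ennreal C * hausdorff_weight s (U i)"
      proof (cases "U i \<inter> A = {}")
        case False
        then show ?thesis using pick[OF False] U by (simp add: V_def weight)
      qed (simp add: V_def)
    qed auto
    also have "\<dots> = ennreal C * (\<Sum>i. hausdorff_weight s (U i))" by simp
    finally have "ennreal (1 / C) * emeasure \<nu> A \<le> ennreal (1 / C) * (ennreal C * (\<Sum>i. hausdorff_weight s (U i)))"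
      by (rule mult_left_mono) simp
    also have "\<dots> = (\<Sum>i. hausdorff_weight s (U i))"
      unfolding mult.assoc[symmetric] using C by (simp add: ennreal_mult[symmetric])
    finally show ?thesis .
  qed
  have "0 < ennreal (1 / C) * emeasure \<nu> A"
    using C M by (simp add: A_def ennreal_zero_less_mult_iff zero_less_iff_neq_zero)
  also have "\<dots> \<le> hausdorff_premeasure s 1 E"
    unfolding hausdorff_premeasure_def by (rule Inf_greatest) (use lower in auto)
  also have "\<dots> \<le> hausdorff_measure s E"
    unfolding hausdorff_measure_def by (rule SUP_upper) simp
  finally show ?thesis by simp
qed

lemma hausdorff_dim_ge:
  assumes "\<And>s. 0 \<le> s \<Longrightarrow> ereal s < b \<Longrightarrow> hausdorff_measure s E \<noteq> 0"
  shows "b \<le> hausdorff_dim E"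
  unfolding hausdorff_dim_def using assms by (intro Inf_greatest) (force simp: not_less[symmetric])

text \<open>
  If \<open>E\<close> were null, a small neighbourhood of it would have length below \<open>1 / M\<close>. The function
  \<open>f v = \<nu> (cball v r)\<close> lives on that neighbourhood and has integral \<open>2 r\<close>, while the pair correlation
  bounds the integral of \<open>f\<^sup>2\<close>; by Cauchy-Schwarz the neighbourhood has length at least \<open>1 / M\<close>.
\<close>

lemma lborel_pos_of_pair_correlation:
  fixes \<nu> :: "real measure" and E :: "real set"
  assumes P: "prob_space \<nu>" and S[measurable_cong]: "sets \<nu> = sets borel" and E: "compact E" "AE u in \<nu>. u \<in> E"
    and M: "M > 0" and freq: "\<And>n. \<exists>k\<ge>n. pair_correlation \<nu> ((1/2) ^ k) \<le> ennreal (M * (1/2) ^ k)"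
  shows "emeasure lborel E > 0"
proof (rule ccontr)
  assume "\<not> ?thesis"
  then have null: "emeasure lborel E = 0" by simp
  interpret prob_space \<nu> by fact
  interpret pair_sigma_finite \<nu> "lborel :: real measure" ..
  have Eb: "E \<in> sets borel" using E(1) by (simp add: borel_compact)
  obtain U where U: "open U" "E \<subseteq> U" "emeasure lborel U < ennreal (1 / M)"
  proof -
    have "E \<in> null_sets lebesgue" using null Eb by (simp add: null_sets_def)
    then have "E \<in> sets lebesgue" by auto
    from sets_lebesgue_outer_open[OF this, of "1 / M"] M obtain T where T: "open T" "E \<subseteq> T" "T - E \<in> lmeasurable" "emeasure lebesgue (T - E) < ennreal (1 / M)"
      by auto
    have "emeasure lborel T \<le> emeasure lborel (T - E) + emeasure lborel E"
      using T(1) Eb by (intro order_trans[OF emeasure_mono emeasure_subadditive]) auto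
    also have "\<dots> < ennreal (1 / M)" using T(1,4) Eb null by simp
    finally show thesis using T that by blast
  qed
  obtain \<delta> where \<delta>: "\<delta> > 0" "(\<Union>x\<in>E. cball x \<delta>) \<subseteq> U"
    using compact_subset_open_imp_cball_epsilon_subset[OF E(1) U(1,2)] by blast
  obtain n :: nat where n: "(1/2) ^ n < \<delta>"
    using real_arch_pow_inv[OF \<delta>(1), of "1/2"] by auto
  obtain k where k: "k \<ge> n" "pair_correlation \<nu> ((1/2) ^ k) \<le> ennreal (M * (1/2) ^ k)" using freq by blast
  \<comment> \<open>Half of the dyadic radius, because two points in a ball of radius \<open>r\<close> are only \<open>2 r\<close>-close.\<close>
  define r where "r = (1/2::real) ^ k / 2"
  have r: "r > 0" "2 * r = (1/2) ^ k" by (auto simp: r_def)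
  have "(1/2) ^ k \<le> (1/2::real) ^ n" using k(1) by (intro power_decreasing) auto
  then have r\<delta>: "r \<le> \<delta>" using n r by linarith
  define f where "f v = emeasure \<nu> (cball v r)" for v
  have [measurable]: "f \<in> borel_measurable borel"
    unfolding f_def by (rule emeasure_cball_measurable[OF finite_measure_axioms S])
  have ball_int: "emeasure \<nu> (cball v c) = (\<integral>\<^sup>+u. (if dist u v \<le> c then 1 else 0) \<partial>\<nu>)" for v c
  proof -
    have "emeasure \<nu> (cball v c) = (\<integral>\<^sup>+u. indicator (cball v c) u \<partial>\<nu>)"
      by (rule nn_integral_indicator[symmetric]) (simp add: S cball_borel)
    also have "\<dots> = (\<integral>\<^sup>+u. (if dist u v \<le> c then 1 else 0) \<partial>\<nu>)"
      by (intro nn_integral_cong) (auto simp: indicator_def dist_commute)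
    finally show ?thesis .
  qed
  have len: "(\<integral>\<^sup>+v. (if dist u v \<le> r then 1 else 0) \<partial>lborel) = ennreal (2 * r)" for u :: real
  proof -
    have "(\<integral>\<^sup>+v. (if dist u v \<le> r then 1 else 0) \<partial>lborel) = (\<integral>\<^sup>+v. indicator (cball u r) v \<partial>lborel)"
      by (intro nn_integral_cong) (auto simp: indicator_def)
    also have "\<dots> = emeasure lborel {u - r..u + r}"
      by (simp add: cball_eq_atLeastAtMost)
    also have "\<dots> = ennreal (2 * r)" using r(1) by simp
    finally show ?thesis .
  qed
  have swap: "(\<integral>\<^sup>+v. g v * f v \<partial>lborel) = (\<integral>\<^sup>+u. \<integral>\<^sup>+v. g v * (if dist u v \<le> r then 1 else 0) \<partial>lborel \<partial>\<nu>)"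
    if "g \<in> borel_measurable borel" for g
  proof -
    note that[measurable]
    have "(\<integral>\<^sup>+v. g v * f v \<partial>lborel) = (\<integral>\<^sup>+v. \<integral>\<^sup>+u. g v * (if dist u v \<le> r then 1 else 0) \<partial>\<nu> \<partial>lborel)"
      unfolding f_def ball_int by (intro nn_integral_cong nn_integral_cmult[symmetric]) measurable
    also have "\<dots> = (\<integral>\<^sup>+u. \<integral>\<^sup>+v. g v * (if dist u v \<le> r then 1 else 0) \<partial>lborel \<partial>\<nu>)"
      by (rule Fubini') measurable
    finally show ?thesis .
  qed
  have total: "(\<integral>\<^sup>+v. f v \<partial>lborel) = ennreal (2 * r)"
    using swap[of "\<lambda>_. 1"] by (simp add: len emeasure_space_1)
  have square: "(\<integral>\<^sup>+v. f v * f v \<partial>lborel) \<le> ennreal (2 * r) * ennreal (M * (2 * r))"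
  proof -
    have "(\<integral>\<^sup>+v. f v * f v \<partial>lborel) = (\<integral>\<^sup>+u. \<integral>\<^sup>+v. f v * (if dist u v \<le> r then 1 else 0) \<partial>lborel \<partial>\<nu>)"
      by (rule swap) measurable
    also have "\<dots> \<le> (\<integral>\<^sup>+u. \<integral>\<^sup>+v. emeasure \<nu> (cball u (2 * r)) * (if dist u v \<le> r then 1 else 0) \<partial>lborel \<partial>\<nu>)"
    proof (intro nn_integral_mono)
      fix u v :: real
      have "f v \<le> emeasure \<nu> (cball u (2 * r))" if "dist u v \<le> r"
        unfolding f_def using that by (intro emeasure_mono) (auto simp: S cball_borel dist_real_def)
      then show "f v * (if dist u v \<le> r then 1 else 0) \<le> emeasure \<nu> (cball u (2 * r)) * (if dist u v \<le> r then 1 else 0)"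
        by auto
    qed
    also have "\<dots> = (\<integral>\<^sup>+u. emeasure \<nu> (cball u (2 * r)) * ennreal (2 * r) \<partial>\<nu>)"
      by (simp add: nn_integral_cmult len)
    also have "\<dots> = ennreal (2 * r) * pair_correlation \<nu> (2 * r)"
      unfolding pair_correlation_def
      using emeasure_cball_measurable[OF finite_measure_axioms S, of "2 * r"]
      by (subst mult.commute, subst nn_integral_cmult) (simp_all add: measurable_cong_sets[OF S refl])
    also have "\<dots> \<le> ennreal (2 * r) * ennreal (M * (2 * r))"
      using k(2) unfolding r(2) by (intro mult_left_mono) auto
    finally show ?thesis .
  qed
  have zero: "f v = 0" if "v \<notin> U" for v
  proof -
    have "AE u in \<nu>. \<not> u \<in> cball v r"
      using E(2)
    proof eventually_elim
      case (elim u)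
      then have "cball u \<delta> \<subseteq> U" using \<delta> by blast
      then have "v \<notin> cball u \<delta>" using that by blast
      then show ?case using r\<delta> by (simp add: dist_commute)
    qed
    moreover have "space \<nu> = UNIV" using sets_eq_imp_space_eq[OF S] by simp
    ultimately show ?thesis unfolding f_def
      using AE_iff_measurable[of "cball v r" \<nu> "\<lambda>u. u \<notin> cball v r"] by (simp add: S cball_borel cball_def)
  qed
  \<comment> \<open>The weight in \<open>f \<le> \<eta> f\<^sup>2 + 1 / (4 \<eta>)\<close> for which the square contributes half of the integral \<open>2 r\<close>.\<close>
  define \<eta> where "\<eta> = 1 / (4 * M * r)"
  have \<eta>: "\<eta> > 0" using M r by (simp add: \<eta>_def)
  have amgm: "f v \<le> ennreal \<eta> * (f v * f v) + ennreal (M * r) * indicator U v" for v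
  proof (cases "v \<in> U")
    case True
    define x where "x = measure \<nu> (cball v r)"
    have fx: "f v = ennreal x" "x \<ge> 0" by (auto simp: f_def x_def emeasure_eq_measure)
    have "4 * M * r * x \<le> x * x + (2 * M * r) * (2 * M * r)"
      using sum_squares_bound[of x "2 * M * r"] by (simp add: power2_eq_square algebra_simps)
    then have "x \<le> \<eta> * (x * x) + M * r"
      using M r by (simp add: \<eta>_def field_simps)
    then have "ennreal x \<le> ennreal (\<eta> * (x * x) + M * r)" by (rule ennreal_leI)
    also have "\<dots> = ennreal \<eta> * (ennreal x * ennreal x) + ennreal (M * r)"
      using \<eta> fx(2) M r by (simp add: ennreal_mult ennreal_plus)
    finally show ?thesis using True fx(1) by simp
  qed (simp add: zero)
  have "ennreal (2 * r) \<le> (\<integral>\<^sup>+v. ennreal \<eta> * (f v * f v) + ennreal (M * r) * indicator U v \<partial>lborel)"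
    unfolding total[symmetric] by (intro nn_integral_mono amgm)
  also have "\<dots> = ennreal \<eta> * (\<integral>\<^sup>+v. f v * f v \<partial>lborel) + ennreal (M * r) * emeasure lborel U"
    using U(1) by (subst nn_integral_add) (auto simp: nn_integral_cmult nn_integral_cmult_indicator)
  also have "\<dots> \<le> ennreal \<eta> * (ennreal (2 * r) * ennreal (M * (2 * r))) + ennreal (M * r) * emeasure lborel U"
    by (intro add_right_mono mult_left_mono square) simp
  also have "\<dots> = ennreal r + ennreal (M * r) * emeasure lborel U"
  proof -
    have "\<eta> * ((2 * r) * (M * (2 * r))) = r" using M r by (simp add: \<eta>_def field_simps)
    then show ?thesis using \<eta> M r by (simp add: ennreal_mult[symmetric])
  qed
  also have "\<dots> < ennreal (2 * r)"
  proof -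
    obtain c where c: "emeasure lborel U = ennreal c" "c \<ge> 0"
      using U(3) by (cases "emeasure lborel U") auto
    have "c < 1 / M" using U(3) c by (simp add: ennreal_less_iff)
    then have "M * r * c < r" using M r(1) by (simp add: field_simps)
    then have less: "ennreal (r + M * r * c) < ennreal (2 * r)" using r(1) by (intro ennreal_lessI) auto
    have "ennreal (r + M * r * c) = ennreal r + ennreal (M * r) * ennreal c"
      using c r(1) M by (simp add: ennreal_plus ennreal_mult)
    then show ?thesis using less c(1) by (simp only:)
  qed
  finally show False by simp
qed

section \<open>The averaged pair correlation of pinned distances\<close>

text \<open>
  The complement of the support is a union of null sets from a countable base.
\<close>

lemma AE_in_msupp:
  fixes \<mu> :: "'a::second_countable_topology measure"
  assumes S: "sets \<mu> = sets borel"
  shows "AE x in \<mu>. x \<in> msupp \<mu>"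
proof -
  obtain B :: "'a set set" where B: "countable B" "topological_basis B"
    using ex_countable_basis by blast
  define N where "N = (\<Union>b\<in>{b \<in> B. emeasure \<mu> b = 0}. b)"
  have "N \<in> null_sets \<mu>" unfolding N_def
  proof (rule null_sets_UN')
    show "countable {b \<in> B. emeasure \<mu> b = 0}" using B(1) by simp
    fix b assume b: "b \<in> {b \<in> B. emeasure \<mu> b = 0}"
    then have "open b" using topological_basis_open[OF B(2)] by simp
    then show "b \<in> null_sets \<mu>" using b S by (auto simp: null_sets_def)
  qed
  moreover have "{x \<in> space \<mu>. \<not> x \<in> msupp \<mu>} \<subseteq> N"
  proof
    fix x assume "x \<in> {x \<in> space \<mu>. \<not> x \<in> msupp \<mu>}"
    then obtain U where U: "open U" "x \<in> U" "emeasure \<mu> U = 0"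
      unfolding msupp_def by (auto simp: zero_less_iff_neq_zero)
    from topological_basisE[OF B(2) U(1,2)] obtain b where b: "b \<in> B" "x \<in> b" "b \<subseteq> U" .
    have "emeasure \<mu> b \<le> emeasure \<mu> U" using U(1) S b(3) by (intro emeasure_mono) auto
    then show "x \<in> N" using b U(3) by (auto simp: N_def)
  qed
  ultimately show ?thesis by (rule AE_I')
qed

lemma pair_correlation_pinned:
  fixes \<mu> :: "'a::euclidean_space measure"
  assumes P: "prob_space \<mu>" and S[measurable_cong]: "sets \<mu> = sets borel"
  shows "pair_correlation (distr \<mu> borel (dist x)) r = (\<integral>\<^sup>+y. \<integral>\<^sup>+y'. (if \<bar>dist x y - dist x y'\<bar> \<le> r then 1 else 0) \<partial>\<mu> \<partial>\<mu>)"
proof -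
  interpret prob_space \<mu> by fact
  define L where "L = distr \<mu> borel (dist x)"
  have sL: "sets L = sets borel" by (simp add: L_def)
  have "prob_space L" unfolding L_def by (rule prob_space_distr) measurable
  then have fL: "finite_measure L" by (simp add: prob_space_def)
  have "emeasure L (cball u r) = (\<integral>\<^sup>+y'. (if \<bar>u - dist x y'\<bar> \<le> r then 1 else 0) \<partial>\<mu>)" for u
  proof -
    have "emeasure L (cball u r) = (\<integral>\<^sup>+v. indicator (cball u r) v \<partial>L)"
      by (rule nn_integral_indicator[symmetric]) (simp add: sL cball_borel)
    also have "\<dots> = (\<integral>\<^sup>+y'. indicator (cball u r) (dist x y') \<partial>\<mu>)"
      unfolding L_def using cball_borel[of u r] by (subst nn_integral_distr) auto
    also have "\<dots> = (\<integral>\<^sup>+y'. (if \<bar>u - dist x y'\<bar> \<le> r then 1 else 0) \<partial>\<mu>)"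
      by (intro nn_integral_cong) (auto simp: indicator_def dist_real_def)
    finally show ?thesis .
  qed
  then have "pair_correlation L r = (\<integral>\<^sup>+u. \<integral>\<^sup>+y'. (if \<bar>u - dist x y'\<bar> \<le> r then 1 else 0) \<partial>\<mu> \<partial>L)"
    by (simp add: pair_correlation_def)
  also have "\<dots> = (\<integral>\<^sup>+y. \<integral>\<^sup>+y'. (if \<bar>dist x y - dist x y'\<bar> \<le> r then 1 else 0) \<partial>\<mu> \<partial>\<mu>)"
    unfolding L_def by (subst nn_integral_distr) measurable
  finally show ?thesis by (simp add: L_def)
qed

lemma pair_correlation_pinned_measurable:
  fixes \<mu> :: "'a::euclidean_space measure"
  assumes P: "prob_space \<mu>" and S[measurable_cong]: "sets \<mu> = sets borel"
  shows "(\<lambda>x. pair_correlation (distr \<mu> borel (dist x)) r) \<in> borel_measurable borel"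
proof -
  interpret prob_space \<mu> by fact
  show ?thesis unfolding pair_correlation_pinned[OF P S] by measurable
qed

text \<open>
  On a support of radius \<open>R\<close> distances are at most \<open>2 R\<close>, so distances that differ by at most \<open>r\<close> have
  squares that differ by at most \<open>4 R r\<close>; both Gaussians are then bounded below.
\<close>

lemma pinned_correlation_le_triple_gauss:
  fixes \<mu> :: "'a::euclidean_space measure"
  assumes P: "prob_space \<mu>" and S[measurable_cong]: "sets \<mu> = sets borel"
    and R: "R > 0" and supp: "AE x in \<mu>. norm x \<le> R" and r: "r > 0"
  shows "(\<integral>\<^sup>+x. pair_correlation (distr \<mu> borel (dist x)) r \<partial>\<mu>)
     \<le> ennreal (exp (pi * R\<^sup>2 + pi)) *
       (\<integral>\<^sup>+x. ennreal (gauss x) * (\<integral>\<^sup>+y. \<integral>\<^sup>+y'. ennreal (gauss (((dist x y)\<^sup>2 - (dist x y')\<^sup>2) / (4 * R * r))) \<partial>\<mu> \<partial>\<mu>) \<partial>\<mu>)"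
proof -
  interpret prob_space \<mu> by fact
  let ?e = "ennreal (exp (pi * R\<^sup>2 + pi))"
  let ?g = "\<lambda>x y y'. ennreal (gauss (((dist x y)\<^sup>2 - (dist x y')\<^sup>2) / (4 * R * r)))"
  have key: "(if \<bar>dist x y - dist x y'\<bar> \<le> r then 1 else 0) \<le> ?e * (ennreal (gauss x) * ?g x y y')"
    if n: "norm x \<le> R" "norm y \<le> R" "norm y' \<le> R" for x y y' :: 'a
  proof (cases "\<bar>dist x y - dist x y'\<bar> \<le> r")
    case True
    have d: "dist x y \<le> 2 * R" "dist x y' \<le> 2 * R"
      using n norm_triangle_ineq4[of x y] norm_triangle_ineq4[of x y'] by (auto simp: dist_norm)
    have "(dist x y)\<^sup>2 - (dist x y')\<^sup>2 = (dist x y - dist x y') * (dist x y + dist x y')"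
      by (simp add: power2_eq_square algebra_simps)
    then have "\<bar>(dist x y)\<^sup>2 - (dist x y')\<^sup>2\<bar> = \<bar>dist x y - dist x y'\<bar> * (dist x y + dist x y')"
      by (simp add: abs_mult)
    also have "\<dots> \<le> r * (4 * R)" using True d r by (intro mult_mono) auto
    finally have "\<bar>((dist x y)\<^sup>2 - (dist x y')\<^sup>2) / (4 * R * r)\<bar> \<le> 1"
      using R r by (simp add: abs_mult field_simps)
    then have "(norm (((dist x y)\<^sup>2 - (dist x y')\<^sup>2) / (4 * R * r)))\<^sup>2 \<le> 1"
      by (simp add: abs_square_le_1)
    then have "pi * (norm (((dist x y)\<^sup>2 - (dist x y')\<^sup>2) / (4 * R * r)))\<^sup>2 \<le> pi * 1" by (intro mult_left_mono) auto
    moreover have "pi * (norm x)\<^sup>2 \<le> pi * R\<^sup>2" using n(1) by (intro mult_left_mono power_mono) auto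
    ultimately have "0 \<le> (pi * R\<^sup>2 + pi) + (- pi * (norm x)\<^sup>2 + - pi * (norm (((dist x y)\<^sup>2 - (dist x y')\<^sup>2) / (4 * R * r)))\<^sup>2)"
      unfolding mult_minus_left by linarith
    then have "exp 0 \<le> exp ((pi * R\<^sup>2 + pi) + (- pi * (norm x)\<^sup>2 + - pi * (norm (((dist x y)\<^sup>2 - (dist x y')\<^sup>2) / (4 * R * r)))\<^sup>2))"
      by (simp only: exp_le_cancel_iff)
    then have "1 \<le> exp (pi * R\<^sup>2 + pi) * (gauss x * gauss (((dist x y)\<^sup>2 - (dist x y')\<^sup>2) / (4 * R * r)))"
      unfolding gauss_def exp_add exp_zero .
    then have "ennreal 1 \<le> ennreal (exp (pi * R\<^sup>2 + pi) * (gauss x * gauss (((dist x y)\<^sup>2 - (dist x y')\<^sup>2) / (4 * R * r))))"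
      by (rule ennreal_leI)
    then show ?thesis using True by (simp add: ennreal_mult less_imp_le[OF gauss_bounds(1)])
  qed simp
  have "(\<integral>\<^sup>+x. pair_correlation (distr \<mu> borel (dist x)) r \<partial>\<mu>)
     \<le> (\<integral>\<^sup>+x. \<integral>\<^sup>+y. \<integral>\<^sup>+y'. ?e * (ennreal (gauss x) * ?g x y y') \<partial>\<mu> \<partial>\<mu> \<partial>\<mu>)"
    unfolding pair_correlation_pinned[OF P S]
  proof (rule nn_integral_mono_AE, use supp in eventually_elim)
    fix x :: 'a assume x: "norm x \<le> R"
    show "(\<integral>\<^sup>+y. \<integral>\<^sup>+y'. (if \<bar>dist x y - dist x y'\<bar> \<le> r then 1 else 0) \<partial>\<mu> \<partial>\<mu>)
      \<le> (\<integral>\<^sup>+y. \<integral>\<^sup>+y'. ?e * (ennreal (gauss x) * ?g x y y') \<partial>\<mu> \<partial>\<mu>)"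
    proof (rule nn_integral_mono_AE, use supp in eventually_elim)
      fix y :: 'a assume y: "norm y \<le> R"
      show "(\<integral>\<^sup>+y'. (if \<bar>dist x y - dist x y'\<bar> \<le> r then 1 else 0) \<partial>\<mu>)
        \<le> (\<integral>\<^sup>+y'. ?e * (ennreal (gauss x) * ?g x y y') \<partial>\<mu>)"
        by (rule nn_integral_mono_AE, use supp in eventually_elim) (rule key[OF x y])
    qed
  qed
  also have "\<dots> = ?e * (\<integral>\<^sup>+x. ennreal (gauss x) * (\<integral>\<^sup>+y. \<integral>\<^sup>+y'. ?g x y y' \<partial>\<mu> \<partial>\<mu>) \<partial>\<mu>)"
    by (simp add: nn_integral_cmult)
  finally show ?thesis .
qed

text \<open>
  The exponents needed by the decay estimate. The exponent \<open>s\<close> is lowered below \<open>d (2 - \<theta>)\<close>, which is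
  equivalent to \<open>c < d\<close>; it may stay above \<open>d\<close>, and for \<open>d = 2\<close> this leaves room for the exponent to
  exceed 1. The inequality \<open>c < s'\<close> then comes down to \<open>(2 - \<theta>) (2 \<theta> - 1) = \<theta> - 2 (1 - \<theta>)\<^sup>2\<close>.
\<close>

lemma admissible_exponents:
  fixes d \<theta> b s :: real
  assumes d: "2 \<le> d" and \<theta>: "0 < \<theta>" "\<theta> < 1" and b: "0 < b" "b \<le> 1"
    and s: "2 * b < s" "2 * b + d * \<theta> < s * (1 + min (2 * \<theta>) 1)"
  obtains s' q r where "0 < s'" "s' \<le> s" "0 < q" "q \<le> d" "q < s' * min (2 * \<theta>) 1 / \<theta>"
    "(s' - d * \<theta>) / (2 * (1 - \<theta>)) < r" "0 < r" "r < s'" "r \<le> d" "b < (s' - d * \<theta> + q * \<theta>) / 2"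
proof -
  define m where "m = min (2 * \<theta>) 1"
  have m: "0 < m" "\<theta> \<le> m" using \<theta> by (auto simp: m_def)
  \<comment> \<open>If \<open>s\<close> is too large, take the midpoint of \<open>d\<close> and \<open>d (2 - \<theta>)\<close>.\<close>
  define s' where "s' = (if s < d * (2 - \<theta>) then s else d * (3 - \<theta>) / 2)"
  have dt: "d * \<theta> < d" using d \<theta> by simp
  have s': "2 * b < s'" "s' \<le> s" "s' < d * (2 - \<theta>)" "2 * b + d * \<theta> < s' * (1 + m)"
  proof -
    have "2 * b < s' \<and> s' \<le> s \<and> s' < d * (2 - \<theta>) \<and> 2 * b + d * \<theta> < s' * (1 + m)"
    proof (cases "s < d * (2 - \<theta>)")
      case True
      then show ?thesis using s by (simp add: s'_def m_def)
    next
      case False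
      then have eq: "s' = d * (3 - \<theta>) / 2" by (simp add: s'_def)
      have eq2: "2 * s' = 3 * d - d * \<theta>" "d * (2 - \<theta>) = 2 * d - d * \<theta>"
        unfolding eq by (simp_all add: right_diff_distrib)
      have sd: "d < s'" using dt eq2(1) by linarith
      have "d * \<theta> \<le> s' * m" using sd m \<theta> d by (intro mult_mono) auto
      then have "2 * b + d * \<theta> < s' * (1 + m)" using sd d b unfolding distrib_left by linarith
      moreover have "2 * b < s'" using sd d b by linarith
      moreover have "s' \<le> s" "s' < d * (2 - \<theta>)" using False eq2 dt unfolding eq2(2) by linarith+
      ultimately show ?thesis by blast
    qed
    then show "2 * b < s'" "s' \<le> s" "s' < d * (2 - \<theta>)" "2 * b + d * \<theta> < s' * (1 + m)" by auto
  qed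
  have s'0: "0 < s'" using s' b by simp
  \<comment> \<open>The condition \<open>b < \<sigma>\<close> reads \<open>L < q\<close>.\<close>
  define L where "L = (2 * b - s' + d * \<theta>) / \<theta>"
  define Q where "Q = s' * m / \<theta>"
  define q where "q = (max L 0 + min Q d) / 2"
  have "L < Q" using s'(4) \<theta> by (simp add: L_def Q_def divide_strict_right_mono distrib_left)
  moreover have "L < d" using s'(1) \<theta> by (simp add: L_def field_simps)
  moreover have "0 < Q" using s'0 m \<theta> by (simp add: Q_def)
  ultimately have q: "L < q" "0 < q" "q < Q" "q < d" using d by (auto simp: q_def)
  define c where "c = (s' - d * \<theta>) / (2 * (1 - \<theta>))"
  have "c < d" using s'(3) \<theta> by (simp add: c_def field_simps)
  moreover have "c < s'"
  proof -
    have "s' * (2 * \<theta> - 1) < d * \<theta>"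
    proof (cases "\<theta> \<le> 1/2")
      case True
      then have "s' * (2 * \<theta> - 1) \<le> 0" using s'0 by (intro mult_nonneg_nonpos) auto
      also have "0 < d * \<theta>" using d \<theta> by simp
      finally show ?thesis .
    next
      case False
      then have "s' * (2 * \<theta> - 1) < (d * (2 - \<theta>)) * (2 * \<theta> - 1)"
        using s'(3) by (intro mult_strict_right_mono) auto
      also have "\<dots> = d * \<theta> - 2 * d * (1 - \<theta>)\<^sup>2" by (simp add: power2_eq_square algebra_simps)
      also have "\<dots> \<le> d * \<theta>" using d by simp
      finally show ?thesis .
    qed
    then show ?thesis using \<theta> by (simp add: c_def field_simps)
  qed
  moreover define r where "r = (max c 0 + min s' d) / 2"
  ultimately have r: "c < r" "0 < r" "r < s'" "r < d" using s'0 d by (auto simp: r_def)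
  have "2 * b - s' + d * \<theta> < q * \<theta>" using q(1) \<theta> by (simp add: L_def field_simps)
  then have "b < (s' - d * \<theta> + q * \<theta>) / 2" by simp
  then show thesis using that[of s' q r] s'0 s'(2) q r by (simp add: Q_def m_def c_def)
qed

text \<open>
  The fourth moment needed for \<open>q\<close> comes from lowering the power \<open>2 / \<theta>\<close> if \<open>\<theta> < 1/2\<close> and from raising it
  otherwise; this is the origin of the case distinction in \<open>\<beta>\<close>.
\<close>

lemma pinned_correlation_bound:
  fixes \<mu> :: "'a::euclidean_space measure" and \<theta> s b :: real
  assumes d: "2 \<le> DIM('a)" and P: "prob_space \<mu>" and S: "sets \<mu> = sets borel"
    and R: "R > 0" and supp: "AE x in \<mu>. norm x \<le> R"
    and \<theta>: "0 < \<theta>" "\<theta> < 1" and b: "0 < b" "b \<le> 1"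
    and s: "2 * b < s" "2 * b + DIM('a) * \<theta> < s * (1 + min (2 * \<theta>) 1)"
    and fin: "fourier_moment \<mu> (2 / \<theta>) (s / \<theta>) < \<infinity>"
  obtains C where "C \<ge> 0" "\<And>r. r > 0 \<Longrightarrow> (\<integral>\<^sup>+x. pair_correlation (distr \<mu> borel (dist x)) r \<partial>\<mu>) \<le> ennreal (C * r powr b)"
proof -
  let ?d = "real DIM('a)"
  interpret prob_space \<mu> by fact
  note [measurable_cong] = S
  obtain s' q r where
    s': "0 < s'" "s' \<le> s" and q: "0 < q" "q \<le> ?d" "q < s' * min (2 * \<theta>) 1 / \<theta>" and
    r: "(s' - ?d * \<theta>) / (2 * (1 - \<theta>)) < r" "0 < r" "r < s'" "r \<le> ?d" and
    \<sigma>: "b < (s' - ?d * \<theta> + q * \<theta>) / 2"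
    using admissible_exponents[OF _ \<theta> b s] d by auto
  have fin': "fourier_moment \<mu> (2 / \<theta>) (s' / \<theta>) < \<infinity>"
    using s' \<theta> by (intro fourier_moment_mono[OF P S fin]) (auto simp: divide_right_mono)
  have fin4: "fourier_moment \<mu> 4 q < \<infinity>"
  proof (rule fourier_moment_mono[OF P S fin' q(1)])
    show "(2 / \<theta> \<le> 4 \<and> q \<le> s' / \<theta>) \<or> (4 < 2 / \<theta> \<and> q * (2 / \<theta>) < s' / \<theta> * 4)"
      using \<theta> q(3) by (cases "\<theta> < 1/2") (auto simp: field_simps)
  qed simp
  have fin2: "fourier_moment \<mu> 2 r < \<infinity>"
  proof (rule fourier_moment_mono[OF P S fin' r(2)])
    show "(2 / \<theta> \<le> 2 \<and> r \<le> s' / \<theta>) \<or> (2 < 2 / \<theta> \<and> r * (2 / \<theta>) < s' / \<theta> * 2)"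
      using \<theta> r(3) by (auto simp: field_simps)
  qed simp
  have supp': "AE w in difference_law \<mu>. norm w \<le> 2 * R"
  proof -
    interpret pair_prob_space \<mu> \<mu> ..
    have "AE p in \<mu> \<Otimes>\<^sub>M \<mu>. norm (fst p) \<le> R \<and> norm (snd p) \<le> R"
      by (rule AE_pair_measure) (use supp in \<open>auto elim!: AE_mp\<close>)
    then have "AE p in \<mu> \<Otimes>\<^sub>M \<mu>. norm (snd p - fst p) \<le> 2 * R"
    proof eventually_elim
      case (elim p)
      then show ?case using norm_triangle_ineq4[of "snd p" "fst p"] by simp
    qed
    then show ?thesis unfolding difference_law_def
      by (subst AE_distr_iff) (auto simp: case_prod_beta')
  qed
  obtain K where K: "K \<ge> 0" "\<And>t. t \<ge> 1 \<Longrightarrow>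
       (\<integral>\<^sup>+u. ennreal (cmod (fourier_transform \<mu> u)) * ennreal (smoothed_difference \<mu> t u) \<partial>lborel)
         \<le> ennreal (K * t powr (- ((s' - ?d * \<theta> + q * \<theta>) / 2)))"
    using fourier_smoothed_difference_decay[OF P S _ supp' \<theta> fin' fin4 q(2) fin2 r(1,4)] R by auto
  obtain C where C: "C \<ge> 0" "\<And>r. r > 0 \<Longrightarrow>
    (\<integral>\<^sup>+x. ennreal (gauss x) * (\<integral>\<^sup>+y. \<integral>\<^sup>+y'. ennreal (gauss (((dist x y)\<^sup>2 - (dist x y')\<^sup>2) / r)) \<partial>\<mu> \<partial>\<mu>) \<partial>\<mu>)
     \<le> ennreal (C * r powr b)"
    using triple_gauss_decay[OF P S K b \<sigma>] by auto
  let ?e = "exp (pi * R\<^sup>2 + pi)"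
  show thesis
  proof (rule that[of "?e * (C * (4 * R) powr b)"])
    show "0 \<le> ?e * (C * (4 * R) powr b)" using C by simp
    fix r :: real assume r: "r > 0"
    have "(\<integral>\<^sup>+x. pair_correlation (distr \<mu> borel (dist x)) r \<partial>\<mu>)
      \<le> ennreal ?e * (\<integral>\<^sup>+x. ennreal (gauss x) * (\<integral>\<^sup>+y. \<integral>\<^sup>+y'. ennreal (gauss (((dist x y)\<^sup>2 - (dist x y')\<^sup>2) / (4 * R * r))) \<partial>\<mu> \<partial>\<mu>) \<partial>\<mu>)"
      by (rule pinned_correlation_le_triple_gauss[OF P S R supp r])
    also have "\<dots> \<le> ennreal ?e * ennreal (C * (4 * R * r) powr b)"
      using R r by (intro mult_left_mono C(2)) auto
    also have "\<dots> = ennreal (?e * (C * (4 * R * r) powr b))" using C by (intro ennreal_mult[symmetric]) auto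
    also have "?e * (C * (4 * R * r) powr b) = ?e * (C * (4 * R) powr b) * r powr b"
      using R r powr_mult[of "4 * R" r b] by simp
    finally show "(\<integral>\<^sup>+x. pair_correlation (distr \<mu> borel (dist x)) r \<partial>\<mu>) \<le> ennreal (?e * (C * (4 * R) powr b) * r powr b)" .
  qed
qed

section \<open>Pinned distance sets\<close>

text \<open>
  In the middle case the first term of the maximum gives \<open>2 b + d \<theta> < s\<close>, which is stronger than both
  conclusions. The conclusions are linear in \<open>s\<close>, so that they pass to some finite order below the
  supremum defining the Fourier spectrum.
\<close>

lemma beta_greaterD:
  fixes d :: nat and \<theta> b :: real and s :: ereal
  assumes \<theta>: "0 \<le> \<theta>" "\<theta> \<le> 1" and b: "0 < b" "ereal b < beta d \<theta> s" and s: "0 \<le> s"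
  shows "ereal (2 * b) < s" and "ereal ((2 * b + d * \<theta>) / (1 + min (2 * \<theta>) 1)) < s"
proof -
  have pos: "1 + min (2 * \<theta>) 1 > 0" using \<theta> by simp
  have "ereal (2 * b) < s \<and> ereal ((2 * b + d * \<theta>) / (1 + min (2 * \<theta>) 1)) < s"
  proof (cases s)
    case (real x)
    have x: "0 \<le> x" using s real by simp
    have dt: "0 \<le> d * \<theta>" using \<theta> by simp
    consider "\<theta> = 0" | "0 < \<theta>" "\<theta> < 1/2" | "1/2 \<le> \<theta>" using \<theta> by linarith
    then have "2 * b < x \<and> 2 * b + d * \<theta> < x * (1 + min (2 * \<theta>) 1)"
    proof cases
      case 1
      then have "b < x / 2" using b(2) real by (simp add: beta_def)
      then show ?thesis using 1 by simp
    next
      case 2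
      then have "b < (x - d * \<theta>) / 2 \<or> (b < (x * (1 + 2 * \<theta>) - d * \<theta>) / 2 \<and> b < x / 2)"
        using b(2) real by (auto simp: beta_def less_max_iff_disj)
      then have "2 * b < x - d * \<theta> \<or> (2 * b < x * (1 + 2 * \<theta>) - d * \<theta> \<and> 2 * b < x)" by auto
      moreover have "0 \<le> x * (2 * \<theta>)" using x \<theta> by simp
      moreover have "x * (1 + min (2 * \<theta>) 1) = x + x * (2 * \<theta>)" "x * (1 + 2 * \<theta>) = x + x * (2 * \<theta>)"
        using 2 by (simp_all add: min_def distrib_left)
      ultimately show ?thesis using dt b(1) by (smt (verit))
    next
      case 3
      then have "b < x - d * \<theta> / 2" "b < x / 2" using b(2) real by (auto simp: beta_def)
      then show ?thesis using 3 by simp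
    qed
    then show ?thesis using real pos by (simp add: divide_less_eq)
  qed (use s in auto)
  then show "ereal (2 * b) < s" "ereal ((2 * b + d * \<theta>) / (1 + min (2 * \<theta>) 1)) < s" by auto
qed

lemma fourier_energy_finite_imp_moment:
  fixes \<mu> :: "'a::euclidean_space measure"
  assumes "\<theta> \<noteq> 0" and "fourier_energy s \<theta> \<mu> < \<infinity>"
  shows "fourier_moment \<mu> (2 / \<theta>) (s / \<theta>) < \<infinity>"
  using assms unfolding fourier_energy_def ennreal_powr_def fourier_moment_def
  by (auto simp: less_top split: if_splits)

text \<open>
  The hypotheses on \<open>b\<close> are strict and continuous in \<open>\<theta>\<close> and \<open>s\<close>, so \<open>\<theta>\<close> may be moved slightly into the
  open interval. From \<open>\<theta> = 0\<close> this costs an arbitrarily small part of \<open>s\<close>; from \<open>\<theta> = 1\<close> it replaces \<open>s\<close>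
  by \<open>\<theta>' s\<close>, since raising the power to \<open>2 / \<theta>'\<close> keeps the weight.
\<close>

lemma interior_fourier_moment:
  fixes \<mu> :: "'a::euclidean_space measure" and \<theta> b s :: real
  assumes P: "prob_space \<mu>" and S: "sets \<mu> = sets borel"
    and \<theta>: "0 \<le> \<theta>" "\<theta> \<le> 1" and b: "0 < b"
    and s: "2 * b < s" "2 * b + DIM('a) * \<theta> < s * (1 + min (2 * \<theta>) 1)"
    and fin: "fourier_energy s \<theta> \<mu> < \<infinity>"
  obtains \<theta>' s' :: real where "0 < \<theta>'" "\<theta>' < 1" "2 * b < s'" "2 * b + DIM('a) * \<theta>' < s' * (1 + min (2 * \<theta>') 1)"
    "fourier_moment \<mu> (2 / \<theta>') (s' / \<theta>') < \<infinity>"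
proof -
  let ?d = "real DIM('a)"
  have d: "?d > 0" by simp
  consider "\<theta> = 0" | "0 < \<theta>" "\<theta> < 1" | "\<theta> = 1" using \<theta> by linarith
  then show thesis
  proof cases
    case 1
    define s' where "s' = (2 * b + s) / 2"
    \<comment> \<open>The second entry makes \<open>d \<theta>'\<close> at most half of the gap between \<open>2 b\<close> and \<open>s'\<close>.\<close>
    define \<theta>' where "\<theta>' = min (1/4) ((s' - 2 * b) / (2 * ?d))"
    have s': "2 * b < s'" "s' < s" using s by (auto simp: s'_def)
    have \<theta>': "0 < \<theta>'" "\<theta>' < 1" "\<theta>' \<le> 1/4"
    proof -
      show "0 < \<theta>'" using s' d by (simp add: \<theta>'_def)
      show le: "\<theta>' \<le> 1/4" unfolding \<theta>'_def by (rule min.cobounded1)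
      show "\<theta>' < 1" using le by simp
    qed
    have "fourier_energy s 0 \<mu> < \<infinity>" using fin 1 by simp
    then have "(SUP z. ennreal ((cmod (fourier_transform \<mu> z))\<^sup>2 * norm z powr s)) < \<infinity>"
      by (simp add: fourier_energy_def)
    then obtain B where B: "B \<ge> 0" "(SUP z. ennreal ((cmod (fourier_transform \<mu> z))\<^sup>2 * norm z powr s)) = ennreal B"
      by (cases "SUP z. ennreal ((cmod (fourier_transform \<mu> z))\<^sup>2 * norm z powr s)") auto
    have decay: "(cmod (fourier_transform \<mu> z))\<^sup>2 * norm z powr s \<le> B" for z
    proof -
      have "ennreal ((cmod (fourier_transform \<mu> z))\<^sup>2 * norm z powr s) \<le> ennreal B"
        unfolding B(2)[symmetric] by (rule SUP_upper) simp
      then show ?thesis using B(1) by (simp add: ennreal_le_iff)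
    qed
    have "fourier_moment \<mu> (2 / \<theta>') (s' / \<theta>') < \<infinity>"
      using \<theta>' s' b by (intro fourier_moment_of_decay[OF P S decay]) (auto simp: divide_strict_right_mono)
    moreover have "2 * b + ?d * \<theta>' < s' * (1 + min (2 * \<theta>') 1)"
    proof -
      have "\<theta>' \<le> (s' - 2 * b) / (2 * ?d)" by (simp add: \<theta>'_def)
      then have "2 * (?d * \<theta>') \<le> s' - 2 * b" using d by (simp add: field_simps)
      then have "2 * b + ?d * \<theta>' < s'" using s'(1) by linarith
      moreover have "0 \<le> s' * min (2 * \<theta>') 1" using \<theta>' s' b by simp
      ultimately show ?thesis by (simp add: distrib_left)
    qed
    ultimately show thesis using that[of \<theta>' s'] \<theta>' s' by blast
  next
    case 2
    then show thesis using that[of \<theta> s] s fourier_energy_finite_imp_moment[OF _ fin] by auto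
  next
    case 3
    have s2: "2 * b + ?d < 2 * s" using s(2) 3 by simp
    have s0: "0 < s" "0 < 2 * s - ?d" using s(1) s2 b by linarith+
    \<comment> \<open>The two quotients are the thresholds that \<open>\<theta>'\<close> must exceed when \<open>s\<close> becomes \<open>\<theta>' s\<close>.\<close>
    define m where "m = max (1/2) (max (2 * b / s) (2 * b / (2 * s - ?d)))"
    define \<theta>' where "\<theta>' = (1 + m) / 2"
    have "m < 1" using s(1) s2 s0 by (auto simp: m_def)
    then have \<theta>': "m < \<theta>'" "\<theta>' < 1" by (auto simp: \<theta>'_def)
    then have \<theta>'2: "1/2 < \<theta>'" "2 * b / s < \<theta>'" "2 * b / (2 * s - ?d) < \<theta>'" by (auto simp: m_def)
    have fin2: "fourier_moment \<mu> 2 s < \<infinity>"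
      using fourier_energy_finite_imp_moment[OF _ fin] 3 by simp
    have "2 \<le> 2 / \<theta>'" using \<theta>' \<theta>'2(1) by (simp add: le_divide_eq)
    then have "fourier_moment \<mu> (2 / \<theta>') s < \<infinity>"
      using \<theta>'2(1) by (intro fourier_moment_mono[OF P S fin2 s0(1)]) auto
    then have "fourier_moment \<mu> (2 / \<theta>') ((\<theta>' * s) / \<theta>') < \<infinity>"
      using \<theta>'2(1) by simp
    moreover have "2 * b < \<theta>' * s" using \<theta>'2(2) s0(1) by (simp add: divide_less_eq)
    moreover have "2 * b + ?d * \<theta>' < \<theta>' * s * (1 + min (2 * \<theta>') 1)"
    proof -
      have "2 * b < \<theta>' * (2 * s - ?d)" using \<theta>'2(3) s0(2) by (simp add: divide_less_eq)
      moreover have "min (2 * \<theta>') 1 = 1" using \<theta>'2(1) by simp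
      ultimately show ?thesis by (simp add: algebra_simps)
    qed
    ultimately show thesis using that[of \<theta>' "\<theta>' * s"] \<theta>'(2) \<theta>'2(1) by auto
  qed
qed

lemma pinned_correlation_bound_of_beta:
  fixes \<mu> :: "'a::euclidean_space measure" and \<theta> b :: real
  assumes d: "2 \<le> DIM('a)" and P: "prob_space \<mu>" and S: "sets \<mu> = sets borel" and K: "compact (msupp \<mu>)"
    and \<theta>: "0 \<le> \<theta>" "\<theta> \<le> 1" and b: "0 < b" "b \<le> 1" "ereal b < beta DIM('a) \<theta> (fourier_spectrum \<theta> \<mu>)"
  shows "\<exists>C\<ge>0. \<forall>r>0. (\<integral>\<^sup>+x. pair_correlation (distr \<mu> borel (dist x)) r \<partial>\<mu>) \<le> ennreal (C * r powr b)"
proof -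
  have "bounded (msupp \<mu>)" using K by (rule compact_imp_bounded)
  then obtain R where R: "R > 0" "\<forall>x\<in>msupp \<mu>. norm x \<le> R" by (auto simp: bounded_pos)
  have supp: "AE x in \<mu>. norm x \<le> R" using AE_in_msupp[OF S] by eventually_elim (use R in auto)
  let ?s = "fourier_spectrum \<theta> \<mu>"
  have s0: "0 \<le> ?s" unfolding fourier_spectrum_def by (rule Sup_upper) simp
  define L where "L = max (2 * b) ((2 * b + DIM('a) * \<theta>) / (1 + min (2 * \<theta>) 1))"
  have "ereal L < ?s" using beta_greaterD[OF \<theta> b(1,3) s0] by (simp add: L_def max_def)
  then obtain a where a: "a \<in> insert 0 {ereal s | s. 0 \<le> s \<and> fourier_energy s \<theta> \<mu> < \<infinity>}" "ereal L < a"
    unfolding fourier_spectrum_def less_Sup_iff by blast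
  have "L > 0" using b by (simp add: L_def)
  then obtain s where s: "L < s" "fourier_energy s \<theta> \<mu> < \<infinity>" using a by auto
  have "1 + min (2 * \<theta>) 1 > 0" using \<theta> by simp
  then have "2 * b < s" "2 * b + DIM('a) * \<theta> < s * (1 + min (2 * \<theta>) 1)"
    using s(1) by (auto simp: L_def divide_less_eq)
  from interior_fourier_moment[OF P S \<theta> b(1) this s(2)] obtain \<theta>' s' :: real where
    par: "0 < \<theta>'" "\<theta>' < 1" "2 * b < s'" "2 * b + DIM('a) * \<theta>' < s' * (1 + min (2 * \<theta>') 1)"
    "fourier_moment \<mu> (2 / \<theta>') (s' / \<theta>') < \<infinity>" .
  show ?thesis
  proof (rule pinned_correlation_bound[OF d P S R(1) supp par(1,2) b(1,2) par(3-5)])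
    fix C :: real
    assume "C \<ge> 0" "\<And>r. r > 0 \<Longrightarrow> (\<integral>\<^sup>+x. pair_correlation (distr \<mu> borel (dist x)) r \<partial>\<mu>) \<le> ennreal (C * r powr b)"
    then show ?thesis by auto
  qed
qed

lemma pinned_distance_law:
  fixes \<mu> :: "'a::euclidean_space measure"
  assumes P: "prob_space \<mu>" and S: "sets \<mu> = sets borel" and K: "compact (msupp \<mu>)"
  shows "prob_space (distr \<mu> borel (dist x))" and "compact (pinned_distance_set x (msupp \<mu>))"
    and "AE u in distr \<mu> borel (dist x). u \<in> pinned_distance_set x (msupp \<mu>)"
proof -
  interpret prob_space \<mu> by fact
  note [measurable_cong] = S
  show "prob_space (distr \<mu> borel (dist x))" by (rule prob_space_distr) measurable
  show c: "compact (pinned_distance_set x (msupp \<mu>))"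
    unfolding pinned_distance_set_def using K by (intro compact_continuous_image continuous_intros)
  have "{u \<in> space borel. u \<in> pinned_distance_set x (msupp \<mu>)} \<in> sets borel"
    using borel_compact[OF c] by simp
  moreover have dm: "dist x \<in> borel_measurable \<mu>" by measurable
  moreover have "AE y in \<mu>. dist x y \<in> pinned_distance_set x (msupp \<mu>)"
    using AE_in_msupp[OF S] by eventually_elim (auto simp: pinned_distance_set_def)
  ultimately show "AE u in distr \<mu> borel (dist x). u \<in> pinned_distance_set x (msupp \<mu>)"
    by (subst AE_distr_iff) (auto intro: dm)
qed

text \<open>
  For each rational \<open>a < B\<close> a bound with a larger exponent makes the weighted dyadic series integrable in
  \<open>x\<close>, hence finite almost everywhere; countably many exponents suffice to reach \<open>B\<close>.
\<close>

lemma AE_hausdorff_dim_pinned: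
  fixes \<mu> :: "'a::euclidean_space measure" and B :: ereal
  assumes P: "prob_space \<mu>" and S: "sets \<mu> = sets borel" and K: "compact (msupp \<mu>)"
    and bound: "\<And>b. 0 < b \<Longrightarrow> ereal b < B \<Longrightarrow> \<exists>C\<ge>0. \<forall>r>0.
        (\<integral>\<^sup>+x. pair_correlation (distr \<mu> borel (dist x)) r \<partial>\<mu>) \<le> ennreal (C * r powr b)"
  shows "AE x in \<mu>. B \<le> hausdorff_dim (pinned_distance_set x (msupp \<mu>))"
proof -
  let ?c = "\<lambda>x r. pair_correlation (distr \<mu> borel (dist x)) r"
  have [measurable]: "(\<lambda>x. ?c x r) \<in> borel_measurable \<mu>" for r
    using pair_correlation_pinned_measurable[OF P S] by (simp add: measurable_cong_sets[OF S refl])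
  have one: "AE x in \<mu>. (\<Sum>k. ennreal (2 powr (a * real k)) * ?c x ((1/2) ^ k)) \<noteq> \<infinity>"
    if a: "0 < a" "ereal a < B" for a
  proof (rule nn_integral_PInf_AE)
    show "(\<lambda>x. \<Sum>k. ennreal (2 powr (a * real k)) * ?c x ((1/2) ^ k)) \<in> borel_measurable \<mu>" by measurable
    obtain b where b: "a < b" "ereal b < B" using ereal_dense2[OF a(2)] by auto
    obtain C where C: "C \<ge> 0" "\<And>r. r > 0 \<Longrightarrow> (\<integral>\<^sup>+x. ?c x r \<partial>\<mu>) \<le> ennreal (C * r powr b)"
      using bound[of b] a b by auto
    define x where "x = 2 powr (a - b)"
    have x: "0 < x" "x < 1" using b by (auto simp: x_def powr_less_one)
    have "(\<integral>\<^sup>+x. (\<Sum>k. ennreal (2 powr (a * real k)) * ?c x ((1/2) ^ k)) \<partial>\<mu>)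
      = (\<Sum>k. ennreal (2 powr (a * real k)) * (\<integral>\<^sup>+x. ?c x ((1/2) ^ k) \<partial>\<mu>))"
      by (subst nn_integral_suminf) (auto simp: nn_integral_cmult)
    also have "\<dots> \<le> (\<Sum>k. ennreal (C * x ^ k))"
    proof (rule suminf_le)
      fix k :: nat
      have "ennreal (2 powr (a * real k)) * (\<integral>\<^sup>+x. ?c x ((1/2) ^ k) \<partial>\<mu>)
        \<le> ennreal (2 powr (a * real k)) * ennreal (C * ((1/2) ^ k) powr b)"
        by (intro mult_left_mono C(2)) auto
      also have "\<dots> = ennreal (2 powr (a * real k) * (C * ((1/2) ^ k) powr b))"
        using C by (intro ennreal_mult[symmetric]) auto
      also have "2 powr (a * real k) * (C * ((1/2) ^ k) powr b) = C * x ^ k"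
      proof -
        have "((1/2) ^ k) powr b = 1 / (2 ^ k) powr b" by (simp add: power_divide powr_divide)
        also have "\<dots> = 2 powr (- b * real k)"
          unfolding two_power_powr using powr_minus_divide[of 2 "b * real k"] by simp
        finally have 1: "((1/2) ^ k) powr b = 2 powr (- b * real k)" .
        have "2 powr (a * real k) * 2 powr (- b * real k) = 2 powr ((a - b) * real k)"
          unfolding powr_add[symmetric] by (simp add: algebra_simps)
        also have "\<dots> = x ^ k" by (simp add: x_def powr_powr flip: powr_realpow)
        finally show ?thesis unfolding 1 by (simp add: mult.left_commute)
      qed
      finally show "ennreal (2 powr (a * real k)) * (\<integral>\<^sup>+x. ?c x ((1/2) ^ k) \<partial>\<mu>) \<le> ennreal (C * x ^ k)" .
    qed auto
    also have "\<dots> = ennreal (\<Sum>k. C * x ^ k)"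
      using x C by (intro suminf_ennreal2) (auto intro!: summable_mult summable_geometric)
    finally show "(\<integral>\<^sup>+x. (\<Sum>k. ennreal (2 powr (a * real k)) * ?c x ((1/2) ^ k)) \<partial>\<mu>) \<noteq> \<infinity>"
      by (auto simp: top_unique)
  qed
  have "AE x in \<mu>. \<forall>a\<in>{a \<in> \<rat>. 0 < a \<and> ereal a < B}. (\<Sum>k. ennreal (2 powr (a * real k)) * ?c x ((1/2) ^ k)) \<noteq> \<infinity>"
  proof (subst AE_ball_countable)
    show "countable {a \<in> \<rat>. 0 < a \<and> ereal a < B}"
      by (rule countable_subset[OF _ countable_rat]) auto
  qed (use one in auto)
  then show ?thesis
  proof eventually_elim
    case (elim x)
    show ?case
    proof (rule hausdorff_dim_ge)
      fix s assume s: "0 \<le> s" "ereal s < B"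
      obtain y where y: "ereal s < ereal y" "ereal y < B" using ereal_dense2[OF s(2)] by auto
      then obtain a where a: "a \<in> \<rat>" "s < a" "a < y" using Rats_dense_in_real[of s y] by auto
      have aB: "ereal a < B" using a(3) y(2) by (metis less_ereal.simps(1) less_trans)
      then have "(\<Sum>k. ennreal (2 powr (a * real k)) * ?c x ((1/2) ^ k)) < \<infinity>"
        using elim a s by (auto simp: less_top)
      then show "hausdorff_measure s (pinned_distance_set x (msupp \<mu>)) \<noteq> 0"
        using a s by (intro hausdorff_measure_pos[OF pinned_distance_law(1)[OF P S K] _ pinned_distance_law(3)[OF P S K], where \<sigma> = a]) auto
    qed
  qed
qed

text \<open>
  Fatou's lemma: the lower limit of the normalised pair correlations is integrable in \<open>x\<close>, hence finite
  almost everywhere, which gives the linear bound at infinitely many dyadic radii.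
\<close>

lemma AE_lborel_pinned_pos:
  fixes \<mu> :: "'a::euclidean_space measure"
  assumes P: "prob_space \<mu>" and S: "sets \<mu> = sets borel" and K: "compact (msupp \<mu>)" and C0: "C \<ge> 0"
    and bound: "\<And>r. r > 0 \<Longrightarrow> (\<integral>\<^sup>+x. pair_correlation (distr \<mu> borel (dist x)) r \<partial>\<mu>) \<le> ennreal (C * r)"
  shows "AE x in \<mu>. emeasure lborel (pinned_distance_set x (msupp \<mu>)) > 0"
proof -
  let ?c = "\<lambda>x k. ennreal (2 ^ k) * pair_correlation (distr \<mu> borel (dist x)) ((1/2) ^ k)"
  have m[measurable]: "(\<lambda>x. pair_correlation (distr \<mu> borel (dist x)) r) \<in> borel_measurable \<mu>" for r
    using pair_correlation_pinned_measurable[OF P S] by (simp add: measurable_cong_sets[OF S refl])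
  have "AE x in \<mu>. liminf (?c x) \<noteq> \<infinity>"
  proof (rule nn_integral_PInf_AE)
    show "(\<lambda>x. liminf (?c x)) \<in> borel_measurable \<mu>" by measurable
    have "(\<integral>\<^sup>+x. liminf (?c x) \<partial>\<mu>) \<le> liminf (\<lambda>k. \<integral>\<^sup>+x. ?c x k \<partial>\<mu>)"
      by (rule nn_integral_liminf) measurable
    also have "\<dots> \<le> liminf (\<lambda>k. ennreal C)"
    proof (rule Liminf_mono, rule always_eventually, rule allI)
      fix k :: nat
      have "(\<integral>\<^sup>+x. ?c x k \<partial>\<mu>) = ennreal (2 ^ k) * (\<integral>\<^sup>+x. pair_correlation (distr \<mu> borel (dist x)) ((1/2) ^ k) \<partial>\<mu>)"
        by (rule nn_integral_cmult) (rule m)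
      also have "\<dots> \<le> ennreal (2 ^ k) * ennreal (C * (1/2) ^ k)"
        by (intro mult_left_mono bound) auto
      also have "\<dots> = ennreal C"
        using C0 by (subst ennreal_mult[symmetric]) (auto simp: power_divide)
      finally show "(\<integral>\<^sup>+x. ?c x k \<partial>\<mu>) \<le> ennreal C" .
    qed
    also have "\<dots> = ennreal C" by (rule Liminf_const) simp
    finally show "(\<integral>\<^sup>+x. liminf (?c x) \<partial>\<mu>) \<noteq> \<infinity>" by (auto simp: top_unique)
  qed
  then show ?thesis
  proof eventually_elim
    case (elim x)
    then obtain M :: nat where M: "liminf (?c x) < of_nat M"
      by (metis ennreal_Ex_less_of_nat infinity_ennreal_def top.not_eq_extremum)
    show ?case
    proof (rule lborel_pos_of_pair_correlation[OF pinned_distance_law(1)[OF P S K] _ pinned_distance_law(2,3)[OF P S K], where M = "real M + 1"])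
      fix n :: nat
      show "\<exists>k\<ge>n. pair_correlation (distr \<mu> borel (dist x)) ((1/2) ^ k) \<le> ennreal ((real M + 1) * (1/2) ^ k)"
      proof (rule ccontr)
        assume no: "\<not> ?thesis"
        have "of_nat M \<le> liminf (?c x)"
        proof (rule Liminf_bounded, rule eventually_sequentiallyI)
          fix k assume k: "n \<le> k"
          have "ennreal ((real M + 1) * (1/2) ^ k) \<le> pair_correlation (distr \<mu> borel (dist x)) ((1/2) ^ k)"
            using no k by (meson linear)
          then have "ennreal (2 ^ k) * ennreal ((real M + 1) * (1/2) ^ k) \<le> ?c x k" by (rule mult_left_mono) simp
          moreover have "ennreal (2 ^ k) * ennreal ((real M + 1) * (1/2) ^ k) = ennreal (real M + 1)"
            by (subst ennreal_mult[symmetric]) (auto simp: power_divide)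
          moreover have "of_nat M \<le> ennreal (real M + 1)"
            unfolding ennreal_of_nat_eq_real_of_nat by (intro ennreal_leI) simp
          ultimately show "of_nat M \<le> ?c x k" by simp
        qed
        then show False using M by simp
      qed
    qed auto
  qed
qed

theorem corollary2p5:
  fixes \<mu> :: "(real ^ 'n) measure" and \<theta> :: real and s :: ereal
  assumes "CARD('n) \<ge> 2"
    and "sets \<mu> = sets borel" and "prob_space \<mu>" and "compact (msupp \<mu>)"
    and "0 \<le> \<theta>" and "\<theta> \<le> 1"
    and "s = fourier_spectrum \<theta> \<mu>"
  shows "(beta CARD('n) \<theta> s > 0 \<longrightarrow>
            (AE x in \<mu>. hausdorff_dim (pinned_distance_set x (msupp \<mu>))
                          \<ge> min 1 (beta CARD('n) \<theta> s)))
       \<and> (beta CARD('n) \<theta> s > 1 \<longrightarrow>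
            (AE x in \<mu>. emeasure lborel (pinned_distance_set x (msupp \<mu>)) > 0))"
proof -
  have dim: "DIM(real ^ 'n) = CARD('n)" by simp
  have d: "2 \<le> DIM(real ^ 'n)" using assms(1) unfolding dim .
  have bound: "\<exists>C\<ge>0. \<forall>r>0. (\<integral>\<^sup>+x. pair_correlation (distr \<mu> borel (dist x)) r \<partial>\<mu>) \<le> ennreal (C * r powr b)"
    if b: "0 < b" "b \<le> 1" "ereal b < beta CARD('n) \<theta> s" for b
  proof -
    have "ereal b < beta DIM(real ^ 'n) \<theta> (fourier_spectrum \<theta> \<mu>)"
      using b(3) unfolding dim assms(7) .
    then show ?thesis
      by (rule pinned_correlation_bound_of_beta[OF d assms(3,2,4,5,6) b(1,2)])
  qed
  show ?thesis
  proof (intro conjI impI)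
    show "AE x in \<mu>. min 1 (beta CARD('n) \<theta> s) \<le> hausdorff_dim (pinned_distance_set x (msupp \<mu>))"
      by (rule AE_hausdorff_dim_pinned[OF assms(3,2,4)]) (use bound in auto)
  next
    assume "beta CARD('n) \<theta> s > 1"
    then obtain C :: real where C: "C \<ge> 0" "\<forall>r>0. (\<integral>\<^sup>+x. pair_correlation (distr \<mu> borel (dist x)) r \<partial>\<mu>) \<le> ennreal (C * r powr 1)"
      using bound[of 1] by (auto simp: one_ereal_def)
    show "AE x in \<mu>. emeasure lborel (pinned_distance_set x (msupp \<mu>)) > 0"
      by (rule AE_lborel_pinned_pos[OF assms(3,2,4) C(1)]) (use C(2) in auto)
  qed
qed

end
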